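(* Let $\mu,\nu\in\mathcal{P}_2(\mathbb{R}^d)$. The mapping $\mathcal{P}_2(\mathbb{R}^d)\ni\sigma\mapsto W_2^2(\sigma,\nu)$ is $L$-differentiable at $\mu$ if and only if there exists a measurable function $T:\mathbb{R}^d\to\mathbb{R}^d$ such that $\Pi^{opt}(\mu,\nu)=\{(I_d,T)\#\mu\}$. In that case, for $Y\in L^2(\Omega,\mathbb{P};\mathbb{R}^d)$ with $Y\sim\nu$, the Fréchet derivative of the function $L^2(\Omega,\mathbb{P};\mathbb{R}^d)\ni Z\mapsto\mathbb{W}_2^2(Z,Y)$ at $X\sim\mu$ is given by $2(X-T(X))$.
   Context: $\mathcal{P}_2(\mathbb{R}^d)$ is the set of Borel probability measures on $\mathbb{R}^d$ with finite second order moment, $|\cdot|$ is the Euclidean norm, $\Pi(\mu,\nu)$ is the set of probability measures on $\mathbb{R}^d\times\mathbb{R}^d$ with first marginal $\mu$ and second marginal $\nu$, $W_2^2(\mu,\nu)=\inf_{\pi\in\Pi(\mu,\nu)}\int|y-x|^2\pi(dx,dy)$, and $\Pi^{opt}(\mu,\nu)$ is the (non-empty) set of $\pi\in\Pi(\mu,\nu)$ attaining this infimum. $I_d$ is the identity map of $\mathbb{R}^d$ and $\#$ denotes push-forward. $(\Omega,\mathcal{A},\mathbb{P})$ is a fixed atomless probability space (equivalently, it supports a random variable uniformly distributed on $[0,1]$), $L^2(\Omega,\mathbb{P};\mathbb{R}^d)$ is the space of $\mathbb{R}^d$-valued square integrable random variables on it, $\mathcal{L}(X)$ is the law of $X$,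 and $X\sim\mu$ means $\mathcal{L}(X)=\mu$. The lift of $f:\mathcal{P}_2(\mathbb{R}^d)\to\mathbb{R}$ is $F:L^2(\Omega,\mathbb{P};\mathbb{R}^d)\to\mathbb{R}$, $F(X)=f(\mathcal{L}(X))$. The function $f$ is $L$-differentiable at $\mu$ if there exists $X\in L^2(\Omega,\mathbb{P};\mathbb{R}^d)$ with $X\sim\mu$ such that $F$ is Fréchet differentiable at $X$. When $F$ is Fréchet differentiable at $X$, its Fréchet derivative $DF(X)$ is the element of $L^2(\Omega,\mathbb{P};\mathbb{R}^d)$ representing the differential by the Riesz theorem: $F(X+H)=F(X)+\mathbb{E}[DF(X)\cdot H]+o(\|H\|_2)$ as $\|H\|_2=\mathbb{E}^{1/2}[|H|^2]\to0$. For $X,Y\in L^2(\Omega,\mathbb{P};\mathbb{R}^d)$ with $X\sim\mu$ and $Y\sim\nu$, $\mathbb{W}_2^2(X,Y)=\sup\{\mathbb{E}[\psi(X)+\tilde\psi(Y)]:\psi\in L^1(\mu),\tilde\psi\in L^1(\nu),\psi(x)+\tilde\psi(y)\le|x-y|^2\}$, which equals $W_2^2(\mathcal{L}(X),\mathcal{L}(Y))$ by Kantorovich duality; thus $Z\mapsto\mathbb{W}_2^2(Z,Y)$ is the lift of $\sigma\mapsto W_2^2(\sigma,\nu)$ when $Y\sim\nu$. *)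

theory Defs
  imports "HOL-Probability.Probability"
begin

section \<open>Probability measures with finite second moment and the Wasserstein distance\<close>

definition P2 :: "'a::euclidean_space measure set" where
  "P2 = {\<mu>. prob_space \<mu> \<and> sets \<mu> = sets borel \<and> integrable \<mu> (\<lambda>x. (norm x)\<^sup>2)}"

definition couplings ::
    "'a::euclidean_space measure \<Rightarrow> 'a measure \<Rightarrow> ('a \<times> 'a) measure set" where
  "couplings \<mu> \<nu> =
     {\<pi>. prob_space \<pi> \<and> sets \<pi> = sets borel \<and> distr \<pi> borel fst = \<mu> \<and> distr \<pi> borel snd = \<nu>}"

definition transport_cost :: "('a::euclidean_space \<times> 'a) measure \<Rightarrow> real" where
  "transport_cost \<pi> = (\<integral>z. (norm (snd z - fst z))\<^sup>2 \<partial>\<pi>)"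

text \<open>
  The squared distance. For arguments in \<^const>\<open>P2\<close> the infimum ranges over a non-empty set of
  nonnegative reals, all the integrals being finite; elsewhere the value carries no meaning.
\<close>
definition W2sq :: "'a::euclidean_space measure \<Rightarrow> 'a measure \<Rightarrow> real" where
  "W2sq \<mu> \<nu> = (INF \<pi>\<in>couplings \<mu> \<nu>. transport_cost \<pi>)"

definition optimal_couplings ::
    "'a::euclidean_space measure \<Rightarrow> 'a measure \<Rightarrow> ('a \<times> 'a) measure set" where
  "optimal_couplings \<mu> \<nu> = {\<pi> \<in> couplings \<mu> \<nu>. transport_cost \<pi> = W2sq \<mu> \<nu>}"

section \<open>Square integrable random vectors\<close>

definition atomless :: "'w measure \<Rightarrow> bool" where
  "atomless M \<longleftrightarrow>
     (\<forall>A\<in>sets M. 0 < measure M A \<longrightarrow>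
        (\<exists>B\<in>sets M. B \<subseteq> A \<and> 0 < measure M B \<and> measure M B < measure M A))"

text \<open>
  Elements of $L^2$ are handled through representatives: \<open>L2_rv M\<close> consists of functions, not of
  classes modulo almost sure equality, and \<open>L2_norm M\<close> is a seminorm on it.
\<close>
definition L2_rv :: "'w measure \<Rightarrow> ('w \<Rightarrow> 'a::euclidean_space) set" where
  "L2_rv M = {X \<in> borel_measurable M. integrable M (\<lambda>\<omega>. (norm (X \<omega>))\<^sup>2)}"

definition L2_norm :: "'w measure \<Rightarrow> ('w \<Rightarrow> 'a::euclidean_space) \<Rightarrow> real" where
  "L2_norm M X = sqrt (\<integral>\<omega>. (norm (X \<omega>))\<^sup>2 \<partial>M)"

abbreviation law :: "'w measure \<Rightarrow> ('w \<Rightarrow> 'a::euclidean_space) \<Rightarrow> 'a measure" where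
  "law M X \<equiv> distr M borel X"

section \<open>Frechet differentiability on $L^2$\<close>

text \<open>
  Continuous linear forms on $L^2$. The bound makes \<open>D\<close> insensitive to the choice of the
  representative.
\<close>
definition L2_bounded_linear ::
    "'w measure \<Rightarrow> (('w \<Rightarrow> 'a::euclidean_space) \<Rightarrow> real) \<Rightarrow> bool" where
  "L2_bounded_linear M D \<longleftrightarrow>
     (\<forall>H\<in>L2_rv M. \<forall>K\<in>L2_rv M. D (\<lambda>\<omega>. H \<omega> + K \<omega>) = D H + D K) \<and>
     (\<forall>c. \<forall>H\<in>L2_rv M. D (\<lambda>\<omega>. c *\<^sub>R H \<omega>) = c * D H) \<and>
     (\<exists>C. \<forall>H\<in>L2_rv M. \<bar>D H\<bar> \<le> C * L2_norm M H)"

definition has_L2_differential ::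
    "'w measure \<Rightarrow> (('w \<Rightarrow> 'a::euclidean_space) \<Rightarrow> real) \<Rightarrow> ('w \<Rightarrow> 'a) \<Rightarrow>
     (('w \<Rightarrow> 'a) \<Rightarrow> real) \<Rightarrow> bool" where
  "has_L2_differential M F X D \<longleftrightarrow>
     L2_bounded_linear M D \<and>
     (\<forall>\<epsilon>>0. \<exists>\<delta>>0. \<forall>H\<in>L2_rv M. L2_norm M H < \<delta> \<longrightarrow>
        \<bar>F (\<lambda>\<omega>. X \<omega> + H \<omega>) - F X - D H\<bar> \<le> \<epsilon> * L2_norm M H)"

definition frechet_differentiable_at ::
    "'w measure \<Rightarrow> (('w \<Rightarrow> 'a::euclidean_space) \<Rightarrow> real) \<Rightarrow> ('w \<Rightarrow> 'a) \<Rightarrow> bool" where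
  "frechet_differentiable_at M F X \<longleftrightarrow> (\<exists>D. has_L2_differential M F X D)"

text \<open>
  \<open>G\<close> is (a representative of) the Frechet derivative \<open>DF(X)\<close>, i.e. the Riesz representative of
  the differential; it is determined up to almost sure equality.
\<close>
definition has_frechet_derivative ::
    "'w measure \<Rightarrow> (('w \<Rightarrow> 'a::euclidean_space) \<Rightarrow> real) \<Rightarrow> ('w \<Rightarrow> 'a) \<Rightarrow> ('w \<Rightarrow> 'a) \<Rightarrow> bool"
  where
  "has_frechet_derivative M F X G \<longleftrightarrow>
     G \<in> L2_rv M \<and> has_L2_differential M F X (\<lambda>H. \<integral>\<omega>. G \<omega> \<bullet> H \<omega> \<partial>M)"

definition L2_lift ::
    "'w measure \<Rightarrow> ('a::euclidean_space measure \<Rightarrow> real) \<Rightarrow> ('w \<Rightarrow> 'a) \<Rightarrow> real" where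
  "L2_lift M f X = f (law M X)"

definition L_differentiable_at ::
    "'w measure \<Rightarrow> ('a::euclidean_space measure \<Rightarrow> real) \<Rightarrow> 'a measure \<Rightarrow> bool" where
  "L_differentiable_at M f \<mu> \<longleftrightarrow>
     (\<exists>X\<in>L2_rv M. law M X = \<mu> \<and> frechet_differentiable_at M (L2_lift M f) X)"

section \<open>The squared distance between random vectors, by Kantorovich's dual problem\<close>

text \<open>
  For \<open>X\<close>, \<open>Y\<close> in \<^const>\<open>L2_rv\<close> over a probability space the set below contains 0 and is bounded
  above, so that \<^const>\<open>Sup\<close> on the reals is a genuine supremum.
\<close>
definition WWsq ::
    "'w measure \<Rightarrow> ('w \<Rightarrow> 'a::euclidean_space) \<Rightarrow> ('w \<Rightarrow> 'a) \<Rightarrow> real" where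
  "WWsq M X Y =
     Sup {(\<integral>\<omega>. \<psi> (X \<omega>) + \<phi> (Y \<omega>) \<partial>M) | \<psi> \<phi>.
            integrable (law M X) \<psi> \<and> integrable (law M Y) \<phi> \<and>
            (\<forall>x y. \<psi> x + \<phi> y \<le> (norm (x - y))\<^sup>2)}"

end

theory Submission
  imports Defs
begin

text \<open>
  Write $F(Z) = W_2^2(\mathcal L(Z), \nu)$. Since the space is atomless, every coupling of
  $\mathcal L(Z)$ and $\nu$ is approximated by pairs $(Z, Y)$ with $Y \sim \nu$, so
  $F(Z) = \inf_{Y \sim \nu} E|Z - Y|^2 = E|Z|^2 + E|Y|^2 - 2 \sup_{Y \sim \nu} E[Z \cdot Y]$ and, as for
  every support function, $F$ is Frechet differentiable at $X$ if and only if all near-optimal $Y$ are close to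
  each other in $L^2$.

  If $F$ is differentiable at $X$, two near-optimal variables can be built from optimal
  couplings so as to be conditionally independent given the cell of $X$ in a fine finite partition. Being
  close to each other, they are close to their conditional mean; hence every optimal coupling sits on
  the graph of one and the same map. Conversely, if the only optimal coupling is given by a map $T$,
  then compactness shows that near-optimal $Y$ are close to $T(X)$, which gives the derivative
  $2(X - T(X))$.

  The functional $\mathbb W_2^2$ agrees with $W_2^2$ by Kantorovich duality, obtained from finite
  transport problems on the cells of fine partitions.
\<close>

section \<open>Square integrable functions\<close>

text \<open>The obstacle is that \<open>M\<close> need not have any randomness left beyond X: if X
  generates all events, every Y is a function of X, and a coupling not carried by a graph is never
  the law of a pair (X, Y). Couplings are therefore realised with a first component that is only
  L^2-close to X, and every argument has to tolerate near-optimal Y with a positive slack. The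
  device used throughout is the finite partition by a simple function: it prescribes cell weights on
  \<open>M\<close>, yields convergent subsequences, glues two measures by a density that is constant
  on product cells, and discretises the dual problem. Compactness loses no second moment because
  both marginals stay fixed along the sequence, so that one simple function per marginal
  approximates the identity uniformly. Differentiability is assumed at a single X, but the condition
  it yields concerns only \<mu> and \<nu>; this is why the derivative formula then holds at every X
  of law \<mu>.\<close>

lemma L2_rvD [measurable_dest]: "X \<in> L2_rv M \<Longrightarrow> X \<in> borel_measurable M"
  by (simp add: L2_rv_def)

lemma L2_rv_integrable: "X \<in> L2_rv M \<Longrightarrow> integrable M (\<lambda>\<omega>. (norm (X \<omega>))\<^sup>2)"
  by (simp add: L2_rv_def)

lemma L2_rv_bound:
  fixes X :: "'w \<Rightarrow> 'a::euclidean_space"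
  assumes "X \<in> borel_measurable M" "integrable M g" "\<And>\<omega>. (norm (X \<omega>))\<^sup>2 \<le> g \<omega>"
  shows "X \<in> L2_rv M"
  unfolding L2_rv_def
proof safe
  show "integrable M (\<lambda>\<omega>. (norm (X \<omega>))\<^sup>2)"
    using assms(1,2) by (rule_tac Bochner_Integration.integrable_bound[of M g])
      (auto intro!: AE_I2 order_trans[OF assms(3)])
qed fact

lemma norm_add_sq_le: "(norm (x + y))\<^sup>2 \<le> 2 * (norm x)\<^sup>2 + 2 * (norm (y::'a::real_inner))\<^sup>2"
proof -
  have "(norm (x + y))\<^sup>2 + (norm (x - y))\<^sup>2 = 2 * (norm x)\<^sup>2 + 2 * (norm y)\<^sup>2"
    by (simp add: power2_norm_eq_inner inner_add inner_diff inner_commute)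
  then show ?thesis using zero_le_power2[of "norm (x - y)"] by linarith
qed

lemma norm_diff_sq_le: "(norm (x - y))\<^sup>2 \<le> 2 * (norm x)\<^sup>2 + 2 * (norm (y::'a::real_inner))\<^sup>2"
  using norm_add_sq_le[of x "- y"] by simp

lemma abs_inner_le_sq: "\<bar>x \<bullet> y\<bar> \<le> (norm x)\<^sup>2 + (norm (y::'a::real_inner))\<^sup>2"
proof -
  have "\<bar>x \<bullet> y\<bar> \<le> norm x * norm y" by (rule Cauchy_Schwarz_ineq2)
  also have "\<dots> \<le> (norm x)\<^sup>2 + (norm y)\<^sup>2"
    using sum_squares_bound[of "norm x" "norm y"] zero_le_power2[of "norm x"] zero_le_power2[of "norm y"]
    by linarith
  finally show ?thesis .
qed

lemma L2_rv_add [intro]: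
  assumes "X \<in> L2_rv M" "Y \<in> L2_rv M"
  shows "(\<lambda>\<omega>. X \<omega> + Y \<omega>) \<in> L2_rv M"
proof (rule L2_rv_bound)
  show "(norm (X \<omega> + Y \<omega>))\<^sup>2 \<le> 2 * (norm (X \<omega>))\<^sup>2 + 2 * (norm (Y \<omega>))\<^sup>2" for \<omega>
    by (rule norm_add_sq_le)
qed (use assms in \<open>auto simp: L2_rv_def\<close>)

lemma L2_rv_scaleR [intro]:
  assumes "X \<in> L2_rv M"
  shows "(\<lambda>\<omega>. c *\<^sub>R X \<omega>) \<in> L2_rv M"
  using assms by (auto simp: L2_rv_def power_mult_distrib)

lemma L2_rv_diff [intro]:
  assumes "X \<in> L2_rv M" "Y \<in> L2_rv M"
  shows "(\<lambda>\<omega>. X \<omega> - Y \<omega>) \<in> L2_rv M"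
  using L2_rv_add[OF assms(1) L2_rv_scaleR[OF assms(2), of "-1"]] by simp

lemma L2_inner_integrable [intro]:
  assumes "X \<in> L2_rv M" "Y \<in> L2_rv M"
  shows "integrable M (\<lambda>\<omega>. X \<omega> \<bullet> Y \<omega>)"
proof (rule Bochner_Integration.integrable_bound)
  show "integrable M (\<lambda>\<omega>. (norm (X \<omega>))\<^sup>2 + (norm (Y \<omega>))\<^sup>2)"
    using assms by (simp add: L2_rv_integrable)
  show "AE \<omega> in M. norm (X \<omega> \<bullet> Y \<omega>) \<le> norm ((norm (X \<omega>))\<^sup>2 + (norm (Y \<omega>))\<^sup>2)"
    using abs_inner_le_sq by (intro AE_I2) simp
qed (use assms in \<open>auto simp: L2_rv_def\<close>)

lemma L2_norm_nonneg [simp]: "0 \<le> L2_norm M X"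
  by (simp add: L2_norm_def)

lemma L2_norm_sq: "(L2_norm M X)\<^sup>2 = (\<integral>\<omega>. (norm (X \<omega>))\<^sup>2 \<partial>M)"
  by (simp add: L2_norm_def)

lemma L2_norm_scaleR: "L2_norm M (\<lambda>\<omega>. c *\<^sub>R X \<omega>) = \<bar>c\<bar> * L2_norm M X"
  by (simp add: L2_norm_def power_mult_distrib real_sqrt_mult)

lemma L2_norm_minus_commute: "L2_norm M (\<lambda>\<omega>. X \<omega> - Y \<omega>) = L2_norm M (\<lambda>\<omega>. Y \<omega> - X \<omega>)"
  by (simp add: L2_norm_def norm_minus_commute)

lemma L2_norm_add_sq:
  assumes "X \<in> L2_rv M" "Y \<in> L2_rv M"
  shows "(L2_norm M (\<lambda>\<omega>. X \<omega> + Y \<omega>))\<^sup>2 =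
    (L2_norm M X)\<^sup>2 + 2 * (\<integral>\<omega>. X \<omega> \<bullet> Y \<omega> \<partial>M) + (L2_norm M Y)\<^sup>2"
proof -
  have "(norm (X \<omega> + Y \<omega>))\<^sup>2 = (norm (X \<omega>))\<^sup>2 + 2 * (X \<omega> \<bullet> Y \<omega>) + (norm (Y \<omega>))\<^sup>2" for \<omega>
    by (simp add: power2_norm_eq_inner inner_add inner_commute)
  then show ?thesis
    using assms by (simp add: L2_norm_sq L2_rv_integrable L2_inner_integrable)
qed

lemma L2_cauchy_schwarz:
  assumes X: "X \<in> L2_rv M" and Y: "Y \<in> L2_rv M"
  shows "\<bar>\<integral>\<omega>. X \<omega> \<bullet> Y \<omega> \<partial>M\<bar> \<le> L2_norm M X * L2_norm M Y"
proof -
  let ?I = "\<integral>\<omega>. X \<omega> \<bullet> Y \<omega> \<partial>M"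
  have *: "0 \<le> (L2_norm M X)\<^sup>2 + 2 * (t * ?I) + t\<^sup>2 * (L2_norm M Y)\<^sup>2" for t
    using L2_norm_add_sq[OF X L2_rv_scaleR[OF Y, of t]] zero_le_power2[of "L2_norm M (\<lambda>\<omega>. X \<omega> + t *\<^sub>R Y \<omega>)"]
    by (simp add: L2_norm_scaleR power_mult_distrib)
  have "?I\<^sup>2 \<le> (L2_norm M X)\<^sup>2 * (L2_norm M Y)\<^sup>2"
  proof (cases "L2_norm M Y = 0")
    case True
    have "?I = 0"
    proof (rule ccontr)
      assume nz: "?I \<noteq> 0"
      \<comment> \<open>The quadratic in \<open>t\<close> is affine when \<open>Y\<close> has norm
        \<open>0\<close>; this \<open>t\<close> would give it the value \<open>-1\<close>. In the
        other case \<open>t\<close> below is its minimiser.\<close>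
      define t where "t = - ((L2_norm M X)\<^sup>2 + 1) / (2 * ?I)"
      have "2 * (t * ?I) = - ((L2_norm M X)\<^sup>2 + 1)" using nz by (simp add: t_def)
      with *[of t] True show False by simp
    qed
    with True show ?thesis by simp
  next
    case False
    define y where "y = (L2_norm M Y)\<^sup>2"
    have "y > 0" using False by (simp add: y_def)
    define t where "t = - ?I / y"
    have ty: "t * y = - ?I" using \<open>y > 0\<close> by (simp add: t_def)
    then have "t\<^sup>2 * y = - (t * ?I)" by (simp add: power2_eq_square mult.assoc)
    then have "0 \<le> (L2_norm M X)\<^sup>2 + t * ?I" using *[of t] unfolding y_def[symmetric] by simp
    then have "0 \<le> ((L2_norm M X)\<^sup>2 + t * ?I) * y" using \<open>y > 0\<close> by simp
    also have "\<dots> = (L2_norm M X)\<^sup>2 * y + (t * y) * ?I" by (simp add: algebra_simps)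
    finally show ?thesis unfolding ty y_def[symmetric] by (simp add: power2_eq_square)
  qed
  then have "\<bar>?I\<bar>\<^sup>2 \<le> (L2_norm M X * L2_norm M Y)\<^sup>2" by (simp add: power_mult_distrib)
  then show ?thesis by (rule power2_le_imp_le) simp
qed

lemma L2_triangle:
  assumes X: "X \<in> L2_rv M" and Y: "Y \<in> L2_rv M"
  shows "L2_norm M (\<lambda>\<omega>. X \<omega> + Y \<omega>) \<le> L2_norm M X + L2_norm M Y"
proof -
  have "(L2_norm M (\<lambda>\<omega>. X \<omega> + Y \<omega>))\<^sup>2 \<le> (L2_norm M X + L2_norm M Y)\<^sup>2"
    using L2_cauchy_schwarz[OF X Y] unfolding L2_norm_add_sq[OF X Y] power2_sum by linarith
  then show ?thesis by (rule power2_le_imp_le) simp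
qed

lemma L2_triangle_diff:
  assumes "X \<in> L2_rv M" "Y \<in> L2_rv M" "Z \<in> L2_rv M"
  shows "L2_norm M (\<lambda>\<omega>. X \<omega> - Z \<omega>) \<le> L2_norm M (\<lambda>\<omega>. X \<omega> - Y \<omega>) + L2_norm M (\<lambda>\<omega>. Y \<omega> - Z \<omega>)"
  using L2_triangle[OF L2_rv_diff[OF assms(1,2)] L2_rv_diff[OF assms(2,3)]] by simp

lemma L2_norm_diff_sq:
  assumes "X \<in> L2_rv M" "Y \<in> L2_rv M"
  shows "(L2_norm M (\<lambda>\<omega>. X \<omega> - Y \<omega>))\<^sup>2 =
    (L2_norm M X)\<^sup>2 - 2 * (\<integral>\<omega>. X \<omega> \<bullet> Y \<omega> \<partial>M) + (L2_norm M Y)\<^sup>2"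
  using L2_norm_add_sq[OF assms(1) L2_rv_scaleR[OF assms(2), of "-1"]] L2_norm_scaleR[of M "-1" Y]
  by simp

lemma L2_rv_distr:
  assumes [measurable]: "f \<in> borel_measurable N" "X \<in> M \<rightarrow>\<^sub>M N"
  shows "f \<in> L2_rv (distr M N X) \<longleftrightarrow> (\<lambda>\<omega>. f (X \<omega>)) \<in> L2_rv M"
  by (auto simp: L2_rv_def integrable_distr_eq)

lemma L2_norm_distr:
  assumes [measurable]: "f \<in> borel_measurable N" "X \<in> M \<rightarrow>\<^sub>M N"
  shows "L2_norm (distr M N X) f = L2_norm M (\<lambda>\<omega>. f (X \<omega>))"
  by (simp add: L2_norm_def integral_distr)

lemma L2_rv_comp:
  assumes "distr M N X = \<mu>" "X \<in> M \<rightarrow>\<^sub>M N" "f \<in> L2_rv \<mu>"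
  shows "(\<lambda>\<omega>. f (X \<omega>)) \<in> L2_rv M"
proof -
  have "f \<in> borel_measurable N" using assms by (auto simp: L2_rv_def)
  with L2_rv_distr[OF this assms(2)] assms(1,3) show ?thesis by simp
qed

lemma L2_norm_comp:
  assumes "distr M N X = \<mu>" "X \<in> M \<rightarrow>\<^sub>M N" "f \<in> borel_measurable N"
  shows "L2_norm M (\<lambda>\<omega>. f (X \<omega>)) = L2_norm \<mu> f"
  using L2_norm_distr[OF assms(3,2)] assms(1) by simp

lemma L2_norm_eq_0_iff:
  assumes "X \<in> L2_rv M"
  shows "L2_norm M X = 0 \<longleftrightarrow> (AE \<omega> in M. X \<omega> = 0)"
  using assms by (simp add: L2_norm_def L2_rv_def integral_nonneg_eq_0_iff_AE)

lemma L2_rv_bounded_linear: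
  assumes "bounded_linear L" "X \<in> L2_rv M"
  shows "(\<lambda>\<omega>. L (X \<omega>)) \<in> L2_rv M"
proof -
  obtain K where K: "\<And>x. norm (L x) \<le> norm x * K" using bounded_linear.bounded[OF assms(1)] by blast
  have [measurable]: "L \<in> borel_measurable borel"
    using assms(1) by (intro borel_measurable_continuous_onI linear_continuous_on)
  show ?thesis
  proof (rule L2_rv_bound)
    show "(norm (L (X \<omega>)))\<^sup>2 \<le> (norm (X \<omega>))\<^sup>2 * K\<^sup>2" for \<omega>
      using power_mono[OF K, of "X \<omega>" 2] by (simp add: power_mult_distrib)
  qed (use assms(2) in \<open>auto simp: L2_rv_def\<close>)
qed

text \<open>\<open>K\<close> depends on \<open>L\<close> alone and is fixed before the measure: the
  compactness argument applies one bound to a whole sequence of laws.\<close>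

lemma L2_norm_bounded_linear:
  assumes "bounded_linear L"
  obtains K where "0 \<le> K"
    "\<And>(M::'w measure) X. X \<in> L2_rv M \<Longrightarrow> L2_norm M (\<lambda>\<omega>. L (X \<omega>)) \<le> K * L2_norm M X"
proof -
  obtain K where K: "\<And>x. norm (L x) \<le> norm x * K" and "K \<ge> 0"
    using bounded_linear.nonneg_bounded[OF assms(1)] by blast
  have "L2_norm M (\<lambda>\<omega>. L (X \<omega>)) \<le> K * L2_norm M X" if X: "X \<in> L2_rv M" for M :: "'w measure" and X
  proof (rule power2_le_imp_le)
    have "(L2_norm M (\<lambda>\<omega>. L (X \<omega>)))\<^sup>2 \<le> (\<integral>\<omega>. K\<^sup>2 * (norm (X \<omega>))\<^sup>2 \<partial>M)"
      unfolding L2_norm_sq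
    proof (rule integral_mono)
      show "(norm (L (X \<omega>)))\<^sup>2 \<le> K\<^sup>2 * (norm (X \<omega>))\<^sup>2" for \<omega>
        using power_mono[OF K, of "X \<omega>" 2] by (simp add: power_mult_distrib mult.commute)
    qed (use L2_rv_integrable[OF X] L2_rv_integrable[OF L2_rv_bounded_linear[OF assms X]] in auto)
    then show "(L2_norm M (\<lambda>\<omega>. L (X \<omega>)))\<^sup>2 \<le> (K * L2_norm M X)\<^sup>2"
      by (simp add: power_mult_distrib L2_norm_sq)
  qed (use \<open>K \<ge> 0\<close> in auto)
  with \<open>K \<ge> 0\<close> show ?thesis by (rule that)
qed

lemma L2_norm_cong_AE:
  assumes "X \<in> borel_measurable M" "Y \<in> borel_measurable M" "AE \<omega> in M. X \<omega> = Y \<omega>"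
  shows "L2_norm M X = L2_norm M Y"
proof -
  have "(\<integral>\<omega>. (norm (X \<omega>))\<^sup>2 \<partial>M) = (\<integral>\<omega>. (norm (Y \<omega>))\<^sup>2 \<partial>M)"
    using assms by (intro integral_cong_AE) auto
  then show ?thesis by (simp add: L2_norm_def)
qed

lemma L2_norm_reverse_triangle:
  assumes "X \<in> L2_rv M" "Y \<in> L2_rv M"
  shows "\<bar>L2_norm M X - L2_norm M Y\<bar> \<le> L2_norm M (\<lambda>\<omega>. X \<omega> - Y \<omega>)"
proof -
  have "L2_norm M X \<le> L2_norm M (\<lambda>\<omega>. X \<omega> - Y \<omega>) + L2_norm M Y"
    using L2_triangle[OF L2_rv_diff[OF assms] assms(2)] by simp
  moreover have "L2_norm M Y \<le> L2_norm M (\<lambda>\<omega>. X \<omega> - Y \<omega>) + L2_norm M X"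
    using L2_triangle[OF L2_rv_diff[OF assms(2,1)] assms(1)] by (simp add: L2_norm_minus_commute[of M X Y])
  ultimately show ?thesis by linarith
qed

lemma L2_rv_Pair:
  assumes "X \<in> L2_rv M" "Y \<in> L2_rv M"
  shows "(\<lambda>\<omega>. (X \<omega>, Y \<omega>)) \<in> L2_rv M"
  using assms by (auto simp: L2_rv_def norm_Pair)

lemma L2_rv_fst: "Z \<in> L2_rv M \<Longrightarrow> (\<lambda>\<omega>. fst (Z \<omega>)) \<in> L2_rv M"
  by (rule L2_rv_bounded_linear) (rule bounded_linear_fst)

lemma L2_rv_snd: "Z \<in> L2_rv M \<Longrightarrow> (\<lambda>\<omega>. snd (Z \<omega>)) \<in> L2_rv M"
  by (rule L2_rv_bounded_linear) (rule bounded_linear_snd)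

lemma L2_norm_mono:
  assumes "X \<in> L2_rv M" "Y \<in> L2_rv M" "\<And>\<omega>. norm (X \<omega>) \<le> norm (Y \<omega>)"
  shows "L2_norm M X \<le> L2_norm M Y"
  unfolding L2_norm_def using assms by (auto intro!: integral_mono power_mono simp: L2_rv_integrable)

lemma L2_norm_Pair_le:
  assumes "X \<in> L2_rv M" "Y \<in> L2_rv M"
  shows "L2_norm M (\<lambda>\<omega>. (X \<omega>, Y \<omega>)) \<le> L2_norm M X + L2_norm M Y"
proof (rule power2_le_imp_le)
  have "(L2_norm M (\<lambda>\<omega>. (X \<omega>, Y \<omega>)))\<^sup>2 = (L2_norm M X)\<^sup>2 + (L2_norm M Y)\<^sup>2"
    using assms by (simp add: L2_norm_sq norm_Pair L2_rv_integrable)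
  also have "\<dots> \<le> (L2_norm M X + L2_norm M Y)\<^sup>2" by (simp add: power2_sum)
  finally show "(L2_norm M (\<lambda>\<omega>. (X \<omega>, Y \<omega>)))\<^sup>2 \<le> (L2_norm M X + L2_norm M Y)\<^sup>2" .
qed simp

lemma L2_bounded_linear_inner:
  fixes G :: "'w \<Rightarrow> 'a::euclidean_space"
  assumes "G \<in> L2_rv M"
  shows "L2_bounded_linear M (\<lambda>H. \<integral>\<omega>. G \<omega> \<bullet> H \<omega> \<partial>M)"
  unfolding L2_bounded_linear_def
proof (intro conjI ballI allI exI)
  fix H K :: "'w \<Rightarrow> 'a" assume "H \<in> L2_rv M" "K \<in> L2_rv M"
  then show "(\<integral>\<omega>. G \<omega> \<bullet> (H \<omega> + K \<omega>) \<partial>M) = (\<integral>\<omega>. G \<omega> \<bullet> H \<omega> \<partial>M) + (\<integral>\<omega>. G \<omega> \<bullet> K \<omega> \<partial>M)"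
    using assms by (simp add: inner_add_right L2_inner_integrable)
next
  fix H :: "'w \<Rightarrow> 'a" assume "H \<in> L2_rv M"
  then show "\<bar>\<integral>\<omega>. G \<omega> \<bullet> H \<omega> \<partial>M\<bar> \<le> L2_norm M G * L2_norm M H"
    using assms by (intro L2_cauchy_schwarz)
qed simp

section \<open>Limits and completeness in L^2\<close>

lemma L2_norm_null_geometric:
  assumes "\<And>k. L2_norm M (f k) \<le> e * (1/2) ^ k"
  shows "(\<lambda>k. L2_norm M (f k)) \<longlonglongrightarrow> 0"
proof (rule tendsto_sandwich[of "\<lambda>_. 0"])
  show "(\<lambda>k. e * (1/2) ^ k) \<longlonglongrightarrow> (0::real)" by (intro tendsto_mult_right_zero LIMSEQ_realpow_zero) auto
qed (use assms in auto)

text \<open>Fatou's lemma for Bochner integrals. The finite bound also makes the limit integrable;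
  it is asked for only from \<open>n0\<close> on because tail estimates start at a given
  index.\<close>

lemma integral_le_of_AE_limit:
  fixes f :: "nat \<Rightarrow> 'w \<Rightarrow> real"
  assumes f: "\<And>n. integrable M (f n)" "\<And>n \<omega>. 0 \<le> f n \<omega>"
    and g: "g \<in> borel_measurable M" "\<And>\<omega>. 0 \<le> g \<omega>"
    and lim: "AE \<omega> in M. (\<lambda>n. f n \<omega>) \<longlonglongrightarrow> g \<omega>"
    and le: "\<And>n. n \<ge> n0 \<Longrightarrow> (\<integral>\<omega>. f n \<omega> \<partial>M) \<le> B"
  shows "integrable M g" "(\<integral>\<omega>. g \<omega> \<partial>M) \<le> B"
proof -
  have [measurable]: "f n \<in> borel_measurable M" for n using f(1) by auto
  have "0 \<le> (\<integral>\<omega>. f n0 \<omega> \<partial>M)" using f(2) by simp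
  then have "B \<ge> 0" using le[of n0] by linarith
  have "(\<integral>\<^sup>+\<omega>. ennreal (g \<omega>) \<partial>M) = (\<integral>\<^sup>+\<omega>. liminf (\<lambda>n. ennreal (f n \<omega>)) \<partial>M)"
  proof (rule nn_integral_cong_AE)
    show "AE \<omega> in M. ennreal (g \<omega>) = liminf (\<lambda>n. ennreal (f n \<omega>))"
      using lim
    proof eventually_elim
      case (elim \<omega>)
      then have "(\<lambda>n. ennreal (f n \<omega>)) \<longlonglongrightarrow> ennreal (g \<omega>)" by (rule tendsto_ennrealI)
      then show ?case using lim_imp_Liminf[of sequentially "\<lambda>n. ennreal (f n \<omega>)"] by simp
    qed
  qed
  also have "\<dots> \<le> liminf (\<lambda>n. \<integral>\<^sup>+\<omega>. ennreal (f n \<omega>) \<partial>M)"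
    by (rule nn_integral_liminf) simp
  also have "\<dots> \<le> ennreal B"
  proof (rule Liminf_le)
    have "(\<integral>\<^sup>+\<omega>. ennreal (f n \<omega>) \<partial>M) \<le> ennreal B" if "n \<ge> n0" for n
      using le[OF that] f by (subst nn_integral_eq_integral) (auto intro: ennreal_leI)
    then show "\<forall>\<^sub>F n in sequentially. (\<integral>\<^sup>+\<omega>. ennreal (f n \<omega>) \<partial>M) \<le> ennreal B"
      by (auto simp: eventually_sequentially)
  qed simp
  finally have *: "(\<integral>\<^sup>+\<omega>. ennreal (g \<omega>) \<partial>M) \<le> ennreal B" .
  then have "(\<integral>\<^sup>+\<omega>. ennreal (g \<omega>) \<partial>M) < \<infinity>"
    using le_less_trans[OF _ ennreal_less_top[of B]] by simp
  then show int: "integrable M g"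
    using g by (intro integrableI_nonneg) auto
  show "(\<integral>\<omega>. g \<omega> \<partial>M) \<le> B"
    using * \<open>B \<ge> 0\<close> g(2) by (subst (asm) nn_integral_eq_integral[OF int]) (auto simp: ennreal_le_iff)
qed

lemma (in prob_space) integral_norm_le_L2_norm:
  assumes "X \<in> L2_rv M"
  shows "integrable M (\<lambda>\<omega>. norm (X \<omega>))" "(\<integral>\<omega>. norm (X \<omega>) \<partial>M) \<le> L2_norm M X"
proof -
  have X: "(\<lambda>\<omega>. norm (X \<omega>)) \<in> L2_rv M" and one: "(\<lambda>\<omega>. 1::real) \<in> L2_rv M"
    using assms by (auto simp: L2_rv_def)
  show "integrable M (\<lambda>\<omega>. norm (X \<omega>))" using L2_inner_integrable[OF X one] by simp
  have "L2_norm M (\<lambda>\<omega>. 1::real) = 1" by (simp add: L2_norm_def prob_space)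
  with L2_cauchy_schwarz[OF X one] show "(\<integral>\<omega>. norm (X \<omega>) \<partial>M) \<le> L2_norm M X"
    by (simp add: L2_norm_def)
qed

text \<open>The increments have summable L^1 norms, so the sequence converges almost everywhere;
  Fatou's lemma, applied to \<open>G k - G j\<close> for growing \<open>j\<close>, turns the
  geometric tail into the rate.\<close>

lemma (in prob_space) L2_geometric_limit:
  fixes G :: "nat \<Rightarrow> 'a \<Rightarrow> 'b::euclidean_space"
  assumes G: "\<And>k. G k \<in> L2_rv M"
    and step: "\<And>k. L2_norm M (\<lambda>\<omega>. G (Suc k) \<omega> - G k \<omega>) \<le> c * (1/2) ^ k"
  obtains Z where "Z \<in> L2_rv M" "\<And>k. L2_norm M (\<lambda>\<omega>. G k \<omega> - Z \<omega>) \<le> 2 * c * (1/2) ^ k"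
proof -
  have [measurable]: "G k \<in> borel_measurable M" for k using G by (rule L2_rvD)
  let ?D = "\<lambda>k \<omega>. G (Suc k) \<omega> - G k \<omega>"
  have D: "?D k \<in> L2_rv M" for k using G by auto
  have "0 \<le> c" using order_trans[OF L2_norm_nonneg step[of 0]] by simp
  have sumc: "(\<Sum>k. ennreal (c * (1/2) ^ k)) < \<infinity>"
  proof -
    have "summable (\<lambda>k. c * (1/2::real) ^ k)" by (intro summable_mult summable_geometric) simp
    then show ?thesis using \<open>0 \<le> c\<close> by (simp add: suminf_ennreal2)
  qed
  have "(\<integral>\<^sup>+\<omega>. (\<Sum>k. ennreal (norm (?D k \<omega>))) \<partial>M) = (\<Sum>k. \<integral>\<^sup>+\<omega>. ennreal (norm (?D k \<omega>)) \<partial>M)"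
    by (rule nn_integral_suminf) simp
  also have "\<dots> \<le> (\<Sum>k. ennreal (c * (1/2) ^ k))"
  proof (rule suminf_le)
    fix k
    have "(\<integral>\<omega>. norm (?D k \<omega>) \<partial>M) \<le> c * (1/2) ^ k"
      using integral_norm_le_L2_norm(2)[OF D[of k]] step[of k] by linarith
    then show "(\<integral>\<^sup>+\<omega>. ennreal (norm (?D k \<omega>)) \<partial>M) \<le> ennreal (c * (1/2) ^ k)"
      using integral_norm_le_L2_norm(1)[OF D[of k]]
      by (subst nn_integral_eq_integral) (auto intro: ennreal_leI)
  qed auto
  finally have "(\<integral>\<^sup>+\<omega>. (\<Sum>k. ennreal (norm (?D k \<omega>))) \<partial>M) \<noteq> \<infinity>"
    using sumc by auto
  then have "AE \<omega> in M. (\<Sum>k. ennreal (norm (?D k \<omega>))) \<noteq> \<infinity>"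
    by (intro nn_integral_PInf_AE) auto
  then have conv: "AE \<omega> in M. (\<lambda>k. G k \<omega>) \<longlonglongrightarrow> lim (\<lambda>k. G k \<omega>)"
  proof eventually_elim
    case (elim \<omega>)
    then have "summable (\<lambda>k. norm (?D k \<omega>))"
      by (intro summable_suminf_not_top) auto
    then have "summable (\<lambda>k. ?D k \<omega>)" by (rule summable_norm_cancel)
    then have "convergent (\<lambda>n. \<Sum>k<n. ?D k \<omega>)" by (simp add: summable_iff_convergent)
    then have "convergent (\<lambda>n. G n \<omega> - G 0 \<omega>)" 
      using sum_lessThan_telescope[of "\<lambda>k. G k \<omega>"] by simp
    from convergent_add[OF this convergent_const[of "G 0 \<omega>"]] show ?case
      by (simp add: convergent_LIMSEQ_iff)
  qed
  define Z where "Z \<omega> = lim (\<lambda>k. G k \<omega>)" for \<omega>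
  have [measurable]: "Z \<in> borel_measurable M" unfolding Z_def by simp
  \<comment> \<open>The subtracted term is what makes the induction on \<open>j\<close> close; it is
    dropped afterwards.\<close>
  have tail: "L2_norm M (\<lambda>\<omega>. G k \<omega> - G (k + j) \<omega>) \<le> 2 * c * (1/2) ^ k - 2 * c * (1/2) ^ (k + j)" for k j
  proof (induction j)
    case 0 then show ?case by (simp add: L2_norm_def)
  next
    case (Suc j)
    have "L2_norm M (\<lambda>\<omega>. G k \<omega> - G (k + Suc j) \<omega>) \<le>
        L2_norm M (\<lambda>\<omega>. G k \<omega> - G (k + j) \<omega>) + L2_norm M (\<lambda>\<omega>. G (k + j) \<omega> - G (k + Suc j) \<omega>)"
      using L2_triangle_diff[OF G G G] .
    also have "L2_norm M (\<lambda>\<omega>. G (k + j) \<omega> - G (k + Suc j) \<omega>) \<le> c * (1/2) ^ (k + j)"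
      using step[of "k + j"] by (simp add: L2_norm_minus_commute[of M "G (k + j)"])
    finally show ?case using Suc by simp
  qed
  have fin: "integrable M (\<lambda>\<omega>. (norm (G k \<omega> - Z \<omega>))\<^sup>2)"
    "(\<integral>\<omega>. (norm (G k \<omega> - Z \<omega>))\<^sup>2 \<partial>M) \<le> (2 * c * (1/2) ^ k)\<^sup>2" for k
  proof -
    have i: "integrable M (\<lambda>\<omega>. (norm (G k \<omega> - G j \<omega>))\<^sup>2)" for j
      using G by (intro L2_rv_integrable) auto
    have l: "AE \<omega> in M. (\<lambda>j. (norm (G k \<omega> - G j \<omega>))\<^sup>2) \<longlonglongrightarrow> (norm (G k \<omega> - Z \<omega>))\<^sup>2"
      using conv by eventually_elim (auto simp: Z_def intro!: tendsto_intros)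
    have b: "(\<integral>\<omega>. (norm (G k \<omega> - G j \<omega>))\<^sup>2 \<partial>M) \<le> (2 * c * (1/2) ^ k)\<^sup>2" if "j \<ge> k" for j
    proof -
      have "L2_norm M (\<lambda>\<omega>. G k \<omega> - G j \<omega>) \<le> 2 * c * (1/2) ^ k"
        using tail[of k "j - k"] that \<open>0 \<le> c\<close> by (simp add: order_trans)
      then show ?thesis unfolding L2_norm_sq[symmetric] by (rule power_mono) simp
    qed
    show "integrable M (\<lambda>\<omega>. (norm (G k \<omega> - Z \<omega>))\<^sup>2)"
      by (rule integral_le_of_AE_limit(1)[OF i _ _ _ l b]) auto
    show "(\<integral>\<omega>. (norm (G k \<omega> - Z \<omega>))\<^sup>2 \<partial>M) \<le> (2 * c * (1/2) ^ k)\<^sup>2"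
      by (rule integral_le_of_AE_limit(2)[OF i _ _ _ l b]) auto
  qed
  show ?thesis
  proof
    have "(\<lambda>\<omega>. G 0 \<omega> - Z \<omega>) \<in> L2_rv M" using fin(1)[of 0] by (simp add: L2_rv_def)
    from L2_rv_diff[OF G[of 0] this] show "Z \<in> L2_rv M" by simp
    fix k
    have "sqrt (\<integral>\<omega>. (norm (G k \<omega> - Z \<omega>))\<^sup>2 \<partial>M) \<le> sqrt ((2 * c * (1/2) ^ k)\<^sup>2)"
      using fin(2)[of k] by (rule real_sqrt_le_mono)
    then show "L2_norm M (\<lambda>\<omega>. G k \<omega> - Z \<omega>) \<le> 2 * c * (1/2) ^ k"
      using \<open>0 \<le> c\<close> by (simp add: L2_norm_def)
  qed
qed

section \<open>Subsets of prescribed measure in atomless spaces\<close>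

text \<open>\<open>D\<close> and \<open>B - D\<close> both have positive measure, and one of them
  has at most half the measure of \<open>B\<close>; iterated halving gets below any
  \<open>e\<close>.\<close>

lemma atomless_small_subset:
  assumes "prob_space M" "atomless M" "A \<in> sets M" "0 < measure M A" "0 < e"
  obtains B where "B \<in> sets M" "B \<subseteq> A" "0 < measure M B" "measure M B \<le> e"
proof -
  interpret prob_space M by fact
  have "\<exists>B\<in>sets M. B \<subseteq> A \<and> 0 < measure M B \<and> measure M B \<le> measure M A / 2 ^ n" for n
  proof (induction n)
    case 0 then show ?case using assms by auto
  next
    case (Suc n)
    then obtain B where B: "B \<in> sets M" "B \<subseteq> A" "0 < measure M B" "measure M B \<le> measure M A / 2 ^ n"
      by auto
    then obtain D where D: "D \<in> sets M" "D \<subseteq> B" "0 < measure M D" "measure M D < measure M B"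
      using assms(2) unfolding atomless_def by blast
    have "measure M (B - D) = measure M B - measure M D"
      using B D by (intro finite_measure_Diff)
    then have "measure M D \<le> measure M A / 2 ^ Suc n \<or>
        0 < measure M (B - D) \<and> measure M (B - D) \<le> measure M A / 2 ^ Suc n"
      using B D by auto
    then show ?case using B D by (metis Diff_subset order_trans sets.Diff)
  qed
  moreover obtain n where "measure M A / e < 2 ^ n"
    using real_arch_pow[of 2 "measure M A / e"] by auto
  then have "measure M A / 2 ^ n \<le> e" using \<open>0 < e\<close> by (simp add: field_simps)
  ultimately show ?thesis by (meson order_trans that)
qed

text \<open>Sierpinski's theorem by greedy exhaustion: each step gains at least half of what any
  admissible set could add. If the union \<open>U\<close> stayed below \<open>t\<close>, some
  \<open>D\<close> outside it would be admissible at every step, and every gain would be at least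
  \<open>measure M D / 2\<close>, which a finite measure forbids.\<close>

lemma atomless_intermediate:
  assumes "prob_space M" "atomless M" "A \<in> sets M" "0 \<le> t" "t \<le> measure M A"
  obtains B where "B \<in> sets M" "B \<subseteq> A" "measure M B = t"
proof -
  interpret prob_space M by fact
  define P where "P B \<longleftrightarrow> B \<in> sets M \<and> B \<subseteq> A \<and> measure M B \<le> t" for B
  define Q where "Q B B' \<longleftrightarrow> B \<subseteq> B' \<and>
    (\<forall>D\<in>sets M. D \<subseteq> A - B \<and> measure M B + measure M D \<le> t \<longrightarrow>
       measure M D / 2 \<le> measure M B' - measure M B)" for B B'
  have step: "\<exists>B'. P B' \<and> Q B B'" if B: "P B" for B
  proof -
    define S where "S = {measure M D |D. D \<in> sets M \<and> D \<subseteq> A - B \<and> measure M B + measure M D \<le> t}"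
    have "{} \<in> sets M \<and> {} \<subseteq> A - B \<and> measure M B + measure M {} \<le> t"
      using B by (simp add: P_def)
    then have "measure M {} \<in> S" unfolding S_def by blast
    then have "S \<noteq> {}" by blast
    have bdd: "bdd_above S" by (intro bdd_aboveI[of _ 1]) (auto simp: S_def)
    have up: "x \<le> Sup S" if "x \<in> S" for x using that bdd by (rule cSup_upper)
    have "Sup S \<ge> 0" using up[OF \<open>measure M {} \<in> S\<close>] by simp
    obtain x where "x \<in> S" "Sup S / 2 \<le> x"
    proof (cases "Sup S = 0")
      case True with \<open>measure M {} \<in> S\<close> show ?thesis by (intro that[of "measure M {}"]) auto
    next
      case False
      then obtain x where "x \<in> S" "Sup S / 2 < x"
        using less_cSupD[OF \<open>S \<noteq> {}\<close>, of "Sup S / 2"] \<open>Sup S \<ge> 0\<close> by auto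
      then show ?thesis by (intro that[of x]) auto
    qed
    then obtain D where D: "D \<in> sets M" "D \<subseteq> A - B" "measure M B + measure M D \<le> t"
      "Sup S / 2 \<le> measure M D" unfolding S_def by auto
    have eq: "measure M (B \<union> D) = measure M B + measure M D"
      using B D by (intro finite_measure_Union) (auto simp: P_def)
    have "P (B \<union> D)" using B D eq by (auto simp: P_def)
    moreover have "measure M D' / 2 \<le> measure M (B \<union> D) - measure M B"
      if "D' \<in> sets M" "D' \<subseteq> A - B" "measure M B + measure M D' \<le> t" for D'
    proof -
      have "measure M D' \<in> S" using that by (auto simp: S_def)
      then show ?thesis using up D(4) eq by fastforce
    qed
    ultimately show ?thesis unfolding Q_def by blast
  qed
  have "P {}" using assms by (simp add: P_def)
  with dependent_nat_choice[where P = "\<lambda>_ B. P B" and Q = "\<lambda>_ B B'. Q B B'"] step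
  obtain B where B: "\<And>n. P (B n)" "\<And>n. Q (B n) (B (Suc n))" by metis
  define U where "U = (\<Union>n. B n)"
  have inc: "incseq B" using B(2) by (intro incseq_SucI) (auto simp: Q_def)
  have lim: "(\<lambda>n. measure M (B n)) \<longlonglongrightarrow> measure M U"
    unfolding U_def using B(1) inc by (intro finite_Lim_measure_incseq) (auto simp: P_def)
  have U: "U \<in> sets M" "U \<subseteq> A" using B(1) by (auto simp: U_def P_def)
  have le: "measure M U \<le> t" using lim B(1) by (intro LIMSEQ_le_const2[OF lim]) (auto simp: P_def)
  have "measure M U = t"
  proof (rule ccontr)
    assume "measure M U \<noteq> t"
    with le have lt: "measure M U < t" by simp
    have "measure M (A - U) = measure M A - measure M U" using U assms by (intro finite_measure_Diff)
    then have "0 < measure M (A - U)" using lt assms by simp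
    then obtain D where D: "D \<in> sets M" "D \<subseteq> A - U" "0 < measure M D" "measure M D \<le> t - measure M U"
      using atomless_small_subset[OF assms(1,2), of "A - U" "t - measure M U"] lt U assms(3) by auto
    have Bn: "measure M (B n) \<le> measure M U" for n
      using B(1)[of n] U by (intro finite_measure_mono) (auto simp: U_def)
    have inc2: "measure M D / 2 \<le> measure M (B (Suc n)) - measure M (B n)" for n
    proof -
      have "D \<subseteq> A - B n" "measure M (B n) + measure M D \<le> t"
        using D Bn[of n] by (auto simp: U_def)
      then show ?thesis using B(2)[of n] D(1) unfolding Q_def by blast
    qed
    have "real n * (measure M D / 2) \<le> measure M (B n)" for n
    proof (induction n)
      case (Suc n) then show ?case using inc2[of n] by (simp add: algebra_simps)
    qed simp
    then have "real n * (measure M D / 2) \<le> 1" for n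
      using order_trans prob_le_1 by blast
    then show False
      using reals_Archimedean3[of "measure M D / 2"] D(3) by (meson half_gt_zero not_le)
  qed
  with U show ?thesis by (intro that)
qed

section \<open>Laws of limits\<close>

lemma continuous_on_lipschitz_bound:
  fixes g :: "'a::real_normed_vector \<Rightarrow> real"
  assumes g: "\<And>x y. \<bar>g x - g y\<bar> \<le> L * norm (x - y)"
  shows "continuous_on UNIV g"
proof (rule lipschitz_on_continuous_on[where L = "\<bar>L\<bar>"], rule lipschitz_onI)
  fix x y
  show "dist (g x) (g y) \<le> \<bar>L\<bar> * dist x y"
    using g[of x y] mult_right_mono[OF abs_ge_self[of L] norm_ge_zero[of "x - y"]] by (simp add: dist_norm)
qed simp

lemma (in prob_space) L2_limit_lipschitz_integral:
  fixes U :: "nat \<Rightarrow> 'a \<Rightarrow> 'b::euclidean_space"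
  assumes U: "\<And>k. U k \<in> L2_rv M" "V \<in> L2_rv M"
    and lim: "(\<lambda>k. L2_norm M (\<lambda>\<omega>. U k \<omega> - V \<omega>)) \<longlonglongrightarrow> 0"
    and g: "\<And>x y. \<bar>g x - g y\<bar> \<le> L * norm (x - y)" "\<And>x. \<bar>g x\<bar> \<le> (B::real)"
  shows "(\<lambda>k. \<integral>\<omega>. g (U k \<omega>) \<partial>M) \<longlonglongrightarrow> (\<integral>\<omega>. g (V \<omega>) \<partial>M)"
proof -
  from g(1) have "continuous_on UNIV g" by (rule continuous_on_lipschitz_bound)
  then have [measurable]: "g \<in> borel_measurable borel" by (rule borel_measurable_continuous_onI)
  have [measurable]: "U k \<in> borel_measurable M" "V \<in> borel_measurable M" for k using U by (auto simp: L2_rv_def)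
  have int: "integrable M (\<lambda>\<omega>. g (W \<omega>))" if [measurable]: "W \<in> borel_measurable M" for W
    using g(2) by (intro integrable_const_bound[where B = B]) auto
  have "\<bar>(\<integral>\<omega>. g (U k \<omega>) \<partial>M) - (\<integral>\<omega>. g (V \<omega>) \<partial>M)\<bar> \<le> \<bar>L\<bar> * L2_norm M (\<lambda>\<omega>. U k \<omega> - V \<omega>)" for k
  proof -
    have D: "(\<lambda>\<omega>. U k \<omega> - V \<omega>) \<in> L2_rv M" using U by auto
    have "\<bar>(\<integral>\<omega>. g (U k \<omega>) \<partial>M) - (\<integral>\<omega>. g (V \<omega>) \<partial>M)\<bar> = \<bar>\<integral>\<omega>. g (U k \<omega>) - g (V \<omega>) \<partial>M\<bar>"
      by (simp add: int)
    also have "\<dots> \<le> (\<integral>\<omega>. \<bar>g (U k \<omega>) - g (V \<omega>)\<bar> \<partial>M)" by (rule integral_abs_bound)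
    also have "\<dots> \<le> (\<integral>\<omega>. \<bar>L\<bar> * norm (U k \<omega> - V \<omega>) \<partial>M)"
    proof (rule integral_mono)
      show "\<bar>g (U k \<omega>) - g (V \<omega>)\<bar> \<le> \<bar>L\<bar> * norm (U k \<omega> - V \<omega>)" for \<omega>
        using g(1)[of "U k \<omega>" "V \<omega>"] mult_right_mono[OF abs_ge_self[of L] norm_ge_zero[of "U k \<omega> - V \<omega>"]] by linarith
    qed (use integral_norm_le_L2_norm(1)[OF D] int in auto)
    also have "\<dots> \<le> \<bar>L\<bar> * L2_norm M (\<lambda>\<omega>. U k \<omega> - V \<omega>)"
      using integral_norm_le_L2_norm(2)[OF D] by (simp add: mult_left_mono)
    finally show ?thesis .
  qed
  moreover have "(\<lambda>k. \<bar>L\<bar> * L2_norm M (\<lambda>\<omega>. U k \<omega> - V \<omega>)) \<longlonglongrightarrow> 0"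
    using tendsto_mult_left[OF lim, of "\<bar>L\<bar>"] by simp
  ultimately have "(\<lambda>k. (\<integral>\<omega>. g (U k \<omega>) \<partial>M) - (\<integral>\<omega>. g (V \<omega>) \<partial>M)) \<longlonglongrightarrow> 0"
    by (intro Lim_null_comparison[where f = "\<lambda>k. (\<integral>\<omega>. g (U k \<omega>) \<partial>M) - (\<integral>\<omega>. g (V \<omega>) \<partial>M)"]) auto
  then show ?thesis by (simp add: LIM_zero_iff)
qed

text \<open>The cut-off distances \<open>g n\<close> are bounded and Lipschitz and decrease to the
  indicator of a closed set; closed sets form an intersection-stable generator.\<close>

lemma borel_prob_eqI_lipschitz:
  fixes \<mu> \<nu> :: "'a::euclidean_space measure"
  assumes "prob_space \<mu>" "prob_space \<nu>" and sets: "sets \<mu> = sets borel" "sets \<nu> = sets borel"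
    and eq: "\<And>g L B. (\<And>x y. \<bar>g x - g y\<bar> \<le> L * norm (x - y)) \<Longrightarrow> (\<And>x. \<bar>g x\<bar> \<le> (B::real)) \<Longrightarrow>
      (\<integral>x. g x \<partial>\<mu>) = (\<integral>x. g x \<partial>\<nu>)"
  shows "\<mu> = \<nu>"
proof -
  interpret M: prob_space \<mu> by fact
  interpret N: prob_space \<nu> by fact
  have [measurable_cong]: "sets \<mu> = sets borel" "sets \<nu> = sets borel" by fact+
  have closed: "measure \<mu> K = measure \<nu> K" if K: "closed K" for K
  \<comment> \<open>The empty set is separate because \<open>infdist x {}\<close> is
    \<open>0\<close> by convention, so that \<open>g n\<close> would be constantly
    \<open>1\<close>.\<close>
  proof (cases "K = {}")
    case False
    define g where "g n x = max 0 (1 - real n * infdist x K)" for n x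
    have [measurable]: "K \<in> sets borel" using K by simp
    have [measurable]: "g n \<in> borel_measurable borel" for n unfolding g_def
      by (intro borel_measurable_continuous_onI continuous_intros)
    have bd: "\<bar>g n x\<bar> \<le> 1" for n x using infdist_nonneg[of x K] by (auto simp: g_def)
    have lip: "\<bar>g n x - g n y\<bar> \<le> real n * norm (x - y)" for n x y
    proof -
      have "\<bar>infdist x K - infdist y K\<bar> \<le> norm (x - y)"
        using infdist_triangle_abs[of x K y] by (simp add: dist_norm)
      then have "\<bar>real n * infdist x K - real n * infdist y K\<bar> \<le> real n * norm (x - y)"
        by (simp add: right_diff_distrib[symmetric] abs_mult mult_left_mono)
      then show ?thesis unfolding g_def by linarith
    qed
    have lim: "(\<lambda>n. g n x) \<longlonglongrightarrow> indicator K x" for x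
    proof (cases "x \<in> K")
      case True then show ?thesis by (simp add: g_def)
    next
      case False
      then have "infdist x K > 0" using K \<open>K \<noteq> {}\<close> by (simp add: infdist_pos_not_in_closed)
      then obtain n0 where n0: "real n0 * infdist x K > 1" using reals_Archimedean3 by blast
      have "g n x = 0" if "n \<ge> n0" for n
      proof -
        have "real n0 * infdist x K \<le> real n * infdist x K"
          using that \<open>infdist x K > 0\<close> by (intro mult_right_mono) auto
        then show ?thesis using n0 by (simp add: g_def)
      qed
      then have "\<forall>\<^sub>F n in sequentially. g n x = 0" by (auto simp: eventually_sequentially)
      then show ?thesis using False by (auto intro: tendsto_eventually)
    qed
    have "(\<lambda>n. \<integral>x. g n x \<partial>\<mu>) \<longlonglongrightarrow> (\<integral>x. indicator K x \<partial>\<mu>)"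
      by (rule integral_dominated_convergence[where w = "\<lambda>_. 1"]) (auto simp: lim bd)
    moreover have "(\<lambda>n. \<integral>x. g n x \<partial>\<nu>) \<longlonglongrightarrow> (\<integral>x. indicator K x \<partial>\<nu>)"
      by (rule integral_dominated_convergence[where w = "\<lambda>_. 1"]) (auto simp: lim bd)
    moreover have "(\<integral>x. g n x \<partial>\<mu>) = (\<integral>x. g n x \<partial>\<nu>)" for n
      using lip bd by (rule eq)
    ultimately have "(\<integral>x. indicator K x \<partial>\<mu>) = (\<integral>x. (indicator K x :: real) \<partial>\<nu>)"
      using LIMSEQ_unique by fastforce
    then show ?thesis by simp
  qed simp
  show ?thesis
  proof (rule measure_eqI_generator_eq[where E = "Collect closed" and \<Omega> = UNIV and A = "\<lambda>_. UNIV"])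
    show "Int_stable (Collect closed)" by (auto simp: Int_stable_def)
    show "sets \<mu> = sigma_sets UNIV (Collect closed)" "sets \<nu> = sigma_sets UNIV (Collect closed)"
      unfolding sets by (simp_all add: borel_eq_closed)
  qed (use closed in \<open>auto simp: M.emeasure_eq_measure N.emeasure_eq_measure\<close>)
qed

text \<open>L^2 convergence passes to expectations of bounded Lipschitz functions, which determine
  the law. In \<open>eq\<close> the function \<open>g\<close> is arbitrary because the lemma serves
  for simple approximants, whose expectations are finite sums.\<close>

lemma law_eq_of_L2_limits:
  fixes U :: "nat \<Rightarrow> 'w \<Rightarrow> 'a::euclidean_space" and U' :: "nat \<Rightarrow> 'v \<Rightarrow> 'a"
  assumes "prob_space M" "prob_space N"
    and U: "\<And>k. U k \<in> L2_rv M" "V \<in> L2_rv M" "(\<lambda>k. L2_norm M (\<lambda>\<omega>. U k \<omega> - V \<omega>)) \<longlonglongrightarrow> 0"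
    and U': "\<And>k. U' k \<in> L2_rv N" "V' \<in> L2_rv N" "(\<lambda>k. L2_norm N (\<lambda>\<omega>. U' k \<omega> - V' \<omega>)) \<longlonglongrightarrow> 0"
    and eq: "\<And>k (g :: 'a \<Rightarrow> real). (\<integral>\<omega>. g (U k \<omega>) \<partial>M) = (\<integral>\<omega>. g (U' k \<omega>) \<partial>N)"
  shows "distr M borel V = distr N borel V'"
proof -
  interpret M: prob_space M by fact
  interpret N: prob_space N by fact
  have [measurable]: "V \<in> borel_measurable M" "V' \<in> borel_measurable N" using U U' by (auto simp: L2_rv_def)
  show ?thesis
  proof (rule borel_prob_eqI_lipschitz)
    fix g :: "'a \<Rightarrow> real" and L B
    assume g: "\<And>x y. \<bar>g x - g y\<bar> \<le> L * norm (x - y)" "\<And>x. \<bar>g x\<bar> \<le> B"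
    from g(1) have "continuous_on UNIV g" by (rule continuous_on_lipschitz_bound)
    then have [measurable]: "g \<in> borel_measurable borel" by (rule borel_measurable_continuous_onI)
    have "(\<integral>\<omega>. g (V \<omega>) \<partial>M) = (\<integral>\<omega>. g (V' \<omega>) \<partial>N)"
      using M.L2_limit_lipschitz_integral[OF U g] N.L2_limit_lipschitz_integral[OF U' g]
      unfolding eq by (rule LIMSEQ_unique)
    then show "(\<integral>x. g x \<partial>law M V) = (\<integral>x. g x \<partial>law N V')" by (simp add: integral_distr)
  qed (auto intro: M.prob_space_distr N.prob_space_distr)
qed

section \<open>Realising laws on an atomless space\<close>

text \<open>Labels are split off one at a time by \<open>atomless_intermediate\<close>; the last one
  receives the rest of \<open>S\<close>.\<close>

lemma atomless_split:
  fixes w :: "'a \<Rightarrow> real"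
  assumes "prob_space M" "atomless M" "finite A" "A \<noteq> {}"
  shows "S \<in> sets M \<Longrightarrow> (\<And>a. a \<in> A \<Longrightarrow> 0 \<le> w a) \<Longrightarrow> sum w A = measure M S \<Longrightarrow>
    \<exists>g \<in> M \<rightarrow>\<^sub>M count_space UNIV. (\<forall>\<omega>. g \<omega> \<in> A) \<and> (\<forall>a\<in>A. measure M {\<omega>\<in>S. g \<omega> = a} = w a)"
  using assms(3,4)
proof (induction A arbitrary: S rule: finite_ne_induct)
  case (singleton a)
  then show ?case by (intro bexI[of _ "\<lambda>_. a"]) auto
next
  case (insert a A)
  interpret prob_space M by fact
  have le: "w a \<le> measure M S"
    using insert.prems(2,3) insert.hyps by (simp add: sum_nonneg flip: insert.prems(3))
  obtain B where B: "B \<in> sets M" "B \<subseteq> S" "measure M B = w a"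
    using atomless_intermediate[OF assms(1,2) insert.prems(1) _ le] insert.prems(2) by auto
  have "measure M (S - B) = sum w A"
    using B insert.prems insert.hyps by (subst finite_measure_Diff) (auto simp flip: insert.prems(3))
  then obtain g where g: "g \<in> M \<rightarrow>\<^sub>M count_space UNIV" "\<And>\<omega>. g \<omega> \<in> A"
    "\<And>b. b \<in> A \<Longrightarrow> measure M {\<omega>\<in>S - B. g \<omega> = b} = w b"
    using insert.IH[of "S - B"] insert.prems B by auto
  note [measurable] = g(1) B(1)
  show ?case
  proof (intro bexI conjI allI ballI)
    let ?g = "\<lambda>\<omega>. if \<omega> \<in> B then a else g \<omega>"
    show "?g \<in> M \<rightarrow>\<^sub>M count_space UNIV" by measurable
    show "?g \<omega> \<in> insert a A" for \<omega> using g(2) by auto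
    fix b assume "b \<in> insert a A"
    then consider "b = a" | "b \<in> A" "b \<noteq> a" by auto
    then show "measure M {\<omega>\<in>S. ?g \<omega> = b} = w b"
    proof cases
      case 1
      have "{\<omega>\<in>S. ?g \<omega> = b} = B" using 1 B(2) g(2) insert.hyps by (auto split: if_splits)
      then show ?thesis using 1 B by simp
    next
      case 2
      then have "{\<omega>\<in>S. ?g \<omega> = b} = {\<omega>\<in>S - B. g \<omega> = b}" by auto
      then show ?thesis using 2 g(3) by simp
    qed
  qed
qed

lemma simple_functionI_count_space:
  assumes "g \<in> M \<rightarrow>\<^sub>M count_space UNIV" "finite A" "\<And>\<omega>. \<omega> \<in> space M \<Longrightarrow> g \<omega> \<in> A"
  shows "simple_function M g"
  unfolding simple_function_def
proof
  show "finite (g ` space M)" using assms(2,3) by (auto intro: finite_subset[of _ A])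
qed (use assms(1) in \<open>auto intro: measurable_sets\<close>)

text \<open>One refinement step. Every cell of \<open>C\<close> is cut separately, so all joint
  weights with the right row sums are attained while \<open>C\<close>, which may depend on a given
  variable, is left untouched.\<close>

lemma atomless_extend:
  fixes p :: "'i \<Rightarrow> 'a \<Rightarrow> real"
  assumes "prob_space M" "atomless M" and A: "finite A" "A \<noteq> {}" and V: "finite V"
    and C: "simple_function M C" "\<And>\<omega>. \<omega> \<in> space M \<Longrightarrow> C \<omega> \<in> V"
    and p: "\<And>i a. 0 \<le> p i a" "\<And>i. i \<in> V \<Longrightarrow> (\<Sum>a\<in>A. p i a) = measure M {\<omega>\<in>space M. C \<omega> = i}"
  obtains G where "simple_function M G" "\<And>\<omega>. G \<omega> \<in> A"
    "\<And>i a. i \<in> V \<Longrightarrow> a \<in> A \<Longrightarrow> measure M {\<omega>\<in>space M. C \<omega> = i \<and> G \<omega> = a} = p i a"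
proof -
  note [measurable] = measurable_simple_function[OF C(1)]
  define S where "S i = {\<omega>\<in>space M. C \<omega> = i}" for i
  have S [measurable]: "S i \<in> sets M" for i unfolding S_def by measurable
  have "\<exists>g. g \<in> M \<rightarrow>\<^sub>M count_space UNIV \<and> (\<forall>\<omega>. g \<omega> \<in> A) \<and>
      (\<forall>a\<in>A. measure M {\<omega>\<in>S i. g \<omega> = a} = p i a)" if "i \<in> V" for i
    using atomless_split[OF assms(1,2) A, of "S i" "p i"] p(1) p(2)[OF that] S[of i]
    by (auto simp: S_def)
  then have "\<exists>g. \<forall>i\<in>V. g i \<in> M \<rightarrow>\<^sub>M count_space UNIV \<and> (\<forall>\<omega>. g i \<omega> \<in> A) \<and>
      (\<forall>a\<in>A. measure M {\<omega>\<in>S i. g i \<omega> = a} = p i a)"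
    by (intro bchoice) blast
  then obtain g where g: "\<And>i. i \<in> V \<Longrightarrow> g i \<in> M \<rightarrow>\<^sub>M count_space UNIV" "\<And>i \<omega>. i \<in> V \<Longrightarrow> g i \<omega> \<in> A"
      "\<And>i a. i \<in> V \<Longrightarrow> a \<in> A \<Longrightarrow> measure M {\<omega>\<in>S i. g i \<omega> = a} = p i a"
    by blast
  obtain a0 where "a0 \<in> A" using A by auto
  define G where "G \<omega> = (if C \<omega> \<in> V then g (C \<omega>) \<omega> else a0)" for \<omega>
  show ?thesis
  proof
    have CV: "C \<in> M \<rightarrow>\<^sub>M count_space V"
      using C V by (subst measurable_count_space_eq2)
        (auto intro: measurable_sets[OF measurable_simple_function])
    have "(\<lambda>\<omega>. g (C \<omega>) \<omega>) \<in> M \<rightarrow>\<^sub>M count_space UNIV"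
    proof (rule measurable_compose_countable'[where f = g and g = C and I = V])
      show "g i \<in> M \<rightarrow>\<^sub>M count_space UNIV" if "i \<in> V" for i using that by (rule g(1))
    qed (use CV V in \<open>auto intro: countable_finite\<close>)
    moreover have "G \<in> M \<rightarrow>\<^sub>M count_space UNIV \<longleftrightarrow> (\<lambda>\<omega>. g (C \<omega>) \<omega>) \<in> M \<rightarrow>\<^sub>M count_space UNIV"
      by (rule measurable_cong) (simp add: G_def C(2))
    ultimately have G: "G \<in> M \<rightarrow>\<^sub>M count_space UNIV" by simp
    show GA: "G \<omega> \<in> A" for \<omega> using g(2) \<open>a0 \<in> A\<close> by (simp add: G_def)
    show "simple_function M G" using G A(1) GA by (rule simple_functionI_count_space)
    fix i a assume "i \<in> V" "a \<in> A"
    moreover have "{\<omega>\<in>space M. C \<omega> = i \<and> G \<omega> = a} = {\<omega>\<in>S i. g i \<omega> = a}"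
      using \<open>i \<in> V\<close> by (auto simp: S_def G_def)
    ultimately show "measure M {\<omega>\<in>space M. C \<omega> = i \<and> G \<omega> = a} = p i a" using g(3) by simp
  qed
qed

text \<open>A word of length \<open>k\<close> names a cell of the common refinement of
  \<open>k\<close> successive partitions; every level \<open>j\<close> has its own alphabet
  \<open>A j\<close>.\<close>

definition words :: "(nat \<Rightarrow> 'a set) \<Rightarrow> nat \<Rightarrow> 'a list set" where
  "words A k = {l. length l = k \<and> (\<forall>j<k. l ! j \<in> A j)}"

lemma words_0 [simp]: "words A 0 = {[]}"
  by (auto simp: words_def)

lemma words_Suc: "l \<in> words A (Suc k) \<longleftrightarrow> (\<exists>l' a. l = l' @ [a] \<and> l' \<in> words A k \<and> a \<in> A k)"
proof (cases l rule: rev_cases)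
  case (snoc l' a)
  then show ?thesis by (auto simp: words_def nth_append less_Suc_eq)
qed (simp add: words_def)

lemma words_snoc [simp]: "l @ [a] \<in> words A (Suc k) \<longleftrightarrow> l \<in> words A k \<and> a \<in> A k"
  by (simp add: words_Suc)

lemma finite_words:
  assumes "\<And>k. finite (A k)"
  shows "finite (words A k)"
proof (induction k)
  case (Suc k)
  have "words A (Suc k) = (\<lambda>(l, a). l @ [a]) ` (words A k \<times> A k)" by (auto simp: words_Suc)
  then show ?case using Suc assms by simp
qed simp

lemma map_upt_in_words: "(\<And>j. f j \<in> A j) \<Longrightarrow> map f [0..<k] \<in> words A k"
  by (simp add: words_def)

text \<open>A Kolmogorov extension on the given space: weights on words that are consistent under
  appending a letter are attained by successive refinements of the cells of \<open>C\<close>. The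
  words are built by dependent choice, each one a prefix of the next.\<close>

lemma atomless_process:
  fixes p :: "'i \<Rightarrow> 'a list \<Rightarrow> real"
  assumes M: "prob_space M" "atomless M" and A: "\<And>k. finite (A k)" "\<And>k. A k \<noteq> {}" and V: "finite V"
    and C: "simple_function M C" "\<And>\<omega>. \<omega> \<in> space M \<Longrightarrow> C \<omega> \<in> V"
    and p: "\<And>i l. 0 \<le> p i l" "\<And>i. i \<in> V \<Longrightarrow> p i [] = measure M {\<omega>\<in>space M. C \<omega> = i}"
      "\<And>i l k. i \<in> V \<Longrightarrow> l \<in> words A k \<Longrightarrow> (\<Sum>a\<in>A k. p i (l @ [a])) = p i l"
  obtains G where "\<And>k. simple_function M (G k)" "\<And>k \<omega>. G k \<omega> \<in> A k"
    "\<And>i k l. i \<in> V \<Longrightarrow> l \<in> words A k \<Longrightarrow>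
       measure M {\<omega>\<in>space M. C \<omega> = i \<and> map (\<lambda>j. G j \<omega>) [0..<k] = l} = p i l"
proof -
  define P where "P k L \<longleftrightarrow> simple_function M L \<and> (\<forall>\<omega>. L \<omega> \<in> words A k) \<and>
    (\<forall>i\<in>V. \<forall>l\<in>words A k. measure M {\<omega>\<in>space M. C \<omega> = i \<and> L \<omega> = l} = p i l)" for k L
  define Q where "Q k L L' \<longleftrightarrow> (\<forall>\<omega>. L \<omega> = butlast (L' \<omega>))" for k :: nat and L L' :: "'b \<Rightarrow> 'a list"
  note [measurable] = measurable_simple_function[OF C(1)]
  have "\<exists>L. \<forall>k. P k (L k) \<and> Q k (L k) (L (Suc k))"
  proof (rule dependent_nat_choice)
    have "P 0 (\<lambda>_. [])" using p(2) by (simp add: P_def)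
    then show "\<exists>L. P 0 L" by blast
    fix L k assume "P k L"
    then have L: "simple_function M L" and Lw: "\<And>\<omega>. L \<omega> \<in> words A k"
      and Lp: "\<And>i l. i \<in> V \<Longrightarrow> l \<in> words A k \<Longrightarrow> measure M {\<omega>\<in>space M. C \<omega> = i \<and> L \<omega> = l} = p i l"
      by (auto simp: P_def)
    have fin: "finite (V \<times> words A k)" using V finite_words[OF A(1)] by simp
    have CL: "simple_function M (\<lambda>\<omega>. (C \<omega>, L \<omega>))" using C(1) L by (rule simple_function_Pair)
    have CLV: "(C \<omega>, L \<omega>) \<in> V \<times> words A k" if "\<omega> \<in> space M" for \<omega> using C(2)[OF that] Lw by simp
    have "(\<Sum>a\<in>A k. p (fst i) (snd i @ [a])) = measure M {\<omega>\<in>space M. (C \<omega>, L \<omega>) = i}"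
      if "i \<in> V \<times> words A k" for i
      using that p(3) Lp by (auto simp: mem_Times_iff prod_eq_iff)
    from atomless_extend[OF M A(1,2) fin CL CLV p(1) this]
    obtain G where G: "simple_function M G" and GA: "\<And>\<omega>. G \<omega> \<in> A k"
      and Gp: "\<And>i a. i \<in> V \<times> words A k \<Longrightarrow> a \<in> A k \<Longrightarrow>
        measure M {\<omega>\<in>space M. (C \<omega>, L \<omega>) = i \<and> G \<omega> = a} = p (fst i) (snd i @ [a])" by blast
    have "P (Suc k) (\<lambda>\<omega>. L \<omega> @ [G \<omega>])"
      unfolding P_def
    proof (intro conjI allI ballI)
      show "simple_function M (\<lambda>\<omega>. L \<omega> @ [G \<omega>])"
        using L G by (rule simple_function_compose2)
      show "L \<omega> @ [G \<omega>] \<in> words A (Suc k)" for \<omega> using Lw GA by simp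
      fix i l assume "i \<in> V" "l \<in> words A (Suc k)"
      then obtain l' a where "l = l' @ [a]" "l' \<in> words A k" "a \<in> A k" by (auto simp: words_Suc)
      then show "measure M {\<omega>\<in>space M. C \<omega> = i \<and> L \<omega> @ [G \<omega>] = l} = p i l"
        using Gp[of "(i, l')" a] \<open>i \<in> V\<close> by (simp add: conj_assoc)
    qed
    moreover have "Q k L (\<lambda>\<omega>. L \<omega> @ [G \<omega>])" by (simp add: Q_def)
    ultimately show "\<exists>L'. P (Suc k) L' \<and> Q k L L'" by blast
  qed
  then obtain L where L: "\<And>k. P k (L k)" and LQ: "\<And>k \<omega>. L k \<omega> = butlast (L (Suc k) \<omega>)"
    unfolding Q_def by blast
  \<comment> \<open>Each word is \<open>butlast\<close> of its successor, so the letter at position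
    \<open>k\<close> is never changed later.\<close>
  define G where "G k \<omega> = last (L (Suc k) \<omega>)" for k \<omega>
  have Lw: "L k \<omega> \<in> words A k" for k \<omega> using L by (auto simp: P_def)
  have step: "L (Suc k) \<omega> = L k \<omega> @ [G k \<omega>]" for k \<omega>
    using Lw[of "Suc k" \<omega>] unfolding LQ[of k] G_def by (auto simp: words_Suc)
  have Lmap: "L k \<omega> = map (\<lambda>j. G j \<omega>) [0..<k]" for k \<omega>
  proof (induction k)
    case 0 show ?case using Lw[of 0] by simp
  qed (simp add: step)
  show ?thesis
  proof
    show "simple_function M (G k)" for k
      unfolding G_def using simple_function_compose1[of M "L (Suc k)" last] L by (simp add: P_def)
    show "G k \<omega> \<in> A k" for k \<omega> using Lw[of "Suc k" \<omega>] step by simp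
    show "measure M {\<omega>\<in>space M. C \<omega> = i \<and> map (\<lambda>j. G j \<omega>) [0..<k] = l} = p i l"
      if "i \<in> V" "l \<in> words A k" for i k l
      using L[of k] that by (auto simp: P_def Lmap)
  qed
qed

lemma simple_function_L2:
  fixes W :: "'w \<Rightarrow> 'a::euclidean_space"
  assumes "prob_space M" "simple_function M W"
  shows "W \<in> L2_rv M"
proof -
  interpret prob_space M by fact
  have [measurable]: "W \<in> borel_measurable M" using assms(2) by (rule borel_measurable_simple_function)
  have "finite (W ` space M)" using assms(2) by (simp add: simple_function_def)
  then obtain B where "\<And>\<omega>. \<omega> \<in> space M \<Longrightarrow> norm (W \<omega>) \<le> B"
    using finite_imp_bounded[THEN bounded_iff[THEN iffD1]] by (metis image_eqI)
  then have "integrable M (\<lambda>\<omega>. (norm (W \<omega>))\<^sup>2)"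
    by (intro integrable_const_bound[where B = "B\<^sup>2"]) (auto intro!: power_mono)
  then show ?thesis by (simp add: L2_rv_def)
qed

lemma simple_function_measurable_comp:
  fixes c :: "'b::topological_space \<Rightarrow> 'v"
  assumes "simple_function borel c" "f \<in> borel_measurable N"
  shows "simple_function N (\<lambda>\<omega>. c (f \<omega>))"
proof (rule simple_functionI_count_space)
  show "(\<lambda>\<omega>. c (f \<omega>)) \<in> N \<rightarrow>\<^sub>M count_space UNIV"
    using measurable_compose[OF assms(2) measurable_simple_function[OF assms(1)]] by simp
  show "finite (range c)" using assms(1) by (simp add: simple_function_def)
qed auto

text \<open>Cantor's diagonal argument in the form of sequential compactness of the cube of
  sequences in \<open>{0..1}\<close>, after enumerating \<open>S\<close>.\<close>

lemma bounded_real_subsequence: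
  fixes f :: "nat \<Rightarrow> 'i \<Rightarrow> real"
  assumes "countable S" and bd: "\<And>n x. 0 \<le> f n x" "\<And>n x. f n x \<le> 1"
  obtains r where "strict_mono r" "\<And>x. x \<in> S \<Longrightarrow> convergent (\<lambda>n. f (r n) x)"
proof -
  define K :: "(nat \<Rightarrow> real) set" where "K = PiE UNIV (\<lambda>_. {0..1})"
  have "compact K"
    unfolding K_def
    using compactin_PiE[of "\<lambda>_::nat. euclidean :: real topology" UNIV "\<lambda>_. {0..1}"]
    by (simp add: euclidean_product_topology)
  then have K: "seq_compact K" by (rule compact_imp_seq_compact)
  define u where "u n = (\<lambda>k. f n (from_nat_into S k))" for n
  have "u n \<in> K" for n using bd by (auto simp: u_def K_def)
  then obtain l r where r: "strict_mono r" "(u \<circ> r) \<longlonglongrightarrow> l"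
    using K unfolding seq_compact_def by metis
  show ?thesis
  proof
    show "convergent (\<lambda>n. f (r n) x)" if "x \<in> S" for x
    proof -
      obtain k where k: "from_nat_into S k = x" using assms(1) \<open>x \<in> S\<close> by (metis from_nat_into_surj)
      have "(\<lambda>n. (u \<circ> r) n k) \<longlonglongrightarrow> l k"
        using continuous_on_tendsto_compose[OF continuous_on_product_coordinates[of k] r(2)] by simp
      then show ?thesis by (auto simp: u_def k convergent_def)
    qed
  qed fact
qed

lemma (in prob_space) integral_finite_range:
  fixes \<phi> :: "'v \<Rightarrow> real"
  assumes "simple_function M W" "finite R" "\<And>\<omega>. \<omega> \<in> space M \<Longrightarrow> W \<omega> \<in> R"
  shows "(\<integral>\<omega>. \<phi> (W \<omega>) \<partial>M) = (\<Sum>v\<in>R. \<phi> v * measure M {\<omega>\<in>space M. W \<omega> = v})"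
proof -
  have [measurable]: "W \<in> M \<rightarrow>\<^sub>M count_space UNIV" by (rule measurable_simple_function) fact
  have ind: "integrable M (indicator {\<omega>\<in>space M. W \<omega> = v} :: 'a \<Rightarrow> real)" for v
    by (rule integrable_real_indicator) (measurable, simp add: less_top[symmetric])
  have "\<phi> (W \<omega>) = (\<Sum>v\<in>R. \<phi> v * indicator {\<omega>\<in>space M. W \<omega> = v} \<omega>)" if "\<omega> \<in> space M" for \<omega>
  proof -
    have "(\<Sum>v\<in>R. \<phi> v * indicator {\<omega>\<in>space M. W \<omega> = v} \<omega>) = (\<Sum>v\<in>R. if v = W \<omega> then \<phi> v else 0)"
      using that by (intro sum.cong) (auto simp: indicator_def)
    then show ?thesis using assms(2,3) that by simp
  qed
  then have "(\<integral>\<omega>. \<phi> (W \<omega>) \<partial>M) = (\<integral>\<omega>. (\<Sum>v\<in>R. \<phi> v * indicator {\<omega>\<in>space M. W \<omega> = v} \<omega>) \<partial>M)"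
    by (intro Bochner_Integration.integral_cong) auto
  also have "\<dots> = (\<Sum>v\<in>R. \<integral>\<omega>. \<phi> v * indicator {\<omega>\<in>space M. W \<omega> = v} \<omega> \<partial>M)"
    using ind by (intro Bochner_Integration.integral_sum integrable_mult_right)
  also have "\<dots> = (\<Sum>v\<in>R. \<phi> v * measure M {\<omega>\<in>space M. W \<omega> = v})"
    by (intro sum.cong) auto
  finally show ?thesis .
qed

lemma simple_function_map_upt:
  "(\<And>j. simple_function N (F j)) \<Longrightarrow> simple_function N (\<lambda>z. map (\<lambda>j. F j z) [0..<k])"
proof (induction k)
  case (Suc k)
  have "simple_function N (\<lambda>z. map (\<lambda>j. F j z) [0..<k] @ [F k z])"
    by (rule simple_function_compose2[where h = "\<lambda>l a. l @ [a]", OF Suc.IH[OF Suc.prems] Suc.prems])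
  then show ?case by simp
qed simp

text \<open>
  A diagonal subsequence makes the weights of all cells of the nested finite partitions given by
  the \<open>F k\<close> converge; cutting \<open>M\<close> along the limiting weights gives a sequence \<open>G\<close> that is Cauchy because
  the partitions approximate the identity uniformly in \<open>n\<close>. This serves as a compactness theorem and,
  for a constant sequence of laws, as a realisation theorem relative to the given \<open>C\<close>.
\<close>
lemma atomless_realization:
  fixes \<rho> :: "nat \<Rightarrow> 'b::euclidean_space measure" and F :: "nat \<Rightarrow> 'b \<Rightarrow> 'b"
    and C :: "'w \<Rightarrow> 'c" and h :: "'b \<Rightarrow> 'c"
  assumes M: "prob_space M" "atomless M"
    and \<rho>: "\<And>n. prob_space (\<rho> n)" "\<And>n. sets (\<rho> n) = sets borel"
    and F: "\<And>k. simple_function borel (F k)"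
    and F_L2: "\<And>n k. (\<lambda>z. F k z - z) \<in> L2_rv (\<rho> n)"
    and F_le: "\<And>n k. L2_norm (\<rho> n) (\<lambda>z. F k z - z) \<le> (1/2) ^ k"
    and C: "simple_function M C" and h: "simple_function borel h"
    and Ch: "\<And>n i. measure (\<rho> n) {z. h z = i} = measure M {\<omega>\<in>space M. C \<omega> = i}"
  obtains r G Z where "strict_mono r" "\<And>k. simple_function M (G k)" "Z \<in> L2_rv M"
    "\<And>k. L2_norm M (\<lambda>\<omega>. G k \<omega> - Z \<omega>) \<le> 4 * (1/2) ^ k"
    "\<And>k (\<phi> :: 'c \<Rightarrow> 'b \<Rightarrow> real). (\<lambda>n. \<integral>z. \<phi> (h z) (F k z) \<partial>\<rho> (r n)) \<longlonglongrightarrow> (\<integral>\<omega>. \<phi> (C \<omega>) (G k \<omega>) \<partial>M)"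
proof -
  interpret M: prob_space M by fact
  interpret R: prob_space "\<rho> n" for n by (rule \<rho>)
  have sp: "space (\<rho> n) = UNIV" for n using sets_eq_imp_space_eq[OF \<rho>(2)] by simp
  define A where "A k = range (F k)" for k
  have A: "finite (A k)" "A k \<noteq> {}" for k using F[of k] by (auto simp: A_def simple_function_def)
  \<comment> \<open>Values of \<open>h\<close> and of \<open>C\<close> together, so that one finite
    index set serves for all \<open>\<rho> n\<close> and for \<open>M\<close>.\<close>
  define V where "V = range h \<union> C ` space M"
  have V: "finite V" using C h by (auto simp: V_def simple_function_def)
  let ?W = "\<lambda>k z. map (\<lambda>j. F j z) [0..<k]"
  have simp\<rho>: "simple_function (\<rho> n) f" if "simple_function borel f" for n and f :: "'b \<Rightarrow> 'x"
    using that by (simp add: simple_function_def sp \<rho>(2))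
  have hW: "simple_function (\<rho> n) (\<lambda>z. (h z, ?W k z))" for n k
    by (intro simp\<rho> simple_function_Pair h simple_function_map_upt F)
  have meas: "{z. h z = i \<and> ?W k z = l} \<in> sets (\<rho> n)" for i k l n
  proof -
    have "(\<lambda>z. (h z, ?W k z)) -` {(i, l)} \<inter> space (\<rho> n) \<in> sets (\<rho> n)"
      using measurable_simple_function[OF hW] by (rule measurable_sets) simp
    then show ?thesis by (simp add: sp vimage_def)
  qed
  define q where "q n i l = measure (\<rho> n) {z. h z = i \<and> ?W (length l) z = l}" for n i l
  have q_sum: "(\<Sum>a\<in>A k. q n i (l @ [a])) = q n i l" if "length l = k" for n i l k
  proof -
    have "(\<Sum>a\<in>A k. q n i (l @ [a])) = measure (\<rho> n) (\<Union>a\<in>A k. {z. h z = i \<and> ?W (Suc k) z = l @ [a]})"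
      unfolding q_def using A meas that
      by (subst R.finite_measure_finite_Union) (auto simp: disjoint_family_on_def simp del: upt_Suc)
    also have "(\<Union>a\<in>A k. {z. h z = i \<and> ?W (Suc k) z = l @ [a]}) = {z. h z = i \<and> ?W k z = l}"
      by (auto simp: A_def)
    finally show ?thesis using that by (simp add: q_def)
  qed
  define S where "S = V \<times> (\<Union>k. words A k)"
  have "countable (words A k)" for k using finite_words[of A, OF A(1)] by (rule countable_finite)
  then have "countable S" unfolding S_def using V by (auto intro: countable_finite)
  then obtain r where r: "strict_mono r" and conv: "\<And>x. x \<in> S \<Longrightarrow> convergent (\<lambda>n. q (r n) (fst x) (snd x))"
    using bounded_real_subsequence[of S "\<lambda>n x. q n (fst x) (snd x)"] by (auto simp: q_def)
  define p where "p i l = lim (\<lambda>n. q (r n) i l)" for i l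
  have plim: "(\<lambda>n. q (r n) i l) \<longlonglongrightarrow> p i l" if "i \<in> V" "l \<in> words A k" for i l k
    using conv[of "(i, l)"] that by (auto simp: S_def p_def convergent_LIMSEQ_iff)
  \<comment> \<open>\<open>p\<close> is a genuine limit only on \<open>S\<close>; elsewhere
    \<open>lim\<close> is unspecified, and the absolute value secures the nonnegativity that
    \<open>atomless_process\<close> asks for at all arguments.\<close>
  define p' where "p' i l = \<bar>p i l\<bar>" for i l
  have p': "p' i l = p i l" if "i \<in> V" "l \<in> words A k" for i l k
    using LIMSEQ_le_const[OF plim[OF that], of 0] by (auto simp: p'_def q_def)
  have p'1: "p' i [] = measure M {\<omega>\<in>space M. C \<omega> = i}" if "i \<in> V" for i
    using plim[OF that, of "[]" 0] p'[OF that, of "[]" 0] by (simp add: q_def Ch LIMSEQ_const_iff)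
  have p'2: "(\<Sum>a\<in>A k. p' i (l @ [a])) = p' i l" if "i \<in> V" "l \<in> words A k" for i l k
  proof -
    have "(\<lambda>n. \<Sum>a\<in>A k. q (r n) i (l @ [a])) \<longlonglongrightarrow> (\<Sum>a\<in>A k. p i (l @ [a]))"
      using that by (intro tendsto_sum plim[of _ _ "Suc k"]) auto
    then have "(\<lambda>n. q (r n) i l) \<longlonglongrightarrow> (\<Sum>a\<in>A k. p i (l @ [a]))"
      using q_sum that by (simp add: words_def)
    then have "(\<Sum>a\<in>A k. p i (l @ [a])) = p i l" using plim[OF that] by (rule LIMSEQ_unique)
    then show ?thesis using that p'[of i _ "Suc k"] p'[OF that] by simp
  qed
  have CV: "C \<omega> \<in> V" if "\<omega> \<in> space M" for \<omega> using that by (simp add: V_def)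
  have p'0: "0 \<le> p' i l" for i l by (simp add: p'_def)
  from atomless_process[of M A V C p', OF M A V C CV p'0 p'1 p'2]
  obtain G where G: "\<And>k. simple_function M (G k)" "\<And>k \<omega>. G k \<omega> \<in> A k"
    and Gp': "\<And>i k l. i \<in> V \<Longrightarrow> l \<in> words A k \<Longrightarrow>
       measure M {\<omega>\<in>space M. C \<omega> = i \<and> map (\<lambda>j. G j \<omega>) [0..<k] = l} = p' i l"
    by blast
  let ?U = "\<lambda>k \<omega>. map (\<lambda>j. G j \<omega>) [0..<k]"
  \<comment> \<open>The expectation of a function of the label and a word is a finite sum, linear in
    the cell weights, so convergence of the weights suffices.\<close>
  have main: "(\<lambda>n. \<integral>z. \<phi> (h z) (?W k z) \<partial>\<rho> (r n)) \<longlonglongrightarrow> (\<integral>\<omega>. \<phi> (C \<omega>) (?U k \<omega>) \<partial>M)"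
    for k and \<phi> :: "'c \<Rightarrow> 'b list \<Rightarrow> real"
  proof -
    let ?R = "V \<times> words A k"
    have fin: "finite ?R" using V finite_words[of A, OF A(1)] by simp
    have "(\<integral>z. \<phi> (h z) (?W k z) \<partial>\<rho> n) = (\<Sum>v\<in>?R. \<phi> (fst v) (snd v) * q n (fst v) (snd v))" for n
    proof -
      have "(\<integral>z. \<phi> (h z) (?W k z) \<partial>\<rho> n) =
          (\<Sum>v\<in>?R. \<phi> (fst v) (snd v) * measure (\<rho> n) {z\<in>space (\<rho> n). (h z, ?W k z) = v})"
        using R.integral_finite_range[where \<phi> = "\<lambda>v. \<phi> (fst v) (snd v)", OF hW[of n k] fin]
        by (simp add: V_def words_def A_def)
      also have "\<dots> = (\<Sum>v\<in>?R. \<phi> (fst v) (snd v) * q n (fst v) (snd v))"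
        by (intro sum.cong) (auto simp: q_def sp words_def)
      finally show ?thesis .
    qed
    moreover have "(\<integral>\<omega>. \<phi> (C \<omega>) (?U k \<omega>) \<partial>M) = (\<Sum>v\<in>?R. \<phi> (fst v) (snd v) * p (fst v) (snd v))"
    proof -
      have "simple_function M (\<lambda>\<omega>. (C \<omega>, ?U k \<omega>))"
        by (intro simple_function_Pair C simple_function_map_upt G)
      moreover have "(C \<omega>, ?U k \<omega>) \<in> ?R" if "\<omega> \<in> space M" for \<omega>
        using that G(2) by (auto simp: V_def intro: map_upt_in_words)
      ultimately have "(\<integral>\<omega>. \<phi> (C \<omega>) (?U k \<omega>) \<partial>M) =
          (\<Sum>v\<in>?R. \<phi> (fst v) (snd v) * measure M {\<omega>\<in>space M. (C \<omega>, ?U k \<omega>) = v})"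
        using M.integral_finite_range[where \<phi> = "\<lambda>v. \<phi> (fst v) (snd v)" and W = "\<lambda>\<omega>. (C \<omega>, ?U k \<omega>)", OF _ fin]
        by simp
      also have "\<dots> = (\<Sum>v\<in>?R. \<phi> (fst v) (snd v) * p (fst v) (snd v))"
        using Gp' p' by (intro sum.cong) auto
      finally show ?thesis .
    qed
    moreover have "(\<lambda>n. \<Sum>v\<in>?R. \<phi> (fst v) (snd v) * q (r n) (fst v) (snd v)) \<longlonglongrightarrow>
        (\<Sum>v\<in>?R. \<phi> (fst v) (snd v) * p (fst v) (snd v))"
      by (intro tendsto_sum tendsto_mult_left plim) auto
    ultimately show ?thesis by simp
  qed
  have GL2: "G k \<in> L2_rv M" for k using M(1) G(1) by (rule simple_function_L2)
  \<comment> \<open>Two successive levels are read off one word of length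
    \<open>Suc (Suc k)\<close>, so the bound on \<open>F (Suc k) - F k\<close>, uniform in
    \<open>n\<close>, passes to the limit. The factor \<open>2\<close> here becomes \<open>4\<close>
    after summing the geometric tail.\<close>
  have "L2_norm M (\<lambda>\<omega>. G (Suc k) \<omega> - G k \<omega>) \<le> 2 * (1/2) ^ k" for k
  proof -
    have bd: "(\<integral>z. (norm (F (Suc k) z - F k z))\<^sup>2 \<partial>\<rho> n) \<le> (2 * (1/2) ^ k)\<^sup>2" for n
    proof -
      have "L2_norm (\<rho> n) (\<lambda>z. F (Suc k) z - F k z) =
          L2_norm (\<rho> n) (\<lambda>z. (F (Suc k) z - z) - (F k z - z))" by simp
      also have "\<dots> \<le> L2_norm (\<rho> n) (\<lambda>z. F (Suc k) z - z) + L2_norm (\<rho> n) (\<lambda>z. F k z - z)"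
        using L2_triangle[OF F_L2[of "Suc k" n] L2_rv_scaleR[OF F_L2[of k n], of "-1"]]
          L2_norm_scaleR[of "\<rho> n" "-1" "\<lambda>z. F k z - z"] by simp
      also have "\<dots> \<le> 2 * (1/2) ^ k" using F_le[of n "Suc k"] F_le[of n k] L2_norm_nonneg[of "\<rho> n" "\<lambda>z. F (Suc k) z - z"]
        by (simp del: L2_norm_nonneg)
      finally show ?thesis unfolding L2_norm_sq[symmetric] by (rule power_mono) simp
    qed
    have "(\<lambda>n. \<integral>z. (norm (F (Suc k) z - F k z))\<^sup>2 \<partial>\<rho> (r n)) \<longlonglongrightarrow> (\<integral>\<omega>. (norm (G (Suc k) \<omega> - G k \<omega>))\<^sup>2 \<partial>M)"
      using main[of "\<lambda>_ l. (norm (l ! Suc k - l ! k))\<^sup>2" "Suc (Suc k)"]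
      by (simp add: nth_append del: upt_Suc)
    then have "(\<integral>\<omega>. (norm (G (Suc k) \<omega> - G k \<omega>))\<^sup>2 \<partial>M) \<le> (2 * (1/2) ^ k)\<^sup>2"
      by (rule LIMSEQ_le_const2) (use bd in auto)
    then show ?thesis unfolding L2_norm_sq[symmetric] by (rule power2_le_imp_le) simp
  qed
  then obtain Z where Z: "Z \<in> L2_rv M" "\<And>k. L2_norm M (\<lambda>\<omega>. G k \<omega> - Z \<omega>) \<le> 4 * (1/2) ^ k"
    using M.L2_geometric_limit[of G 2, OF GL2] by auto
  have "(\<lambda>n. \<integral>z. \<phi> (h z) (F k z) \<partial>\<rho> (r n)) \<longlonglongrightarrow> (\<integral>\<omega>. \<phi> (C \<omega>) (G k \<omega>) \<partial>M)"
    for k and \<phi> :: "'c \<Rightarrow> 'b \<Rightarrow> real"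
    using main[of "\<lambda>i l. \<phi> i (l ! k)" "Suc k"] by (simp del: upt_Suc)
  with r G(1) Z show ?thesis by (rule that)
qed

lemma borel_measurable_fst_borel [measurable]: "(fst :: 'a::topological_space \<times> 'b::topological_space \<Rightarrow> 'a) \<in> borel_measurable borel"
  by (intro borel_measurable_continuous_onI continuous_intros)

lemma borel_measurable_snd_borel [measurable]: "(snd :: 'a::topological_space \<times> 'b::topological_space \<Rightarrow> 'b) \<in> borel_measurable borel"
  by (intro borel_measurable_continuous_onI continuous_intros)

section \<open>Measures with finite second moment and their approximation by simple maps\<close>

lemma P2_D:
  assumes "\<mu> \<in> P2"
  shows "prob_space \<mu>" "sets \<mu> = sets borel" "space \<mu> = UNIV" "(\<lambda>x. x) \<in> L2_rv \<mu>"
  using assms sets_eq_imp_space_eq[of \<mu> borel] by (auto simp: P2_def L2_rv_def measurable_def)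

lemma law_in_P2:
  assumes "prob_space M" "X \<in> L2_rv M"
  shows "law M X \<in> P2"
proof -
  interpret prob_space M by fact
  have [measurable]: "X \<in> borel_measurable M" using assms by (simp add: L2_rv_def)
  show ?thesis using assms by (auto simp: P2_def L2_rv_def integrable_distr_eq intro: prob_space_distr)
qed

lemma L2_rv_law_P2:
  assumes "X \<in> borel_measurable M" "law M X \<in> P2"
  shows "X \<in> L2_rv M"
  using L2_rv_comp[OF refl assms(1) P2_D(4)[OF assms(2)]] by simp

lemma P2_simple_approx:
  assumes "\<mu> \<in> P2" "0 < e"
  obtains c where "simple_function borel c" "(\<lambda>x. c x - x) \<in> L2_rv \<mu>"
    "L2_norm \<mu> (\<lambda>x. c x - x) \<le> e"
proof -
  note \<mu> = P2_D[OF assms(1)]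
  interpret prob_space \<mu> by (rule \<mu>)
  obtain F where F: "\<And>i. simple_function borel (F i)" "\<And>x. (\<lambda>i. F i x) \<longlonglongrightarrow> x"
    "\<And>i x. dist (F i x) 0 \<le> 2 * dist x (0::'a)"
    using borel_measurable_implies_sequence_metric[of "\<lambda>x. x::'a" borel 0] by auto
  have [measurable]: "F i \<in> borel_measurable borel" for i using F(1) by (rule borel_measurable_simple_function)
  note [measurable_cong] = \<mu>(2)
  have int: "integrable \<mu> (\<lambda>x. 9 * (norm x)\<^sup>2)" using \<mu>(4) by (simp add: L2_rv_def)
  \<comment> \<open>The approximants satisfy \<open>norm (F i x) \<le> 2 * norm x\<close>, so the
    error is at most \<open>3 * norm x\<close>; its square is the dominating function.\<close>
  have bd: "(norm (F i x - x))\<^sup>2 \<le> 9 * (norm x)\<^sup>2" for i x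
  proof -
    have "norm (F i x - x) \<le> 3 * norm x"
      using F(3)[of i x] norm_triangle_ineq4[of "F i x" x] by simp
    from power_mono[OF this, of 2] show ?thesis by (simp add: power_mult_distrib)
  qed
  have L2: "(\<lambda>x. F i x - x) \<in> L2_rv \<mu>" for i
    by (rule L2_rv_bound[OF _ int bd]) simp
  have "(\<lambda>i. \<integral>x. (norm (F i x - x))\<^sup>2 \<partial>\<mu>) \<longlonglongrightarrow> (\<integral>x. 0 \<partial>\<mu>)"
  proof (rule integral_dominated_convergence[OF _ _ int])
    show "AE x in \<mu>. (\<lambda>i. (norm (F i x - x))\<^sup>2) \<longlonglongrightarrow> 0"
    proof (rule AE_I2)
      fix x
      have "(\<lambda>i. (norm (F i x - x))\<^sup>2) \<longlonglongrightarrow> (norm (x - x))\<^sup>2" by (intro tendsto_intros F)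
      then show "(\<lambda>i. (norm (F i x - x))\<^sup>2) \<longlonglongrightarrow> 0" by simp
    qed
    show "AE x in \<mu>. norm ((norm (F i x - x))\<^sup>2) \<le> 9 * (norm x)\<^sup>2" for i
      using bd by (intro AE_I2) simp
  qed simp_all
  then have "\<forall>\<^sub>F i in sequentially. (\<integral>x. (norm (F i x - x))\<^sup>2 \<partial>\<mu>) < e\<^sup>2"
    using \<open>0 < e\<close> by (intro order_tendstoD(2)) auto
  then obtain i where "(\<integral>x. (norm (F i x - x))\<^sup>2 \<partial>\<mu>) < e\<^sup>2" by (auto simp: eventually_sequentially)
  then have "L2_norm \<mu> (\<lambda>x. F i x - x) \<le> e"
    unfolding L2_norm_sq[symmetric] using \<open>0 < e\<close> power2_le_imp_le[of _ e] by simp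
  with F(1) L2 show ?thesis by (rule that)
qed

lemma P2_simple_approx_seq:
  assumes "\<mu> \<in> P2" "0 < e"
  obtains c where "\<And>k::nat. simple_function borel (c k)" "\<And>k. (\<lambda>x. c k x - x) \<in> L2_rv \<mu>"
    "\<And>k. L2_norm \<mu> (\<lambda>x. c k x - x) \<le> e * (1/2) ^ k"
proof -
  have "\<exists>c. simple_function borel c \<and> (\<lambda>x. c x - x) \<in> L2_rv \<mu> \<and> L2_norm \<mu> (\<lambda>x. c x - x) \<le> e * (1/2) ^ k"
    for k :: nat
    using P2_simple_approx[OF assms(1), of "e * (1/2) ^ k"] assms(2) by auto
  then have "\<exists>c. \<forall>k::nat. simple_function borel (c k) \<and> (\<lambda>x. c k x - x) \<in> L2_rv \<mu> \<and>
      L2_norm \<mu> (\<lambda>x. c k x - x) \<le> e * (1/2) ^ k"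
    by (intro choice allI)
  then show ?thesis using that by blast
qed

text \<open>The law of \<open>Z\<close> is exact while \<open>p Z = X\<close> holds only up to
  \<open>e\<close>, since \<open>M\<close> may carry no randomness beyond \<open>X\<close>. What is
  matched exactly is the cell: \<open>(C, Z)\<close> has the law of \<open>(c o p, id)\<close> under
  \<open>\<rho>\<close>, and \<open>X\<close> and \<open>p Z\<close> are each within
  \<open>e / 2\<close> of \<open>C\<close>.\<close>

lemma atomless_realize_over:
  fixes X :: "'w \<Rightarrow> 'b::euclidean_space" and \<rho> :: "'c::euclidean_space measure"
  assumes M: "prob_space M" "atomless M" and X: "X \<in> L2_rv M" and \<rho>: "\<rho> \<in> P2"
    and p: "p \<in> borel_measurable borel" "distr \<rho> borel p = law M X" and "0 < e"
  obtains Z where "Z \<in> L2_rv M" "law M Z = \<rho>" "L2_norm M (\<lambda>\<omega>. X \<omega> - p (Z \<omega>)) \<le> e"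
proof -
  interpret M: prob_space M by fact
  interpret R: prob_space \<rho> by (rule P2_D[OF \<rho>])
  note [measurable_cong] = P2_D(2)[OF \<rho>]
  have [measurable]: "X \<in> borel_measurable M" "p \<in> borel_measurable borel" using X p by (auto simp: L2_rv_def)
  have p\<rho>: "p \<in> borel_measurable \<rho>" by measurable
  have XP: "law M X \<in> P2" using M(1) X by (rule law_in_P2)
  obtain c where c: "simple_function borel c" "(\<lambda>x. c x - x) \<in> L2_rv (law M X)"
      "L2_norm (law M X) (\<lambda>x. c x - x) \<le> e / 2"
    using P2_simple_approx[OF XP, of "e / 2"] \<open>0 < e\<close> by auto
  have [measurable]: "c \<in> borel_measurable borel" using c(1) by (rule borel_measurable_simple_function)
  obtain F where F: "\<And>k::nat. simple_function borel (F k)" "\<And>k. (\<lambda>z. F k z - z) \<in> L2_rv \<rho>"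
      "\<And>k. L2_norm \<rho> (\<lambda>z. F k z - z) \<le> (1/2) ^ k"
    using P2_simple_approx_seq[OF \<rho>, of 1] by auto
  define C where "C \<omega> = c (X \<omega>)" for \<omega>
  define h where "h z = c (p z)" for z
  have simp_comp: "simple_function N (\<lambda>\<omega>. c (f \<omega>))" if "f \<in> borel_measurable N" for f :: "'x \<Rightarrow> 'b" and N
    using c(1) that by (rule simple_function_measurable_comp)
  have C: "simple_function M C" unfolding C_def by (rule simp_comp) simp
  have h: "simple_function borel h" unfolding h_def by (rule simp_comp) simp
  have h\<rho>: "simple_function \<rho> h" unfolding h_def by (rule simp_comp) simp
  have [measurable]: "C \<in> borel_measurable M" "h \<in> borel_measurable borel"
    using C h by (auto intro: borel_measurable_simple_function)
  have Ch: "measure \<rho> {z. h z = i} = measure M {\<omega>\<in>space M. C \<omega> = i}" for i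
  proof -
    have "{x. c x = i} \<in> sets borel" by measurable
    then have "measure (distr \<rho> borel p) {x. c x = i} = measure \<rho> {z. h z = i}"
      "measure (law M X) {x. c x = i} = measure M {\<omega>\<in>space M. C \<omega> = i}"
      by (subst measure_distr; simp add: vimage_def h_def C_def Int_def conj_commute P2_D(3)[OF \<rho>])+
    then show ?thesis using p(2) by simp
  qed
  obtain r G Z where "strict_mono (r :: nat \<Rightarrow> nat)" and G: "\<And>k. simple_function M (G k)" and Z: "Z \<in> L2_rv M"
    "\<And>k. L2_norm M (\<lambda>\<omega>. G k \<omega> - Z \<omega>) \<le> 4 * (1/2) ^ k"
    and lim: "\<And>k (\<phi> :: 'b \<Rightarrow> 'c \<Rightarrow> real). (\<lambda>n::nat. \<integral>z. \<phi> (h z) (F k z) \<partial>\<rho>) \<longlonglongrightarrow> (\<integral>\<omega>. \<phi> (C \<omega>) (G k \<omega>) \<partial>M)"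
    by (rule atomless_realization[of M "\<lambda>_. \<rho>" F C h,
        OF M R.prob_space_axioms P2_D(2)[OF \<rho>] F C h Ch]) (rule that)
  have [measurable]: "Z \<in> borel_measurable M" using Z by (simp add: L2_rv_def)
  \<comment> \<open>The realisation theorem is applied to a constant sequence of laws, so its
    convergence statement is an equality.\<close>
  have eq: "(\<integral>\<omega>. \<phi> (C \<omega>) (G k \<omega>) \<partial>M) = (\<integral>z. \<phi> (h z) (F k z) \<partial>\<rho>)" for k and \<phi> :: "'b \<Rightarrow> 'c \<Rightarrow> real"
    using lim[of \<phi> k] by (simp add: LIMSEQ_const_iff)
  have F\<rho>: "simple_function \<rho> (F k)" for k
    using F(1)[of k] by (simp add: simple_function_def P2_D[OF \<rho>])
  have norm_pair: "norm ((x, y) - (x, y')) = norm (y - y')" for x :: 'b and y y' :: 'c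
    by (simp add: norm_Pair)
  have joint: "law M (\<lambda>\<omega>. (C \<omega>, Z \<omega>)) = distr \<rho> borel (\<lambda>z. (h z, z))"
  proof (rule law_eq_of_L2_limits[OF M(1) R.prob_space_axioms,
      where U = "\<lambda>k \<omega>. (C \<omega>, G k \<omega>)" and U' = "\<lambda>k z. (h z, F k z)"])
    show "(\<lambda>\<omega>. (C \<omega>, G k \<omega>)) \<in> L2_rv M" for k
      using M(1) by (rule simple_function_L2) (intro simple_function_Pair C G)
    show "(\<lambda>z. (h z, F k z)) \<in> L2_rv \<rho>" for k
      using R.prob_space_axioms by (rule simple_function_L2) (intro simple_function_Pair h\<rho> F\<rho>)
    show "(\<lambda>\<omega>. (C \<omega>, Z \<omega>)) \<in> L2_rv M"
    proof -
      have "C \<in> L2_rv M" using M(1) C by (rule simple_function_L2)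
      with Z(1) show ?thesis by (auto simp: L2_rv_def norm_Pair)
    qed
    show "(\<lambda>z. (h z, z)) \<in> L2_rv \<rho>"
    proof -
      have "h \<in> L2_rv \<rho>" using R.prob_space_axioms h\<rho> by (rule simple_function_L2)
      with P2_D(4)[OF \<rho>] show ?thesis by (auto simp: L2_rv_def norm_Pair)
    qed
    show "(\<lambda>k. L2_norm M (\<lambda>\<omega>. (C \<omega>, G k \<omega>) - (C \<omega>, Z \<omega>))) \<longlonglongrightarrow> 0"
      unfolding L2_norm_def norm_pair unfolding L2_norm_def[symmetric]
      using Z(2) by (rule L2_norm_null_geometric)
    show "(\<lambda>k. L2_norm \<rho> (\<lambda>z. (h z, F k z) - (h z, z))) \<longlonglongrightarrow> 0"
      unfolding L2_norm_def norm_pair unfolding L2_norm_def[symmetric]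
      using F(3) by (intro L2_norm_null_geometric[where e = 1]) simp
    show "(\<integral>\<omega>. g (C \<omega>, G k \<omega>) \<partial>M) = (\<integral>z. g (h z, F k z) \<partial>\<rho>)" for k and g :: "'b \<times> 'c \<Rightarrow> real"
      using eq[of "\<lambda>x y. g (x, y)" k] .
  qed
  show ?thesis
  proof
    have "law M Z = distr (law M (\<lambda>\<omega>. (C \<omega>, Z \<omega>))) borel snd"
      by (subst distr_distr) (auto simp: comp_def)
    also have "\<dots> = distr \<rho> borel (\<lambda>z. z)"
      unfolding joint by (subst distr_distr) (auto simp: comp_def)
    also have "\<dots> = \<rho>" by (rule distr_id2) (simp add: P2_D[OF \<rho>])
    finally show "law M Z = \<rho>" .
    have "L2_norm M (\<lambda>\<omega>. C \<omega> - p (Z \<omega>)) = L2_norm (law M (\<lambda>\<omega>. (C \<omega>, Z \<omega>))) (\<lambda>u. fst u - p (snd u))"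
      by (subst L2_norm_distr) auto
    also have "\<dots> = L2_norm \<rho> (\<lambda>z. c (p z) - p z)"
      unfolding joint by (subst L2_norm_distr) (auto simp: h_def)
    also have "\<dots> = L2_norm (law M X) (\<lambda>x. c x - x)"
      unfolding p(2)[symmetric] by (subst L2_norm_distr) auto
    finally have 1: "L2_norm M (\<lambda>\<omega>. C \<omega> - p (Z \<omega>)) \<le> e / 2" using c(3) by simp
    have "L2_norm M (\<lambda>\<omega>. X \<omega> - C \<omega>) = L2_norm (law M X) (\<lambda>x. c x - x)"
      unfolding L2_norm_minus_commute[of M X] C_def by (subst L2_norm_distr) auto
    then have 2: "L2_norm M (\<lambda>\<omega>. X \<omega> - C \<omega>) \<le> e / 2" using c(3) by simp
    have "(\<lambda>x. x) \<in> L2_rv (distr \<rho> borel p)" unfolding p(2) by (rule P2_D(4)[OF XP])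
    then have "p \<in> L2_rv \<rho>" by (subst (asm) L2_rv_distr) auto
    then have pZ: "(\<lambda>\<omega>. p (Z \<omega>)) \<in> L2_rv M"
      by (intro L2_rv_comp[OF \<open>law M Z = \<rho>\<close>]) auto
    have "C \<in> L2_rv M" using M(1) C by (rule simple_function_L2)
    from L2_triangle_diff[OF X this pZ] 1 2
    show "L2_norm M (\<lambda>\<omega>. X \<omega> - p (Z \<omega>)) \<le> e" by simp
  qed fact
qed

section \<open>Compactness of pairs with fixed marginals\<close>

lemma LIMSEQ_uniform_approx:
  fixes a :: "nat \<Rightarrow> real"
  assumes "\<And>k n. \<bar>a n - a' k n\<bar> \<le> c * (1/2) ^ k" "\<And>k. \<bar>b' k - b\<bar> \<le> c * (1/2) ^ k"
    "\<And>k. a' k \<longlonglongrightarrow> b' k"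
  shows "a \<longlonglongrightarrow> b"
proof (rule LIMSEQ_I)
  fix e :: real assume "0 < e"
  have "(\<lambda>k. c * (1/2) ^ k) \<longlonglongrightarrow> 0" by (intro tendsto_mult_right_zero LIMSEQ_realpow_zero) auto
  then have "\<forall>\<^sub>F k in sequentially. c * (1/2) ^ k < e / 3" using \<open>0 < e\<close> by (intro order_tendstoD(2)) auto
  then obtain k where k: "c * (1/2) ^ k < e / 3" by (auto simp: eventually_sequentially)
  obtain N where N: "\<And>n. n \<ge> N \<Longrightarrow> norm (a' k n - b' k) < e / 3"
    using LIMSEQ_D[OF assms(3)[of k], of "e / 3"] \<open>0 < e\<close> by auto
  have "norm (a n - b) < e" if "n \<ge> N" for n
    using N[OF that] assms(1)[of n k] assms(2)[of k] k unfolding real_norm_def by linarith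
  then show "\<exists>N. \<forall>n\<ge>N. norm (a n - b) < e" by blast
qed

text \<open>The marginals of \<open>(A, Y n)\<close> do not depend on \<open>n\<close>, so simple
  maps on each factor approximate the identity uniformly in \<open>n\<close>; this plays the role of
  tightness and of uniform integrability. Transport costs and L^2 distances are norms of linear
  images \<open>J\<close> of the pair, hence the form of the conclusion. \<open>A'\<close> agrees
  with \<open>A\<close> in law only.\<close>

lemma atomless_L2_compact:
  fixes A :: "'w \<Rightarrow> 'b::euclidean_space" and Y :: "nat \<Rightarrow> 'w \<Rightarrow> 'c::euclidean_space"
  assumes M: "prob_space M" "atomless M" and A: "A \<in> L2_rv M" and Y: "\<And>n. Y n \<in> L2_rv M"
    and \<nu>: "\<And>n. law M (Y n) = \<nu>"
  obtains r A' Y' where "strict_mono (r :: nat \<Rightarrow> nat)" "A' \<in> L2_rv M" "Y' \<in> L2_rv M"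
    "law M A' = law M A" "law M Y' = \<nu>"
    "\<And>J :: 'b \<times> 'c \<Rightarrow> 'd::euclidean_space. bounded_linear J \<Longrightarrow>
       (\<lambda>n. L2_norm M (\<lambda>\<omega>. J (A \<omega>, Y (r n) \<omega>))) \<longlonglongrightarrow> L2_norm M (\<lambda>\<omega>. J (A' \<omega>, Y' \<omega>))"
proof -
  interpret M: prob_space M by fact
  have AP: "law M A \<in> P2" using M(1) A by (rule law_in_P2)
  have \<nu>P: "\<nu> \<in> P2" using law_in_P2[OF M(1) Y[of 0]] \<nu> by simp
  have mA [measurable]: "A \<in> borel_measurable M" and mY [measurable]: "Y n \<in> borel_measurable M" for n
    using A Y by (auto simp: L2_rv_def)
  \<comment> \<open>Errors of half size on each factor add up to the \<open>(1/2) ^ k\<close> that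
    the realisation theorem demands for the pair.\<close>
  obtain f where f: "\<And>k::nat. simple_function borel (f k)" "\<And>k. (\<lambda>x. f k x - x) \<in> L2_rv (law M A)"
      "\<And>k. L2_norm (law M A) (\<lambda>x. f k x - x) \<le> 1/2 * (1/2) ^ k"
    by (rule P2_simple_approx_seq[OF AP, of "1/2"]) (simp, rule that)
  obtain g where g: "\<And>k::nat. simple_function borel (g k)" "\<And>k. (\<lambda>x. g k x - x) \<in> L2_rv \<nu>"
      "\<And>k. L2_norm \<nu> (\<lambda>x. g k x - x) \<le> 1/2 * (1/2) ^ k"
    by (rule P2_simple_approx_seq[OF \<nu>P, of "1/2"]) (simp, rule that)
  have [measurable]: "f k \<in> borel_measurable borel" "g k \<in> borel_measurable borel" for k
    using f(1) g(1) by (auto intro: borel_measurable_simple_function)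
  define \<rho> where "\<rho> n = law M (\<lambda>\<omega>. (A \<omega>, Y n \<omega>))" for n
  define F where "F k z = (f k (fst z), g k (snd z))" for k and z :: "'b \<times> 'c"
  have \<rho>P: "\<rho> n \<in> P2" for n unfolding \<rho>_def using M(1) L2_rv_Pair[OF A Y] by (rule law_in_P2)
  have \<rho>_fst: "distr (\<rho> n) borel fst = law M A" for n
    unfolding \<rho>_def by (subst distr_distr) (auto simp: comp_def)
  have \<rho>_snd: "distr (\<rho> n) borel snd = \<nu>" for n
    unfolding \<rho>_def by (subst distr_distr) (auto simp: comp_def \<nu>)
  have [measurable_cong]: "sets (\<rho> n) = sets borel" for n by (rule P2_D(2)[OF \<rho>P])
  have F: "simple_function borel (F k)" for k
  proof -
    have "simple_function borel (\<lambda>z :: 'b \<times> 'c. f k (fst z))" "simple_function borel (\<lambda>z :: 'b \<times> 'c. g k (snd z))"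
      using simple_function_measurable_comp[OF f(1) borel_measurable_fst_borel]
        simple_function_measurable_comp[OF g(1) borel_measurable_snd_borel] by auto
    then show ?thesis unfolding F_def[abs_def] by (rule simple_function_Pair)
  qed
  have f\<rho>: "(\<lambda>z. f k (fst z) - fst z) \<in> L2_rv (\<rho> n)"
    "L2_norm (\<rho> n) (\<lambda>z. f k (fst z) - fst z) \<le> 1/2 * (1/2) ^ k" for k n
    using L2_rv_comp[OF \<rho>_fst _ f(2)[of k], of n] L2_norm_comp[OF \<rho>_fst, of n "\<lambda>x. f k x - x"] f(3)[of k]
    by simp_all
  have g\<rho>: "(\<lambda>z. g k (snd z) - snd z) \<in> L2_rv (\<rho> n)"
    "L2_norm (\<rho> n) (\<lambda>z. g k (snd z) - snd z) \<le> 1/2 * (1/2) ^ k" for k n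
    using L2_rv_comp[OF \<rho>_snd _ g(2)[of k], of n] L2_norm_comp[OF \<rho>_snd, of n "\<lambda>x. g k x - x"] g(3)[of k]
    by simp_all
  have F_eq: "F k z - z = (f k (fst z) - fst z, g k (snd z) - snd z)" for k z
    by (simp add: F_def prod_eq_iff)
  have F_L2: "(\<lambda>z. F k z - z) \<in> L2_rv (\<rho> n)" for n k
    unfolding F_eq using f\<rho>(1) g\<rho>(1) by (rule L2_rv_Pair)
  have F_le: "L2_norm (\<rho> n) (\<lambda>z. F k z - z) \<le> (1/2) ^ k" for n k
    unfolding F_eq using L2_norm_Pair_le[OF f\<rho>(1)[of k n] g\<rho>(1)[of k n]] f\<rho>(2)[of n k] g\<rho>(2)[of n k] by simp
  \<comment> \<open>A trivial label: no variable on \<open>M\<close> has to be respected, only laws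
    are reproduced.\<close>
  define C where "C = (\<lambda>_::'w. ())"
  define h where "h = (\<lambda>_::'b \<times> 'c. ())"
  have C: "simple_function M C" and h: "simple_function borel h" by (auto simp: C_def h_def)
  have Ch: "measure (\<rho> n) {z. h z = i} = measure M {\<omega>\<in>space M. C \<omega> = i}" for n i
    using prob_space.prob_space[OF P2_D(1)[OF \<rho>P]] M.prob_space by (simp add: C_def h_def P2_D(3)[OF \<rho>P])
  obtain r G Z where r: "strict_mono (r :: nat \<Rightarrow> nat)" and G: "\<And>k. simple_function M (G k)" and Z: "Z \<in> L2_rv M"
    "\<And>k. L2_norm M (\<lambda>\<omega>. G k \<omega> - Z \<omega>) \<le> 4 * (1/2) ^ k"
    and lim: "\<And>k (\<phi> :: unit \<Rightarrow> 'b \<times> 'c \<Rightarrow> real).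
       (\<lambda>n. \<integral>z. \<phi> (h z) (F k z) \<partial>\<rho> (r n)) \<longlonglongrightarrow> (\<integral>\<omega>. \<phi> (C \<omega>) (G k \<omega>) \<partial>M)"
    by (rule atomless_realization[of M \<rho> F C h,
        OF M P2_D(1)[OF \<rho>P] P2_D(2)[OF \<rho>P] F F_L2 F_le C h Ch]) (rule that)
  have lim: "(\<lambda>n. \<integral>z. \<phi> (F k z) \<partial>\<rho> (r n)) \<longlonglongrightarrow> (\<integral>\<omega>. \<phi> (G k \<omega>) \<partial>M)" for k and \<phi> :: "'b \<times> 'c \<Rightarrow> real"
    using lim[of "\<lambda>_. \<phi>" k] .
  have [measurable]: "Z \<in> borel_measurable M" using Z by (simp add: L2_rv_def)
  have GL2: "G k \<in> L2_rv M" for k using M(1) G by (rule simple_function_L2)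
  have GZ0: "(\<lambda>k. L2_norm M (\<lambda>\<omega>. G k \<omega> - Z \<omega>)) \<longlonglongrightarrow> 0"
    using Z(2) by (rule L2_norm_null_geometric)
  have fstZ: "law M (\<lambda>\<omega>. fst (Z \<omega>)) = law M A"
  proof (rule law_eq_of_L2_limits[OF M(1) M(1), where U = "\<lambda>k \<omega>. fst (G k \<omega>)" and U' = "\<lambda>k \<omega>. f k (A \<omega>)"])
    show "(\<lambda>\<omega>. f k (A \<omega>)) \<in> L2_rv M" for k
      using L2_rv_add[OF L2_rv_comp[OF refl mA f(2)[of k]] A] by simp
    show "(\<lambda>k. L2_norm M (\<lambda>\<omega>. fst (G k \<omega>) - fst (Z \<omega>))) \<longlonglongrightarrow> 0"
    proof (rule tendsto_sandwich[OF _ _ tendsto_const GZ0])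
      show "\<forall>\<^sub>F k in sequentially. L2_norm M (\<lambda>\<omega>. fst (G k \<omega>) - fst (Z \<omega>)) \<le> L2_norm M (\<lambda>\<omega>. G k \<omega> - Z \<omega>)"
        by (intro always_eventually allI L2_norm_mono L2_rv_diff L2_rv_fst GL2 Z)
           (metis fst_diff norm_fst_le prod.collapse)
    qed simp
    show "(\<lambda>k. L2_norm M (\<lambda>\<omega>. f k (A \<omega>) - A \<omega>)) \<longlonglongrightarrow> 0"
      using f(3) L2_norm_comp[OF refl mA, of "\<lambda>x. f k x - x" for k]
      by (intro L2_norm_null_geometric[where e = "1/2"]) simp
    show "(\<integral>\<omega>. g (fst (G k \<omega>)) \<partial>M) = (\<integral>\<omega>. g (f k (A \<omega>)) \<partial>M)" for k and g :: "'b \<Rightarrow> real"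
    proof -
      have "(\<integral>z. g (fst (F k z)) \<partial>\<rho> n) = (\<integral>\<omega>. g (f k (A \<omega>)) \<partial>M)" for n
      proof -
        have [measurable]: "(\<lambda>x. g (f k x)) \<in> borel_measurable borel"
          using borel_measurable_simple_function[OF simple_function_compose1[OF f(1)[of k], of g]] by simp
        show ?thesis unfolding \<rho>_def F_def by (subst integral_distr) auto
      qed
      with lim[of "\<lambda>z. g (fst z)" k] show ?thesis by (simp add: LIMSEQ_const_iff)
    qed
  qed (use A Z GL2 in \<open>auto intro: L2_rv_fst\<close>)
  have id\<nu>: "(\<lambda>x. x) \<in> L2_rv \<nu>" by (rule P2_D(4)[OF \<nu>P])
  have "law M (\<lambda>\<omega>. snd (Z \<omega>)) = distr \<nu> borel (\<lambda>x. x)"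
  proof (rule law_eq_of_L2_limits[OF M(1) P2_D(1)[OF \<nu>P], where U = "\<lambda>k \<omega>. snd (G k \<omega>)" and U' = g])
    show "g k \<in> L2_rv \<nu>" for k
      using L2_rv_add[OF g(2)[of k] id\<nu>] by simp
    show "(\<lambda>k. L2_norm M (\<lambda>\<omega>. snd (G k \<omega>) - snd (Z \<omega>))) \<longlonglongrightarrow> 0"
    proof (rule tendsto_sandwich[OF _ _ tendsto_const GZ0])
      show "\<forall>\<^sub>F k in sequentially. L2_norm M (\<lambda>\<omega>. snd (G k \<omega>) - snd (Z \<omega>)) \<le> L2_norm M (\<lambda>\<omega>. G k \<omega> - Z \<omega>)"
        by (intro always_eventually allI L2_norm_mono L2_rv_diff L2_rv_snd GL2 Z)
           (metis snd_diff norm_snd_le prod.collapse)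
    qed simp
    show "(\<lambda>k. L2_norm \<nu> (\<lambda>x. g k x - x)) \<longlonglongrightarrow> 0"
      using g(3) by (rule L2_norm_null_geometric)
    show "(\<integral>\<omega>. u (snd (G k \<omega>)) \<partial>M) = (\<integral>x. u (g k x) \<partial>\<nu>)" for k and u :: "'c \<Rightarrow> real"
    proof -
      have "(\<integral>z. u (snd (F k z)) \<partial>\<rho> n) = (\<integral>x. u (g k x) \<partial>\<nu>)" for n
      proof -
        have [measurable]: "(\<lambda>x. u (g k x)) \<in> borel_measurable borel"
          using borel_measurable_simple_function[OF simple_function_compose1[OF g(1)[of k], of u]] by simp
        show ?thesis unfolding F_def \<rho>_snd[of n, symmetric] by (subst integral_distr) auto
      qed
      with lim[of "\<lambda>z. u (snd z)" k] show ?thesis by (simp add: LIMSEQ_const_iff)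
    qed
  qed (use Z GL2 id\<nu> in \<open>auto intro: L2_rv_snd\<close>)
  also have "\<dots> = \<nu>" by (rule distr_id2) (simp add: P2_D[OF \<nu>P])
  finally have sndZ: "law M (\<lambda>\<omega>. snd (Z \<omega>)) = \<nu>" .
  show ?thesis
  proof
    fix J :: "'b \<times> 'c \<Rightarrow> 'd" assume J: "bounded_linear J"
    obtain K1 where K1: "0 \<le> K1" "\<And>(N :: 'w measure) X. X \<in> L2_rv N \<Longrightarrow> L2_norm N (\<lambda>\<omega>. J (X \<omega>)) \<le> K1 * L2_norm N X"
      by (rule L2_norm_bounded_linear[OF J]) (rule that)
    obtain K2 where K2: "0 \<le> K2" "\<And>(N :: ('b \<times> 'c) measure) X. X \<in> L2_rv N \<Longrightarrow> L2_norm N (\<lambda>\<omega>. J (X \<omega>)) \<le> K2 * L2_norm N X"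
      by (rule L2_norm_bounded_linear[OF J]) (rule that)
    have Jb [measurable]: "J \<in> borel_measurable borel"
      using J by (intro borel_measurable_continuous_onI linear_continuous_on)
    have lin: "J x - J y = J (x - y)" for x y
      using J by (simp add: linear_diff bounded_linear.linear)
    have id\<rho>: "(\<lambda>z. z) \<in> L2_rv (\<rho> n)" for n by (rule P2_D(4)[OF \<rho>P])
    have F\<rho>: "F k \<in> L2_rv (\<rho> n)" for k n using L2_rv_add[OF F_L2[of k n] id\<rho>] by simp
    \<comment> \<open>\<open>K2\<close> accounts for replacing the identity by \<open>F k\<close>
      under the laws, \<open>4 * K1\<close> for replacing \<open>Z\<close> by \<open>G k\<close> on
      \<open>M\<close>.\<close>
    let ?c = "K2 + 4 * K1"
    have "(\<lambda>n. L2_norm (\<rho> (r n)) J) \<longlonglongrightarrow> L2_norm M (\<lambda>\<omega>. J (Z \<omega>))"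
    proof (rule LIMSEQ_uniform_approx[where c = ?c])
      fix k n
      have "\<bar>L2_norm (\<rho> (r n)) J - L2_norm (\<rho> (r n)) (\<lambda>z. J (F k z))\<bar> \<le> L2_norm (\<rho> (r n)) (\<lambda>z. J z - J (F k z))"
        using L2_norm_reverse_triangle[OF L2_rv_bounded_linear[OF J id\<rho>] L2_rv_bounded_linear[OF J F\<rho>]] .
      also have "\<dots> = L2_norm (\<rho> (r n)) (\<lambda>z. J (F k z - z))"
        by (subst L2_norm_minus_commute) (simp add: lin)
      also have "\<dots> \<le> K2 * L2_norm (\<rho> (r n)) (\<lambda>z. F k z - z)" using F_L2 by (rule K2(2))
      also have "\<dots> \<le> K2 * (1/2) ^ k" using K2(1) F_le by (intro mult_left_mono)
      also have "\<dots> \<le> ?c * (1/2) ^ k" using K1(1) by (intro mult_right_mono) auto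
      finally show "\<bar>L2_norm (\<rho> (r n)) J - L2_norm (\<rho> (r n)) (\<lambda>z. J (F k z))\<bar> \<le> ?c * (1/2) ^ k" .
    next
      fix k
      have "\<bar>L2_norm M (\<lambda>\<omega>. J (G k \<omega>)) - L2_norm M (\<lambda>\<omega>. J (Z \<omega>))\<bar> \<le> L2_norm M (\<lambda>\<omega>. J (G k \<omega>) - J (Z \<omega>))"
        using L2_norm_reverse_triangle[OF L2_rv_bounded_linear[OF J GL2] L2_rv_bounded_linear[OF J Z(1)]] .
      also have "\<dots> \<le> K1 * L2_norm M (\<lambda>\<omega>. G k \<omega> - Z \<omega>)"
        unfolding lin using L2_rv_diff[OF GL2 Z(1)] by (rule K1(2))
      also have "\<dots> \<le> K1 * (4 * (1/2) ^ k)" using K1(1) Z(2) by (intro mult_left_mono)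
      also have "\<dots> \<le> ?c * (1/2) ^ k" using K2(1) by (simp add: algebra_simps)
      finally show "\<bar>L2_norm M (\<lambda>\<omega>. J (G k \<omega>)) - L2_norm M (\<lambda>\<omega>. J (Z \<omega>))\<bar> \<le> ?c * (1/2) ^ k" .
      show "(\<lambda>n. L2_norm (\<rho> (r n)) (\<lambda>z. J (F k z))) \<longlonglongrightarrow> L2_norm M (\<lambda>\<omega>. J (G k \<omega>))"
        unfolding L2_norm_def using lim[of "\<lambda>z. (norm (J z))\<^sup>2" k] by (rule tendsto_real_sqrt)
    qed
    moreover have "L2_norm (\<rho> n) J = L2_norm M (\<lambda>\<omega>. J (A \<omega>, Y n \<omega>))" for n
      unfolding \<rho>_def by (subst L2_norm_distr) auto
    ultimately show "(\<lambda>n. L2_norm M (\<lambda>\<omega>. J (A \<omega>, Y (r n) \<omega>))) \<longlonglongrightarrow> L2_norm M (\<lambda>\<omega>. J (fst (Z \<omega>), snd (Z \<omega>)))"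
      by simp
  qed (use r fstZ sndZ Z(1) in \<open>auto intro: L2_rv_fst L2_rv_snd\<close>)
qed

section \<open>Couplings and the squared Wasserstein distance\<close>

lemma couplingsD:
  assumes "\<pi> \<in> couplings \<mu> \<nu>"
  shows "prob_space \<pi>" "sets \<pi> = sets borel" "space \<pi> = UNIV" "distr \<pi> borel fst = \<mu>" "distr \<pi> borel snd = \<nu>"
  using assms sets_eq_imp_space_eq[of \<pi> borel] by (auto simp: couplings_def)

lemma couplings_fst_measurable [measurable (raw)]:
  assumes "\<pi> \<in> couplings \<mu> \<nu>"
  shows "fst \<in> borel_measurable \<pi>" "snd \<in> borel_measurable \<pi>"
proof -
  note [measurable_cong] = couplingsD(2)[OF assms]
  show "fst \<in> borel_measurable \<pi>" "snd \<in> borel_measurable \<pi>" by measurable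
qed

lemma couplings_L2:
  assumes "\<pi> \<in> couplings \<mu> \<nu>"
  shows "f \<in> L2_rv \<mu> \<Longrightarrow> (\<lambda>z. f (fst z)) \<in> L2_rv \<pi>" "f \<in> L2_rv \<nu> \<Longrightarrow> (\<lambda>z. f (snd z)) \<in> L2_rv \<pi>"
  by (rule L2_rv_comp[OF couplingsD(4)[OF assms] couplings_fst_measurable(1)[OF assms]], assumption)
     (rule L2_rv_comp[OF couplingsD(5)[OF assms] couplings_fst_measurable(2)[OF assms]], assumption)

lemma couplings_L2_norm:
  assumes "\<pi> \<in> couplings \<mu> \<nu>"
  shows "f \<in> borel_measurable borel \<Longrightarrow> L2_norm \<pi> (\<lambda>z. f (fst z)) = L2_norm \<mu> f"
    "f \<in> borel_measurable borel \<Longrightarrow> L2_norm \<pi> (\<lambda>z. f (snd z)) = L2_norm \<nu> f"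
  by (rule L2_norm_comp[OF couplingsD(4)[OF assms] couplings_fst_measurable(1)[OF assms]], assumption)
     (rule L2_norm_comp[OF couplingsD(5)[OF assms] couplings_fst_measurable(2)[OF assms]], assumption)

lemma couplings_P2:
  assumes "\<pi> \<in> couplings \<mu> \<nu>" "\<mu> \<in> P2" "\<nu> \<in> P2"
  shows "\<pi> \<in> P2"
proof -
  have "(\<lambda>z. (fst z, snd z)) \<in> L2_rv \<pi>"
    using assms by (intro L2_rv_Pair couplings_L2[OF assms(1)] P2_D)
  then show ?thesis using couplingsD[OF assms(1)] by (simp add: P2_def L2_rv_def)
qed

lemma transport_cost_eq: "transport_cost \<pi> = (L2_norm \<pi> (\<lambda>z. fst z - snd z))\<^sup>2"
  by (simp add: transport_cost_def L2_norm_sq norm_minus_commute)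

lemma law_Pair_coupling:
  assumes "prob_space M" and [measurable]: "X \<in> borel_measurable M" "Y \<in> borel_measurable M"
  shows "law M (\<lambda>\<omega>. (X \<omega>, Y \<omega>)) \<in> couplings (law M X) (law M Y)"
    and "transport_cost (law M (\<lambda>\<omega>. (X \<omega>, Y \<omega>))) = (L2_norm M (\<lambda>\<omega>. X \<omega> - Y \<omega>))\<^sup>2"
proof -
  interpret prob_space M by fact
  show "law M (\<lambda>\<omega>. (X \<omega>, Y \<omega>)) \<in> couplings (law M X) (law M Y)"
    unfolding couplings_def by (auto simp: distr_distr comp_def intro: prob_space_distr)
  show "transport_cost (law M (\<lambda>\<omega>. (X \<omega>, Y \<omega>))) = (L2_norm M (\<lambda>\<omega>. X \<omega> - Y \<omega>))\<^sup>2"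
    unfolding transport_cost_eq by (subst L2_norm_distr) auto
qed

lemma W2sq_le:
  assumes "\<pi> \<in> couplings \<mu> \<nu>"
  shows "W2sq \<mu> \<nu> \<le> transport_cost \<pi>"
  unfolding W2sq_def using assms
  by (intro cINF_lower) (auto intro!: bdd_belowI[of _ 0] simp: transport_cost_eq)

lemma W2sq_le_L2:
  assumes "prob_space M" "X \<in> borel_measurable M" "Y \<in> borel_measurable M"
  shows "W2sq (law M X) (law M Y) \<le> (L2_norm M (\<lambda>\<omega>. X \<omega> - Y \<omega>))\<^sup>2"
  using W2sq_le[OF law_Pair_coupling(1)[OF assms]] law_Pair_coupling(2)[OF assms] by simp

section \<open>Realising couplings and existence of optimal ones\<close>

lemma atomless_rv_exists:
  assumes "prob_space M" "atomless M" "\<rho> \<in> P2"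
  obtains Z where "Z \<in> L2_rv M" "law M Z = \<rho>"
proof -
  interpret prob_space M by fact
  interpret R: prob_space \<rho> using P2_D(1)[OF assms(3)] .
  \<comment> \<open>A constant variable under a constant projection imposes nothing, so that only
    the law of \<open>Z\<close> is prescribed.\<close>
  have "(\<lambda>_. 0::real) \<in> L2_rv M" by (simp add: L2_rv_def)
  moreover have "distr \<rho> borel (\<lambda>_. 0::real) = law M (\<lambda>_. 0)"
    by (rule measure_eqI) (simp_all add: emeasure_distr emeasure_space_1 R.emeasure_space_1 split: split_indicator)
  ultimately show ?thesis
    using atomless_realize_over[OF assms(1,2) _ assms(3), of "\<lambda>_. 0::real" "\<lambda>_. 0::real" 1] that by auto
qed

lemma couplings_nonempty:
  assumes "prob_space M" "atomless M" "\<mu> \<in> P2" "\<nu> \<in> P2"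
  shows "couplings \<mu> \<nu> \<noteq> {}"
proof -
  obtain X Y where "X \<in> L2_rv M" "law M X = \<mu>" "Y \<in> L2_rv M" "law M Y = \<nu>"
    using atomless_rv_exists[OF assms(1,2,3)] atomless_rv_exists[OF assms(1,2,4)] by metis
  then show ?thesis using law_Pair_coupling(1)[OF assms(1), of X Y] by (auto simp: L2_rv_def)
qed

lemma W2sq_nonneg:
  assumes "prob_space M" "atomless M" "\<mu> \<in> P2" "\<nu> \<in> P2"
  shows "0 \<le> W2sq \<mu> \<nu>"
  unfolding W2sq_def using couplings_nonempty[OF assms] by (intro cINF_greatest) (auto simp: transport_cost_eq)

text \<open>\<open>\<pi>\<close> is realised as the law of some \<open>Z\<close> with
  \<open>fst Z\<close> close to \<open>X\<close>. Pairing \<open>snd Z\<close> with \<open>X\<close>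
  keeps the second marginal exact and changes the cost by the displacement of the first component
  only.\<close>

lemma coupling_realize:
  assumes M: "prob_space M" "atomless M" and X: "X \<in> L2_rv M" and \<nu>: "\<nu> \<in> P2"
    and \<pi>: "\<pi> \<in> couplings (law M X) \<nu>" and "0 < e"
  obtains Y where "Y \<in> L2_rv M" "law M Y = \<nu>"
    "L2_norm M (\<lambda>\<omega>. X \<omega> - Y \<omega>) \<le> L2_norm \<pi> (\<lambda>z. fst z - snd z) + e"
proof -
  have XP: "law M X \<in> P2" using M(1) X by (rule law_in_P2)
  obtain Z where Z: "Z \<in> L2_rv M" "law M Z = \<pi>" "L2_norm M (\<lambda>\<omega>. X \<omega> - fst (Z \<omega>)) \<le> e"
    by (rule atomless_realize_over[OF M X couplings_P2[OF \<pi> XP \<nu>] borel_measurable_fst_borel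
          couplingsD(4)[OF \<pi>] \<open>0 < e\<close>]) (rule that)
  have [measurable]: "Z \<in> borel_measurable M" using Z by (simp add: L2_rv_def)
  show ?thesis
  proof
    show "(\<lambda>\<omega>. snd (Z \<omega>)) \<in> L2_rv M" using Z(1) by (rule L2_rv_snd)
    show "law M (\<lambda>\<omega>. snd (Z \<omega>)) = \<nu>"
      unfolding couplingsD(5)[OF \<pi>, symmetric] Z(2)[symmetric] by (subst distr_distr) (auto simp: comp_def)
    have "L2_norm \<pi> (\<lambda>z. fst z - snd z) = L2_norm M (\<lambda>\<omega>. fst (Z \<omega>) - snd (Z \<omega>))"
      unfolding Z(2)[symmetric] by (subst L2_norm_distr) auto
    then show "L2_norm M (\<lambda>\<omega>. X \<omega> - snd (Z \<omega>)) \<le> L2_norm \<pi> (\<lambda>z. fst z - snd z) + e"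
      using L2_triangle_diff[OF X L2_rv_fst[OF Z(1)] L2_rv_snd[OF Z(1)]] Z(3) by linarith
  qed
qed

lemma W2sq_near:
  assumes M: "prob_space M" "atomless M" and X: "X \<in> L2_rv M" and \<nu>: "\<nu> \<in> P2" and "0 < e"
  obtains Y where "Y \<in> L2_rv M" "law M Y = \<nu>"
    "(L2_norm M (\<lambda>\<omega>. X \<omega> - Y \<omega>))\<^sup>2 \<le> W2sq (law M X) \<nu> + e"
proof -
  have XP: "law M X \<in> P2" using M(1) X by (rule law_in_P2)
  have "\<exists>\<pi>\<in>couplings (law M X) \<nu>. transport_cost \<pi> < W2sq (law M X) \<nu> + e / 2"
    using couplings_nonempty[OF M XP \<nu>] \<open>0 < e\<close> unfolding W2sq_def
    by (subst cINF_less_iff[symmetric]) (auto intro!: bdd_belowI[of _ 0] simp: transport_cost_eq)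
  then obtain \<pi> where \<pi>: "\<pi> \<in> couplings (law M X) \<nu>" "transport_cost \<pi> < W2sq (law M X) \<nu> + e / 2" by blast
  define s where "s = L2_norm \<pi> (\<lambda>z. fst z - snd z)"
  have "0 \<le> s" by (simp add: s_def)
  \<comment> \<open>With \<open>d \<le> 1\<close> the square \<open>(s + d)\<^sup>2\<close> exceeds
    \<open>s\<^sup>2\<close> by at most \<open>d * (2 * s + 1)\<close>, that is by
    \<open>e / 2\<close>; the other half of \<open>e\<close> is spent in choosing
    \<open>\<pi>\<close>.\<close>
  define d where "d = min 1 (e / (2 * (2 * s + 1)))"
  have d: "0 < d" "d \<le> 1" "d * (2 * s + 1) \<le> e / 2"
  proof -
    show "0 < d" "d \<le> 1" using \<open>0 < e\<close> \<open>0 \<le> s\<close> by (auto simp: d_def)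
    have "d * (2 * s + 1) \<le> e / (2 * (2 * s + 1)) * (2 * s + 1)"
      using \<open>0 \<le> s\<close> by (intro mult_right_mono) (auto simp: d_def)
    also have "\<dots> = e / 2" using \<open>0 \<le> s\<close> by (simp add: field_simps)
    finally show "d * (2 * s + 1) \<le> e / 2" .
  qed
  obtain Y where Y: "Y \<in> L2_rv M" "law M Y = \<nu>" "L2_norm M (\<lambda>\<omega>. X \<omega> - Y \<omega>) \<le> s + d"
    using coupling_realize[OF M X \<nu> \<pi>(1) d(1)] unfolding s_def[symmetric] by blast
  have "(L2_norm M (\<lambda>\<omega>. X \<omega> - Y \<omega>))\<^sup>2 \<le> (s + d)\<^sup>2" using Y(3) by (rule power_mono) simp
  also have "\<dots> = s\<^sup>2 + d * (2 * s + d)" by (simp add: power2_eq_square algebra_simps)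
  also have "\<dots> \<le> s\<^sup>2 + d * (2 * s + 1)" using d(1,2) by (intro add_left_mono mult_left_mono) auto
  also have "\<dots> \<le> W2sq (law M X) \<nu> + e" using d(3) \<pi>(2) by (simp add: s_def transport_cost_eq)
  finally show ?thesis using Y(1,2) by (intro that)
qed

lemma near_optimal_sequence:
  assumes M: "prob_space M" "atomless M" and X: "X \<in> L2_rv M" and \<nu>: "\<nu> \<in> P2"
    and Y: "\<And>n. Y n \<in> L2_rv M" "\<And>n. law M (Y n) = \<nu>"
      "\<And>n. (L2_norm M (\<lambda>\<omega>. X \<omega> - Y n \<omega>))\<^sup>2 \<le> W2sq (law M X) \<nu> + 1 / real (Suc n)"
  shows "(\<lambda>n. L2_norm M (\<lambda>\<omega>. X \<omega> - Y n \<omega>)) \<longlonglongrightarrow> sqrt (W2sq (law M X) \<nu>)"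
proof -
  have m: "X \<in> borel_measurable M" "Y n \<in> borel_measurable M" for n using X Y by (auto simp: L2_rv_def)
  have "(\<lambda>n. (L2_norm M (\<lambda>\<omega>. X \<omega> - Y n \<omega>))\<^sup>2) \<longlonglongrightarrow> W2sq (law M X) \<nu>"
  proof (rule tendsto_sandwich)
    show "\<forall>\<^sub>F n in sequentially. W2sq (law M X) \<nu> \<le> (L2_norm M (\<lambda>\<omega>. X \<omega> - Y n \<omega>))\<^sup>2"
      using W2sq_le_L2[OF M(1) m] Y(2) by simp
    show "\<forall>\<^sub>F n in sequentially. (L2_norm M (\<lambda>\<omega>. X \<omega> - Y n \<omega>))\<^sup>2 \<le> W2sq (law M X) \<nu> + 1 / real (Suc n)"
      using Y(3) by simp
    show "(\<lambda>n. W2sq (law M X) \<nu> + 1 / real (Suc n)) \<longlonglongrightarrow> W2sq (law M X) \<nu>"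
      using tendsto_add[OF tendsto_const LIMSEQ_inverse_real_of_nat, of "W2sq (law M X) \<nu>"]
      by (simp add: inverse_eq_divide)
  qed simp
  from tendsto_real_sqrt[OF this] show ?thesis by simp
qed

text \<open>The direct method: along a minimising sequence the cost is the squared norm of a linear
  image of the pair, so it converges along the extracted subsequence and the limit pair attains the
  infimum.\<close>

lemma optimal_coupling_exists:
  fixes \<mu> \<nu> :: "'a::euclidean_space measure"
  assumes M: "prob_space M" "atomless M" and \<mu>: "\<mu> \<in> P2" and \<nu>: "\<nu> \<in> P2"
  shows "optimal_couplings \<mu> \<nu> \<noteq> {}"
proof -
  obtain X where X: "X \<in> L2_rv M" "law M X = \<mu>" using atomless_rv_exists[OF M \<mu>] .
  have "\<exists>Y. Y \<in> L2_rv M \<and> law M Y = \<nu> \<and>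
      (L2_norm M (\<lambda>\<omega>. X \<omega> - Y \<omega>))\<^sup>2 \<le> W2sq (law M X) \<nu> + 1 / real (Suc n)" for n
    using W2sq_near[OF M X(1) \<nu>, of "1 / real (Suc n)"] by (metis of_nat_0_less_iff zero_less_Suc zero_less_divide_1_iff)
  then obtain Y where Y: "\<And>n. Y n \<in> L2_rv M" "\<And>n. law M (Y n) = \<nu>"
      "\<And>n. (L2_norm M (\<lambda>\<omega>. X \<omega> - Y n \<omega>))\<^sup>2 \<le> W2sq (law M X) \<nu> + 1 / real (Suc n)"
    by metis
  obtain r X' Y' where r: "strict_mono (r :: nat \<Rightarrow> nat)" and XY: "X' \<in> L2_rv M" "Y' \<in> L2_rv M"
    "law M X' = law M X" "law M Y' = \<nu>"
    and lim: "\<And>J :: 'a \<times> 'a \<Rightarrow> 'a. bounded_linear J \<Longrightarrow>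
       (\<lambda>n. L2_norm M (\<lambda>\<omega>. J (X \<omega>, Y (r n) \<omega>))) \<longlonglongrightarrow> L2_norm M (\<lambda>\<omega>. J (X' \<omega>, Y' \<omega>))"
    by (rule atomless_L2_compact[of M X Y \<nu>, OF M X(1) Y(1) Y(2)]) (rule that)
  have "bounded_linear (\<lambda>z :: 'a \<times> 'a. fst z - snd z)"
    by (intro bounded_linear_sub bounded_linear_fst bounded_linear_snd)
  from lim[OF this] have "(\<lambda>n. L2_norm M (\<lambda>\<omega>. X \<omega> - Y (r n) \<omega>)) \<longlonglongrightarrow> L2_norm M (\<lambda>\<omega>. X' \<omega> - Y' \<omega>)" by simp
  moreover have "(\<lambda>n. L2_norm M (\<lambda>\<omega>. X \<omega> - Y (r n) \<omega>)) \<longlonglongrightarrow> sqrt (W2sq (law M X) \<nu>)"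
    using LIMSEQ_subseq_LIMSEQ[OF near_optimal_sequence[OF M X(1) \<nu> Y] r] by (simp add: comp_def)
  ultimately have "L2_norm M (\<lambda>\<omega>. X' \<omega> - Y' \<omega>) = sqrt (W2sq (law M X) \<nu>)" by (rule LIMSEQ_unique)
  then have "(L2_norm M (\<lambda>\<omega>. X' \<omega> - Y' \<omega>))\<^sup>2 = W2sq \<mu> \<nu>"
    using W2sq_nonneg[OF M \<mu> \<nu>] X(2) by simp
  then have "law M (\<lambda>\<omega>. (X' \<omega>, Y' \<omega>)) \<in> optimal_couplings \<mu> \<nu>"
    using law_Pair_coupling[OF M(1), of X' Y'] XY X(2) by (auto simp: optimal_couplings_def L2_rv_def)
  then show ?thesis by blast
qed

section \<open>Uniqueness of the optimal map implies differentiability\<close>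

lemma optimal_map_marginal:
  assumes T: "T \<in> borel_measurable borel" and \<mu>: "\<mu> \<in> P2"
    and opt: "distr \<mu> borel (\<lambda>x. (x, T x)) \<in> optimal_couplings \<mu> \<nu>"
  shows "distr \<mu> borel T = \<nu>"
proof -
  note [measurable] = T and [measurable_cong] = P2_D(2)[OF \<mu>]
  have "distr \<mu> borel T = distr (distr \<mu> borel (\<lambda>x. (x, T x))) borel snd"
    by (subst distr_distr) (auto simp: comp_def)
  also have "\<dots> = \<nu>" using opt by (simp add: optimal_couplings_def couplings_def)
  finally show ?thesis .
qed

text \<open>By contradiction and compactness. \<open>T\<close> is merely measurable, so
  \<open>T (X)\<close> cannot be recovered from a limit of \<open>X\<close> by continuity; it is
  carried along by taking \<open>(X, T (X))\<close> as the first component of the pair.\<close>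

lemma near_optimal_close_to_map:
  fixes X :: "'w \<Rightarrow> 'a::euclidean_space"
  assumes M: "prob_space M" "atomless M" and \<mu>: "\<mu> \<in> P2" and \<nu>: "\<nu> \<in> P2"
    and T: "T \<in> borel_measurable borel" and opt: "optimal_couplings \<mu> \<nu> = {distr \<mu> borel (\<lambda>x. (x, T x))}"
    and X: "X \<in> L2_rv M" "law M X = \<mu>" and "0 < e"
  obtains \<eta> where "0 < \<eta>" "\<And>Y. Y \<in> L2_rv M \<Longrightarrow> law M Y = \<nu> \<Longrightarrow>
    (L2_norm M (\<lambda>\<omega>. X \<omega> - Y \<omega>))\<^sup>2 \<le> W2sq \<mu> \<nu> + \<eta> \<Longrightarrow> L2_norm M (\<lambda>\<omega>. T (X \<omega>) - Y \<omega>) \<le> e"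
proof (rule ccontr)
  assume "\<not> thesis"
  then have "\<exists>Y. Y \<in> L2_rv M \<and> law M Y = \<nu> \<and>
      (L2_norm M (\<lambda>\<omega>. X \<omega> - Y \<omega>))\<^sup>2 \<le> W2sq (law M X) \<nu> + 1 / real (Suc n) \<and>
      e < L2_norm M (\<lambda>\<omega>. T (X \<omega>) - Y \<omega>)" for n
    using that[of "1 / real (Suc n)"] X(2) by (force simp: not_le)
  then obtain Y where Y: "\<And>n. Y n \<in> L2_rv M" "\<And>n. law M (Y n) = \<nu>"
      "\<And>n. (L2_norm M (\<lambda>\<omega>. X \<omega> - Y n \<omega>))\<^sup>2 \<le> W2sq (law M X) \<nu> + 1 / real (Suc n)"
      "\<And>n. e < L2_norm M (\<lambda>\<omega>. T (X \<omega>) - Y n \<omega>)"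
    by metis
  note [measurable] = T
  have [measurable]: "X \<in> borel_measurable M" using X by (simp add: L2_rv_def)
  have T\<nu>: "distr \<mu> borel T = \<nu>" using optimal_map_marginal[OF T \<mu>] opt by simp
  have "law M (\<lambda>\<omega>. T (X \<omega>)) = \<nu>"
    unfolding T\<nu>[symmetric] X(2)[symmetric] by (subst distr_distr) (auto simp: comp_def)
  then have TX: "(\<lambda>\<omega>. T (X \<omega>)) \<in> L2_rv M" using \<nu> by (intro L2_rv_law_P2) auto
  obtain r A Y' where r: "strict_mono (r :: nat \<Rightarrow> nat)" and A: "A \<in> L2_rv M" and Y': "Y' \<in> L2_rv M"
    and lawA: "law M A = law M (\<lambda>\<omega>. (X \<omega>, T (X \<omega>)))" and lawY': "law M Y' = \<nu>"
    and lim: "\<And>J :: ('a \<times> 'a) \<times> 'a \<Rightarrow> 'a. bounded_linear J \<Longrightarrow>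
       (\<lambda>n. L2_norm M (\<lambda>\<omega>. J ((X \<omega>, T (X \<omega>)), Y (r n) \<omega>))) \<longlonglongrightarrow> L2_norm M (\<lambda>\<omega>. J (A \<omega>, Y' \<omega>))"
    by (rule atomless_L2_compact[of M "\<lambda>\<omega>. (X \<omega>, T (X \<omega>))" Y \<nu>, OF M L2_rv_Pair[OF X(1) TX] Y(1) Y(2)]) (rule that)
  have [measurable]: "A \<in> borel_measurable M" "Y' \<in> borel_measurable M" using A Y' by (auto simp: L2_rv_def)
  let ?X = "\<lambda>\<omega>. fst (A \<omega>)"
  have lawX: "law M ?X = \<mu>"
  proof -
    have "law M ?X = distr (law M A) borel fst" by (subst distr_distr) (auto simp: comp_def)
    also have "\<dots> = law M X" unfolding lawA by (subst distr_distr) (auto simp: comp_def)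
    finally show ?thesis using X(2) by simp
  qed
  have "bounded_linear (\<lambda>z :: ('a \<times> 'a) \<times> 'a. fst (fst z) - snd z)"
    by (intro bounded_linear_sub bounded_linear_snd bounded_linear_compose[OF bounded_linear_fst bounded_linear_fst])
  from lim[OF this] have "(\<lambda>n. L2_norm M (\<lambda>\<omega>. X \<omega> - Y (r n) \<omega>)) \<longlonglongrightarrow> L2_norm M (\<lambda>\<omega>. ?X \<omega> - Y' \<omega>)" by simp
  moreover have "(\<lambda>n. L2_norm M (\<lambda>\<omega>. X \<omega> - Y (r n) \<omega>)) \<longlonglongrightarrow> sqrt (W2sq (law M X) \<nu>)"
    using LIMSEQ_subseq_LIMSEQ[OF near_optimal_sequence[OF M X(1) \<nu> Y(1,2,3)] r] by (simp add: comp_def)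
  ultimately have "L2_norm M (\<lambda>\<omega>. ?X \<omega> - Y' \<omega>) = sqrt (W2sq (law M X) \<nu>)" by (rule LIMSEQ_unique)
  then have "(L2_norm M (\<lambda>\<omega>. ?X \<omega> - Y' \<omega>))\<^sup>2 = W2sq \<mu> \<nu>"
    using W2sq_nonneg[OF M \<mu> \<nu>] X(2) by simp
  then have "law M (\<lambda>\<omega>. (?X \<omega>, Y' \<omega>)) \<in> optimal_couplings \<mu> \<nu>"
    using law_Pair_coupling[OF M(1), of ?X Y'] lawX lawY' by (auto simp: optimal_couplings_def)
  then have "law M (\<lambda>\<omega>. (?X \<omega>, Y' \<omega>)) = distr \<mu> borel (\<lambda>x. (x, T x))" unfolding opt by simp
  also have "\<dots> = law M (\<lambda>\<omega>. (X \<omega>, T (X \<omega>)))"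
    unfolding X(2)[symmetric] by (subst distr_distr) (auto simp: comp_def)
  finally have eq: "law M (\<lambda>\<omega>. (?X \<omega>, Y' \<omega>)) = law M (\<lambda>\<omega>. (X \<omega>, T (X \<omega>)))" .
  have zero: "L2_norm (law M (\<lambda>\<omega>. (X \<omega>, T (X \<omega>)))) (\<lambda>z. T (fst z) - snd z) = 0"
    by (subst L2_norm_distr) (auto simp: L2_norm_def)
  have 1: "L2_norm M (\<lambda>\<omega>. T (?X \<omega>) - Y' \<omega>) = 0"
    using zero unfolding eq[symmetric] by (subst (asm) L2_norm_distr) auto
  have 2: "L2_norm M (\<lambda>\<omega>. T (?X \<omega>) - snd (A \<omega>)) = 0"
    using zero unfolding lawA[symmetric] by (subst (asm) L2_norm_distr) auto
  have "law M (\<lambda>\<omega>. T (?X \<omega>)) = \<nu>"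
    unfolding T\<nu>[symmetric] lawX[symmetric] by (subst distr_distr) (auto simp: comp_def)
  then have TX': "(\<lambda>\<omega>. T (?X \<omega>)) \<in> L2_rv M" using \<nu> by (intro L2_rv_law_P2) auto
  \<comment> \<open>Both variables equal \<open>T (fst A)\<close> almost surely:
    \<open>snd A\<close> because \<open>A\<close> has the law of \<open>(X, T (X))\<close>, and
    \<open>Y'\<close> because the limit coupling is optimal and the optimal coupling is
    unique.\<close>
  have "L2_norm M (\<lambda>\<omega>. snd (A \<omega>) - Y' \<omega>) = 0"
    using L2_triangle_diff[OF L2_rv_snd[OF A] TX' Y'] 1 2
    by (simp add: L2_norm_minus_commute[of M "\<lambda>\<omega>. snd (A \<omega>)" "\<lambda>\<omega>. T (?X \<omega>)"] order_antisym)
  moreover have "bounded_linear (\<lambda>z :: ('a \<times> 'a) \<times> 'a. snd (fst z) - snd z)"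
    by (intro bounded_linear_sub bounded_linear_snd bounded_linear_compose[OF bounded_linear_snd bounded_linear_fst])
  from lim[OF this] have "(\<lambda>n. L2_norm M (\<lambda>\<omega>. T (X \<omega>) - Y (r n) \<omega>)) \<longlonglongrightarrow> L2_norm M (\<lambda>\<omega>. snd (A \<omega>) - Y' \<omega>)" by simp
  moreover have "e \<le> L2_norm M (\<lambda>\<omega>. T (X \<omega>) - Y (r n) \<omega>)" for n using Y(4)[of "r n"] by simp
  ultimately have "e \<le> 0" by (auto intro: LIMSEQ_le_const)
  with \<open>0 < e\<close> show False by simp
qed

text \<open>The upper bound tests \<open>X + H\<close> against \<open>T (X)\<close>. The lower bound
  takes \<open>Y\<close> near-optimal for \<open>X + H\<close> and tests \<open>X\<close> against
  it; such a \<open>Y\<close> is near-optimal for \<open>X\<close> as well, hence close to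
  \<open>T (X)\<close>, and replacing it by \<open>T (X)\<close> in the linear term costs at most
  \<open>\<epsilon>\<close> times the norm of \<open>H\<close>.\<close>

lemma optimal_map_frechet_derivative:
  fixes X :: "'w \<Rightarrow> 'a::euclidean_space"
  assumes M: "prob_space M" "atomless M" and \<mu>: "\<mu> \<in> P2" and \<nu>: "\<nu> \<in> P2"
    and T: "T \<in> borel_measurable borel" and opt: "optimal_couplings \<mu> \<nu> = {distr \<mu> borel (\<lambda>x. (x, T x))}"
    and X: "X \<in> L2_rv M" "law M X = \<mu>"
  shows "has_frechet_derivative M (\<lambda>Z. W2sq (law M Z) \<nu>) X (\<lambda>\<omega>. 2 *\<^sub>R (X \<omega> - T (X \<omega>)))"
proof -
  note [measurable] = T
  have [measurable]: "X \<in> borel_measurable M" using X by (simp add: L2_rv_def)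
  have T\<nu>: "distr \<mu> borel T = \<nu>" using optimal_map_marginal[OF T \<mu>] opt by simp
  have lawTX: "law M (\<lambda>\<omega>. T (X \<omega>)) = \<nu>"
    unfolding T\<nu>[symmetric] X(2)[symmetric] by (subst distr_distr) (auto simp: comp_def)
  then have TX: "(\<lambda>\<omega>. T (X \<omega>)) \<in> L2_rv M" using \<nu> by (intro L2_rv_law_P2) auto
  define V where "V \<omega> = X \<omega> - T (X \<omega>)" for \<omega>
  have V: "V \<in> L2_rv M" unfolding V_def using X(1) TX by (rule L2_rv_diff)
  have G: "(\<lambda>\<omega>. 2 *\<^sub>R V \<omega>) \<in> L2_rv M" using V by (rule L2_rv_scaleR)
  define s where "s = L2_norm M V"
  have "0 \<le> s" by (simp add: s_def)
  have W: "W2sq \<mu> \<nu> = s\<^sup>2"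
  proof -
    have "distr \<mu> borel (\<lambda>x. (x, T x)) = law M (\<lambda>\<omega>. (X \<omega>, T (X \<omega>)))"
      unfolding X(2)[symmetric] by (subst distr_distr) (auto simp: comp_def)
    then have "law M (\<lambda>\<omega>. (X \<omega>, T (X \<omega>))) \<in> optimal_couplings \<mu> \<nu>" using opt by simp
    then have "W2sq \<mu> \<nu> = transport_cost (law M (\<lambda>\<omega>. (X \<omega>, T (X \<omega>))))"
      by (simp add: optimal_couplings_def)
    then show ?thesis using law_Pair_coupling(2)[OF M(1), of X "\<lambda>\<omega>. T (X \<omega>)"] by (simp add: s_def V_def[abs_def])
  qed
  have "\<exists>\<delta>>0. \<forall>H\<in>L2_rv M. L2_norm M H < \<delta> \<longrightarrow>
      \<bar>W2sq (law M (\<lambda>\<omega>. X \<omega> + H \<omega>)) \<nu> - W2sq (law M X) \<nu> - (\<integral>\<omega>. (2 *\<^sub>R V \<omega>) \<bullet> H \<omega> \<partial>M)\<bar> \<le> \<epsilon> * L2_norm M H"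
    if "0 < \<epsilon>" for \<epsilon>
  proof -
    obtain \<eta> where \<eta>: "0 < \<eta>" "\<And>Y. Y \<in> L2_rv M \<Longrightarrow> law M Y = \<nu> \<Longrightarrow>
      (L2_norm M (\<lambda>\<omega>. X \<omega> - Y \<omega>))\<^sup>2 \<le> W2sq \<mu> \<nu> + \<eta> \<Longrightarrow> L2_norm M (\<lambda>\<omega>. T (X \<omega>) - Y \<omega>) \<le> \<epsilon> / 2"
      by (rule near_optimal_close_to_map[OF M \<mu> \<nu> T opt X, of "\<epsilon> / 2"]) (use \<open>0 < \<epsilon>\<close> in simp, rule that)
    \<comment> \<open>The first entry gives \<open>h\<^sup>2 \<le> \<epsilon> * h\<close>. The
      others make \<open>(s + 3 * h)\<^sup>2 \<le> s\<^sup>2 + h * (6 * s + 9)\<close> at most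
      \<open>s\<^sup>2 + \<eta>\<close>, where \<open>s + 3 * h\<close> bounds the distance from
      \<open>X\<close> to the near-optimal \<open>Y\<close>.\<close>
    define \<delta> where "\<delta> = min \<epsilon> (min 1 (\<eta> / (6 * s + 9)))"
    have "0 < \<delta>" using \<open>0 < \<epsilon>\<close> \<eta>(1) \<open>0 \<le> s\<close> by (simp add: \<delta>_def)
    moreover have "\<bar>W2sq (law M (\<lambda>\<omega>. X \<omega> + H \<omega>)) \<nu> - W2sq (law M X) \<nu> - (\<integral>\<omega>. (2 *\<^sub>R V \<omega>) \<bullet> H \<omega> \<partial>M)\<bar> \<le> \<epsilon> * L2_norm M H"
      if H: "H \<in> L2_rv M" and Hd: "L2_norm M H < \<delta>" for H
    proof -
      define h where "h = L2_norm M H"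
      have h: "0 \<le> h" "h \<le> \<epsilon>" "h \<le> 1" "h * (6 * s + 9) \<le> \<eta>"
        using Hd \<open>0 \<le> s\<close> by (auto simp: h_def \<delta>_def pos_less_divide_eq less_imp_le)
      have [measurable]: "H \<in> borel_measurable M" using H by (simp add: L2_rv_def)
      let ?XH = "\<lambda>\<omega>. X \<omega> + H \<omega>"
      have XH: "?XH \<in> L2_rv M" using X(1) H by (rule L2_rv_add)
      have dd: "(\<integral>\<omega>. (2 *\<^sub>R V \<omega>) \<bullet> H \<omega> \<partial>M) = 2 * (\<integral>\<omega>. V \<omega> \<bullet> H \<omega> \<partial>M)" by simp
      have upper: "W2sq (law M ?XH) \<nu> \<le> s\<^sup>2 + 2 * (\<integral>\<omega>. V \<omega> \<bullet> H \<omega> \<partial>M) + h\<^sup>2"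
      proof -
        have "W2sq (law M ?XH) \<nu> \<le> (L2_norm M (\<lambda>\<omega>. ?XH \<omega> - T (X \<omega>)))\<^sup>2"
          using W2sq_le_L2[OF M(1), of ?XH "\<lambda>\<omega>. T (X \<omega>)"] lawTX by simp
        also have "(\<lambda>\<omega>. ?XH \<omega> - T (X \<omega>)) = (\<lambda>\<omega>. V \<omega> + H \<omega>)" by (auto simp: V_def)
        finally show ?thesis by (simp add: L2_norm_add_sq[OF V H] s_def h_def)
      qed
      show ?thesis
      \<comment> \<open>\<open>W2sq_near\<close> needs a positive slack, here
        \<open>h\<^sup>2\<close>; if \<open>h = 0\<close> the laws of \<open>X + H\<close> and
        \<open>X\<close> coincide.\<close>
      proof (cases "h = 0")
        case True
        then have "AE \<omega> in M. H \<omega> = 0" using L2_norm_eq_0_iff[OF H] by (simp add: h_def)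
        then have "law M ?XH = law M X" by (intro distr_cong_AE) auto
        moreover have "(\<integral>\<omega>. (2 *\<^sub>R V \<omega>) \<bullet> H \<omega> \<partial>M) = 0"
          using L2_cauchy_schwarz[OF G H] True by (simp add: h_def)
        ultimately show ?thesis using \<open>0 < \<epsilon>\<close> by simp
      next
        case False
        then have "0 < h\<^sup>2" by simp
        \<comment> \<open>The slack \<open>h\<^sup>2\<close> is tuned to cancel against the
          quadratic term in the expansion of the distance from \<open>X + H\<close> to
          \<open>Y\<close>.\<close>
        obtain Y where Y: "Y \<in> L2_rv M" "law M Y = \<nu>"
            "(L2_norm M (\<lambda>\<omega>. ?XH \<omega> - Y \<omega>))\<^sup>2 \<le> W2sq (law M ?XH) \<nu> + h\<^sup>2"
          by (rule W2sq_near[OF M XH \<nu> \<open>0 < h\<^sup>2\<close>]) (rule that)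
        have VH: "\<bar>\<integral>\<omega>. V \<omega> \<bullet> H \<omega> \<partial>M\<bar> \<le> s * h" using L2_cauchy_schwarz[OF V H] by (simp add: s_def h_def)
        have "(L2_norm M (\<lambda>\<omega>. ?XH \<omega> - Y \<omega>))\<^sup>2 \<le> s\<^sup>2 + 2 * (s * h) + 2 * h\<^sup>2"
          using Y(3) upper VH by linarith
        also have "\<dots> \<le> (s + 2 * h)\<^sup>2" using \<open>0 \<le> s\<close> h(1) by (simp add: power2_eq_square algebra_simps)
        finally have "L2_norm M (\<lambda>\<omega>. ?XH \<omega> - Y \<omega>) \<le> s + 2 * h"
          by (rule power2_le_imp_le) (use \<open>0 \<le> s\<close> h(1) in simp)
        moreover have "L2_norm M (\<lambda>\<omega>. X \<omega> - Y \<omega>) \<le> L2_norm M (\<lambda>\<omega>. X \<omega> - ?XH \<omega>) + L2_norm M (\<lambda>\<omega>. ?XH \<omega> - Y \<omega>)"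
          using X(1) XH Y(1) by (rule L2_triangle_diff)
        moreover have "L2_norm M (\<lambda>\<omega>. X \<omega> - ?XH \<omega>) = h"
          by (simp add: h_def L2_norm_def)
        ultimately have "L2_norm M (\<lambda>\<omega>. X \<omega> - Y \<omega>) \<le> s + 3 * h" by linarith
        then have "(L2_norm M (\<lambda>\<omega>. X \<omega> - Y \<omega>))\<^sup>2 \<le> (s + 3 * h)\<^sup>2" by (rule power_mono) simp
        also have "\<dots> = s\<^sup>2 + h * (6 * s + 9 * h)" by (simp add: power2_eq_square algebra_simps)
        also have "\<dots> \<le> s\<^sup>2 + h * (6 * s + 9)" using h(1,3) by (intro add_left_mono mult_left_mono) auto
        also have "\<dots> \<le> W2sq \<mu> \<nu> + \<eta>" using h(4) W by simp
        finally have close: "L2_norm M (\<lambda>\<omega>. T (X \<omega>) - Y \<omega>) \<le> \<epsilon> / 2" using \<eta>(2) Y(1,2) by blast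
        have [measurable]: "Y \<in> borel_measurable M" using Y by (simp add: L2_rv_def)
        have XY: "(\<lambda>\<omega>. X \<omega> - Y \<omega>) \<in> L2_rv M" using X(1) Y(1) by (rule L2_rv_diff)
        have TY: "(\<lambda>\<omega>. T (X \<omega>) - Y \<omega>) \<in> L2_rv M" using TX Y(1) by (rule L2_rv_diff)
        have "s\<^sup>2 \<le> (L2_norm M (\<lambda>\<omega>. X \<omega> - Y \<omega>))\<^sup>2"
          using W2sq_le_L2[OF M(1), of X Y] X(2) Y(2) W by simp
        also have "\<dots> = (L2_norm M (\<lambda>\<omega>. ?XH \<omega> - Y \<omega>))\<^sup>2 - 2 * (\<integral>\<omega>. (X \<omega> - Y \<omega>) \<bullet> H \<omega> \<partial>M) - h\<^sup>2"
          using L2_norm_add_sq[OF XY H] by (simp add: h_def algebra_simps)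
        also have "(\<integral>\<omega>. (X \<omega> - Y \<omega>) \<bullet> H \<omega> \<partial>M) = (\<integral>\<omega>. V \<omega> \<bullet> H \<omega> + (T (X \<omega>) - Y \<omega>) \<bullet> H \<omega> \<partial>M)"
          by (rule Bochner_Integration.integral_cong) (auto simp: V_def inner_diff_left)
        also have "\<dots> = (\<integral>\<omega>. V \<omega> \<bullet> H \<omega> \<partial>M) + (\<integral>\<omega>. (T (X \<omega>) - Y \<omega>) \<bullet> H \<omega> \<partial>M)"
          using V TY H by (intro Bochner_Integration.integral_add L2_inner_integrable)
        finally have lower: "s\<^sup>2 \<le> (L2_norm M (\<lambda>\<omega>. ?XH \<omega> - Y \<omega>))\<^sup>2 -
            2 * ((\<integral>\<omega>. V \<omega> \<bullet> H \<omega> \<partial>M) + (\<integral>\<omega>. (T (X \<omega>) - Y \<omega>) \<bullet> H \<omega> \<partial>M)) - h\<^sup>2" .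
        have "s\<^sup>2 \<le> W2sq (law M ?XH) \<nu> - 2 * (\<integral>\<omega>. V \<omega> \<bullet> H \<omega> \<partial>M) - 2 * (\<integral>\<omega>. (T (X \<omega>) - Y \<omega>) \<bullet> H \<omega> \<partial>M)"
          using order_trans[OF lower diff_right_mono[OF diff_right_mono[OF Y(3)]]] by (simp add: distrib_left)
        moreover have "\<bar>\<integral>\<omega>. (T (X \<omega>) - Y \<omega>) \<bullet> H \<omega> \<partial>M\<bar> \<le> \<epsilon> / 2 * h"
          using L2_cauchy_schwarz[OF TY H] mult_right_mono[OF close h(1)] by (simp add: h_def)
        moreover have "h\<^sup>2 \<le> \<epsilon> * h" using h(1,2) by (simp add: power2_eq_square mult_right_mono)
        ultimately show ?thesis using upper unfolding dd X(2) W h_def[symmetric] abs_le_iff by linarith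
      qed
    qed
    ultimately show ?thesis by blast
  qed
  then show ?thesis
    using L2_bounded_linear_inner[OF G] G
    by (simp add: has_frechet_derivative_def has_L2_differential_def V_def[abs_def])
qed

section \<open>Gluing along finite partitions\<close>

lemma (in prob_space) nn_integral_finite_range:
  assumes "simple_function M W" "finite R" "\<And>\<omega>. \<omega> \<in> space M \<Longrightarrow> W \<omega> \<in> R" "\<And>v. 0 \<le> \<phi> v"
  shows "(\<integral>\<^sup>+\<omega>. ennreal (\<phi> (W \<omega>)) \<partial>M) = ennreal (\<Sum>v\<in>R. \<phi> v * measure M {\<omega>\<in>space M. W \<omega> = v})"
proof -
  have "simple_function M (\<lambda>\<omega>. \<phi> (W \<omega>))" using assms(1) by (rule simple_function_compose1)
  then have "(\<lambda>\<omega>. \<phi> (W \<omega>)) \<in> L2_rv M" by (rule simple_function_L2[OF prob_space_axioms])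
  from integral_norm_le_L2_norm(1)[OF this] have "integrable M (\<lambda>\<omega>. \<phi> (W \<omega>))"
    using assms(4) by simp
  then show ?thesis
    using assms(4) by (simp add: nn_integral_eq_integral integral_finite_range[OF assms(1-3)])
qed

text \<open>There are finitely many cells, so the null ones together are negligible; this licenses
  dividing by cell masses.\<close>

lemma (in prob_space) AE_positive_level:
  assumes "simple_function M W"
  shows "AE \<omega> in M. measure M {\<omega>'\<in>space M. W \<omega>' = W \<omega>} \<noteq> 0"
proof -
  have [measurable]: "W \<in> M \<rightarrow>\<^sub>M count_space UNIV" using assms by (rule measurable_simple_function)
  have fin: "finite (W ` space M)" using assms by (simp add: simple_function_def)
  have "AE \<omega> in M. \<forall>v\<in>W ` space M. W \<omega> = v \<longrightarrow> measure M {\<omega>'\<in>space M. W \<omega>' = v} \<noteq> 0"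
  proof (rule AE_finite_allI[OF fin])
    fix v
    show "AE \<omega> in M. W \<omega> = v \<longrightarrow> measure M {\<omega>'\<in>space M. W \<omega>' = v} \<noteq> 0"
    proof (cases "measure M {\<omega>'\<in>space M. W \<omega>' = v} = 0")
      case True
      have "{\<omega>'\<in>space M. W \<omega>' = v} \<in> sets M" by measurable
      with True have "{\<omega>'\<in>space M. W \<omega>' = v} \<in> null_sets M" by (simp add: null_sets_def emeasure_eq_measure)
      from AE_not_in[OF this] AE_space show ?thesis by eventually_elim auto
    qed simp
  qed
  with AE_space show ?thesis by eventually_elim auto
qed

text \<open>The density rescales each product cell so that its mass becomes \<open>p i j\<close>;
  inside a cell the two coordinates stay independent. The marginals survive because the row and
  column sums of \<open>p\<close> are the cell masses. It serves both to glue two couplings and to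
  spread a finite transport plan over a continuous one.\<close>

lemma glue_finite:
  fixes \<pi>1 :: "'a::euclidean_space measure" and \<pi>2 :: "'b::euclidean_space measure"
    and c1 :: "'a \<Rightarrow> 'i" and c2 :: "'b \<Rightarrow> 'j"
  assumes P: "prob_space \<pi>1" "prob_space \<pi>2" and S: "sets \<pi>1 = sets borel" "sets \<pi>2 = sets borel"
    and c: "simple_function borel c1" "simple_function borel c2"
    and p: "\<And>i j. 0 \<le> p i j"
      "\<And>i. i \<in> range c1 \<Longrightarrow> (\<Sum>j\<in>range c2. p i j) = measure \<pi>1 {x. c1 x = i}"
      "\<And>j. j \<in> range c2 \<Longrightarrow> (\<Sum>i\<in>range c1. p i j) = measure \<pi>2 {x. c2 x = j}"
    and w: "w = (\<lambda>z. p (c1 (fst z)) (c2 (snd z)) /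
      (measure \<pi>1 {x. c1 x = c1 (fst z)} * measure \<pi>2 {x. c2 x = c2 (snd z)}))"
    and \<rho>: "\<rho> = density (\<pi>1 \<Otimes>\<^sub>M \<pi>2) (\<lambda>z. ennreal (w z))"
  shows "prob_space \<rho>" "sets \<rho> = sets borel" "distr \<rho> borel fst = \<pi>1" "distr \<rho> borel snd = \<pi>2"
    "w \<in> borel_measurable (\<pi>1 \<Otimes>\<^sub>M \<pi>2)"
    "\<And>i j. i \<in> range c1 \<Longrightarrow> j \<in> range c2 \<Longrightarrow> measure \<rho> {z. c1 (fst z) = i \<and> c2 (snd z) = j} = p i j"
proof -
  interpret A: prob_space \<pi>1 by fact
  interpret B: prob_space \<pi>2 by fact
  interpret AB: pair_prob_space \<pi>1 \<pi>2 ..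
  define m where "m i = measure \<pi>1 {x. c1 x = i}" for i
  define n where "n j = measure \<pi>2 {x. c2 x = j}" for j
  note [measurable_cong] = S
  have sp: "space \<pi>1 = UNIV" "space \<pi>2 = UNIV" using S by (auto dest: sets_eq_imp_space_eq)
  have SP: "sets (\<pi>1 \<Otimes>\<^sub>M \<pi>2) = sets borel"
    using sets_pair_measure_cong[OF S] unfolding borel_prod .
  have [measurable]: "c1 \<in> borel \<rightarrow>\<^sub>M count_space UNIV" "c2 \<in> borel \<rightarrow>\<^sub>M count_space UNIV"
    using c by (auto intro: measurable_simple_function)
  have c1: "simple_function \<pi>1 c1" and c2: "simple_function \<pi>2 c2"
    using c by (auto simp: simple_function_def sp S)
  have fin: "finite (range c1)" "finite (range c2)" using c by (auto simp: simple_function_def)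
  define v where "v i j = p i j / (m i * n j)" for i j
  have v: "0 \<le> v i j" for i j using p(1) by (simp add: v_def m_def n_def)
  have w_eq: "w z = v (c1 (fst z)) (c2 (snd z))" for z by (simp add: w v_def m_def n_def)
  have w_simple: "simple_function (\<pi>1 \<Otimes>\<^sub>M \<pi>2) w"
  proof -
    have "simple_function (\<pi>1 \<Otimes>\<^sub>M \<pi>2) (\<lambda>z. c1 (fst z))" "simple_function (\<pi>1 \<Otimes>\<^sub>M \<pi>2) (\<lambda>z. c2 (snd z))"
      using c by (auto intro!: simple_function_measurable_comp)
    then show ?thesis unfolding w_eq[abs_def] by (rule simple_function_compose2)
  qed
  then show wm [measurable]: "w \<in> borel_measurable (\<pi>1 \<Otimes>\<^sub>M \<pi>2)" by (rule borel_measurable_simple_function)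
  have wx: "(\<lambda>y. w (x, y)) \<in> borel_measurable \<pi>2" for x
    unfolding w_eq using simple_function_compose1[OF c2, of "v (c1 x)"] by (simp add: borel_measurable_simple_function)
  have wy: "(\<lambda>x. w (x, y)) \<in> borel_measurable \<pi>1" for y
    unfolding w_eq using simple_function_compose1[OF c1, of "\<lambda>i. v i (c2 y)"] by (simp add: borel_measurable_simple_function)
  \<comment> \<open>A null cell forces \<open>p i j = 0\<close>, so the convention for division by
    \<open>0\<close> in \<open>v\<close> loses no mass.\<close>
  have p0: "p i j = 0" if "m i = 0 \<or> n j = 0" "i \<in> range c1" "j \<in> range c2" for i j
  proof -
    have "p i j \<le> m i" unfolding m_def p(2)[OF that(2), symmetric] using that fin p(1) by (intro member_le_sum) auto
    moreover have "p i j \<le> n j" unfolding n_def p(3)[OF that(3), symmetric]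
      using that fin p(1) by (intro member_le_sum[of i "range c1" "\<lambda>i. p i j"]) auto
    ultimately show ?thesis using that(1) p(1)[of i j] by auto
  qed
  have inner1: "(\<integral>\<^sup>+y. ennreal (w (x, y)) \<partial>\<pi>2) = 1" if "m (c1 x) \<noteq> 0" for x
  proof -
    have "(\<integral>\<^sup>+y. ennreal (w (x, y)) \<partial>\<pi>2) = ennreal (\<Sum>j\<in>range c2. v (c1 x) j * n j)"
      unfolding w_eq using B.nn_integral_finite_range[OF c2 fin(2), where \<phi> = "v (c1 x)"] v
      by (simp add: sp n_def)
    also have "(\<Sum>j\<in>range c2. v (c1 x) j * n j) = (\<Sum>j\<in>range c2. p (c1 x) j / m (c1 x))"
      using p0 by (intro sum.cong) (auto simp: v_def)
    also have "\<dots> = 1" using p(2)[of "c1 x"] that by (simp add: m_def flip: sum_divide_distrib)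
    finally show ?thesis by simp
  qed
  have inner2: "(\<integral>\<^sup>+x. ennreal (w (x, y)) \<partial>\<pi>1) = 1" if "n (c2 y) \<noteq> 0" for y
  proof -
    have "(\<integral>\<^sup>+x. ennreal (w (x, y)) \<partial>\<pi>1) = ennreal (\<Sum>i\<in>range c1. v i (c2 y) * m i)"
      unfolding w_eq using A.nn_integral_finite_range[OF c1 fin(1), where \<phi> = "\<lambda>i. v i (c2 y)"] v
      by (simp add: sp m_def)
    also have "(\<Sum>i\<in>range c1. v i (c2 y) * m i) = (\<Sum>i\<in>range c1. p i (c2 y) / n (c2 y))"
      using p0 by (intro sum.cong) (auto simp: v_def)
    also have "\<dots> = 1" using p(3)[of "c2 y"] that by (simp add: n_def flip: sum_divide_distrib)
    finally show ?thesis by simp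
  qed
  have AE1: "AE x in \<pi>1. m (c1 x) \<noteq> 0" using A.AE_positive_level[OF c1] by (simp add: sp m_def)
  have AE2: "AE y in \<pi>2. n (c2 y) \<noteq> 0" using B.AE_positive_level[OF c2] by (simp add: sp n_def)
  show S\<rho>: "sets \<rho> = sets borel" by (simp add: \<rho> SP)
  note [measurable_cong] = S\<rho> SP
  have sp\<rho>: "space \<rho> = UNIV" using S\<rho> by (auto dest: sets_eq_imp_space_eq)
  show F1: "distr \<rho> borel fst = \<pi>1"
  proof (rule measure_eqI)
    fix X :: "'a set" assume "X \<in> sets (distr \<rho> borel fst)"
    then have [measurable]: "X \<in> sets borel" by simp
    have fX: "fst -` X \<in> sets (\<pi>1 \<Otimes>\<^sub>M \<pi>2)"
      using measurable_sets[OF borel_measurable_fst_borel, of X] by (simp add: SP)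
    have "emeasure (distr \<rho> borel fst) X = emeasure \<rho> (fst -` X)"
      by (subst emeasure_distr) (auto simp: sp\<rho>)
    also have "\<dots> = (\<integral>\<^sup>+z. ennreal (w z) * indicator (fst -` X) z \<partial>(\<pi>1 \<Otimes>\<^sub>M \<pi>2))"
      unfolding \<rho> by (rule emeasure_density[OF _ fX]) measurable
    also have "\<dots> = (\<integral>\<^sup>+z. indicator X (fst z) * ennreal (w z) \<partial>(\<pi>1 \<Otimes>\<^sub>M \<pi>2))"
      by (intro nn_integral_cong) (auto simp: sp\<rho> split: split_indicator)
    also have "\<dots> = (\<integral>\<^sup>+x. \<integral>\<^sup>+y. indicator X x * ennreal (w (x, y)) \<partial>\<pi>2 \<partial>\<pi>1)"
      by (subst B.nn_integral_fst[symmetric]) auto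
    also have "\<dots> = (\<integral>\<^sup>+x. indicator X x \<partial>\<pi>1)"
    proof (rule nn_integral_cong_AE)
      show "AE x in \<pi>1. (\<integral>\<^sup>+y. indicator X x * ennreal (w (x, y)) \<partial>\<pi>2) = indicator X x"
        using AE1 by eventually_elim (subst nn_integral_cmult, auto simp: inner1 intro!: measurable_compose[OF wx measurable_ennreal])
    qed
    finally show "emeasure (distr \<rho> borel fst) X = emeasure \<pi>1 X" by simp
  qed (simp add: S)
  show "distr \<rho> borel snd = \<pi>2"
  proof (rule measure_eqI)
    fix X :: "'b set" assume "X \<in> sets (distr \<rho> borel snd)"
    then have [measurable]: "X \<in> sets borel" by simp
    have fX: "snd -` X \<in> sets (\<pi>1 \<Otimes>\<^sub>M \<pi>2)"
      using measurable_sets[OF borel_measurable_snd_borel, of X] by (simp add: SP)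
    have "emeasure (distr \<rho> borel snd) X = emeasure \<rho> (snd -` X)"
      by (subst emeasure_distr) (auto simp: sp\<rho>)
    also have "\<dots> = (\<integral>\<^sup>+z. ennreal (w z) * indicator (snd -` X) z \<partial>(\<pi>1 \<Otimes>\<^sub>M \<pi>2))"
      unfolding \<rho> by (rule emeasure_density[OF _ fX]) measurable
    also have "\<dots> = (\<integral>\<^sup>+z. indicator X (snd z) * ennreal (w z) \<partial>(\<pi>1 \<Otimes>\<^sub>M \<pi>2))"
      by (intro nn_integral_cong) (auto simp: sp\<rho> split: split_indicator)
    also have "\<dots> = (\<integral>\<^sup>+y. \<integral>\<^sup>+x. indicator X y * ennreal (w (x, y)) \<partial>\<pi>1 \<partial>\<pi>2)"
      by (subst AB.nn_integral_snd[symmetric]) auto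
    also have "\<dots> = (\<integral>\<^sup>+y. indicator X y \<partial>\<pi>2)"
    proof (rule nn_integral_cong_AE)
      show "AE y in \<pi>2. (\<integral>\<^sup>+x. indicator X y * ennreal (w (x, y)) \<partial>\<pi>1) = indicator X y"
        using AE2 by eventually_elim (subst nn_integral_cmult, auto simp: inner2 intro!: measurable_compose[OF wy measurable_ennreal])
    qed
    finally show "emeasure (distr \<rho> borel snd) X = emeasure \<pi>2 X" by simp
  qed (simp add: S)
  show "prob_space \<rho>"
  proof
    have "emeasure \<rho> (space \<rho>) = emeasure (distr \<rho> borel fst) UNIV"
      by (subst emeasure_distr) (auto simp: sp\<rho>)
    then show "emeasure \<rho> (space \<rho>) = 1" unfolding F1 using A.emeasure_space_1 by (simp add: sp)
  qed
  show "measure \<rho> {z. c1 (fst z) = i \<and> c2 (snd z) = j} = p i j" if ij: "i \<in> range c1" "j \<in> range c2" for i j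
  proof -
    have R: "{z. c1 (fst z) = i \<and> c2 (snd z) = j} = {x. c1 x = i} \<times> {y. c2 y = j}" by auto
    have [measurable]: "{x. c1 x = i} \<in> sets \<pi>1" "{y. c2 y = j} \<in> sets \<pi>2"
      using measurable_sets[of c1 borel "count_space UNIV" "{i}"] measurable_sets[of c2 borel "count_space UNIV" "{j}"]
      by (auto simp: vimage_def S)
    have "emeasure \<rho> ({x. c1 x = i} \<times> {y. c2 y = j}) =
        (\<integral>\<^sup>+z. ennreal (w z) * indicator ({x. c1 x = i} \<times> {y. c2 y = j}) z \<partial>(\<pi>1 \<Otimes>\<^sub>M \<pi>2))"
      unfolding \<rho> by (rule emeasure_density) measurable
    also have "\<dots> = (\<integral>\<^sup>+z. ennreal (v i j) * indicator ({x. c1 x = i} \<times> {y. c2 y = j}) z \<partial>(\<pi>1 \<Otimes>\<^sub>M \<pi>2))"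
      by (intro nn_integral_cong) (auto simp: w_eq split: split_indicator)
    also have "\<dots> = ennreal (v i j) * emeasure (\<pi>1 \<Otimes>\<^sub>M \<pi>2) ({x. c1 x = i} \<times> {y. c2 y = j})"
      by (rule nn_integral_cmult_indicator) measurable
    also have "\<dots> = ennreal (v i j * (m i * n j))"
      using v by (simp add: B.emeasure_pair_measure_Times A.emeasure_eq_measure B.emeasure_eq_measure
        m_def n_def ennreal_mult)
    also have "v i j * (m i * n j) = p i j" using p0[of i j] ij by (auto simp: v_def)
    finally show ?thesis unfolding R using p(1) by (simp add: measure_def)
  qed
qed

section \<open>Differentiability implies that the optimal coupling is a map\<close>

text \<open>
  Smulyan's test: both \<open>X + H\<close> and \<open>X - H\<close> are compared with near-optimal \<open>Y1\<close> and \<open>Y2\<close>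
  respectively, with \<open>H\<close> a small multiple of \<open>Y1 - Y2\<close>; the differential cancels in the sum.
\<close>
lemma differentiable_near_optimal_close:
  fixes X :: "'w \<Rightarrow> 'a::euclidean_space"
  assumes M: "prob_space M" and X: "X \<in> L2_rv M"
    and diff: "frechet_differentiable_at M (L2_lift M (\<lambda>\<sigma>. W2sq \<sigma> \<nu>)) X" and "0 < e"
  obtains \<eta> where "0 < \<eta>"
    "\<And>Y1 Y2. Y1 \<in> L2_rv M \<Longrightarrow> Y2 \<in> L2_rv M \<Longrightarrow> law M Y1 = \<nu> \<Longrightarrow> law M Y2 = \<nu> \<Longrightarrow>
      (L2_norm M (\<lambda>\<omega>. X \<omega> - Y1 \<omega>))\<^sup>2 \<le> W2sq (law M X) \<nu> + \<eta> \<Longrightarrow>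
      (L2_norm M (\<lambda>\<omega>. X \<omega> - Y2 \<omega>))\<^sup>2 \<le> W2sq (law M X) \<nu> + \<eta> \<Longrightarrow>
      L2_norm M (\<lambda>\<omega>. Y1 \<omega> - Y2 \<omega>) \<le> e"
proof -
  define F where "F Z = W2sq (law M Z) \<nu>" for Z :: "'w \<Rightarrow> 'a"
  obtain D where D: "has_L2_differential M F X D"
    using diff by (auto simp: frechet_differentiable_at_def L2_lift_def[abs_def] F_def[abs_def])
  have Dm: "D (\<lambda>\<omega>. c *\<^sub>R H \<omega>) = c * D H" if "H \<in> L2_rv M" for c H
    using D that by (auto simp: has_L2_differential_def L2_bounded_linear_def)
  have "\<forall>\<epsilon>>0. \<exists>\<delta>>0. \<forall>H\<in>L2_rv M. L2_norm M H < \<delta> \<longrightarrow>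
      \<bar>F (\<lambda>\<omega>. X \<omega> + H \<omega>) - F X - D H\<bar> \<le> \<epsilon> * L2_norm M H"
    using D by (simp add: has_L2_differential_def)
  from this[rule_format, of "e / 3"] obtain \<delta> where \<delta>: "0 < \<delta>" "\<And>H. H \<in> L2_rv M \<Longrightarrow> L2_norm M H < \<delta> \<Longrightarrow>
      \<bar>F (\<lambda>\<omega>. X \<omega> + H \<omega>) - F X - D H\<bar> \<le> e / 3 * L2_norm M H"
    using \<open>0 < e\<close> by auto
  \<comment> \<open>Each third of \<open>e\<close> pays for one error: the near-optimality slack
    \<open>e / 3 * s\<close>, the remainder of the differential, which needs
    \<open>s < \<delta>\<close>, and the quadratic term
    \<open>s\<^sup>2 \<le> e / 3 * s\<close>.\<close>
  define s where "s = min (\<delta> / 2) (e / 3)"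
  have s: "0 < s" "s < \<delta>" "s \<le> e / 3" using \<delta>(1) \<open>0 < e\<close> by (auto simp: s_def)
  show ?thesis
  proof
    show "0 < e / 3 * s" using s \<open>0 < e\<close> by simp
    fix Y1 Y2 assume Y: "Y1 \<in> L2_rv M" "Y2 \<in> L2_rv M" and lawY: "law M Y1 = \<nu>" "law M Y2 = \<nu>"
      and near: "(L2_norm M (\<lambda>\<omega>. X \<omega> - Y1 \<omega>))\<^sup>2 \<le> W2sq (law M X) \<nu> + e / 3 * s"
        "(L2_norm M (\<lambda>\<omega>. X \<omega> - Y2 \<omega>))\<^sup>2 \<le> W2sq (law M X) \<nu> + e / 3 * s"
    define n where "n = L2_norm M (\<lambda>\<omega>. Y1 \<omega> - Y2 \<omega>)"
    show "L2_norm M (\<lambda>\<omega>. Y1 \<omega> - Y2 \<omega>) \<le> e"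
    proof (cases "n = 0")
      case True
      then show ?thesis using \<open>0 < e\<close> by (simp add: n_def)
    next
      case False
      then have "0 < n" using L2_norm_nonneg[of M "\<lambda>\<omega>. Y1 \<omega> - Y2 \<omega>"] unfolding n_def by linarith
      have V: "(\<lambda>\<omega>. Y1 \<omega> - Y2 \<omega>) \<in> L2_rv M" using Y by (rule L2_rv_diff)
      \<comment> \<open>Normalised to have norm exactly \<open>s\<close>, so that pairing
        \<open>H\<close> with \<open>Y1 - Y2\<close> gives \<open>s * n\<close>.\<close>
      define H where "H \<omega> = (s / n) *\<^sub>R (Y1 \<omega> - Y2 \<omega>)" for \<omega>
      have H: "H \<in> L2_rv M" unfolding H_def using V by (rule L2_rv_scaleR)
      have Hs: "L2_norm M H = s" unfolding H_def L2_norm_scaleR n_def[symmetric] using s \<open>0 < n\<close> by simp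
      have near_le: "F (\<lambda>\<omega>. X \<omega> + K \<omega>) \<le> F X + e / 3 * s + 2 * (\<integral>\<omega>. (X \<omega> - Z \<omega>) \<bullet> K \<omega> \<partial>M) + (L2_norm M K)\<^sup>2"
        if K: "K \<in> L2_rv M" and Z: "Z \<in> L2_rv M" "law M Z = \<nu>"
          "(L2_norm M (\<lambda>\<omega>. X \<omega> - Z \<omega>))\<^sup>2 \<le> W2sq (law M X) \<nu> + e / 3 * s" for K Z
      proof -
        have "F (\<lambda>\<omega>. X \<omega> + K \<omega>) \<le> (L2_norm M (\<lambda>\<omega>. (X \<omega> + K \<omega>) - Z \<omega>))\<^sup>2"
          unfolding F_def Z(2)[symmetric] using X K Z(1) by (intro W2sq_le_L2 M) (auto simp: L2_rv_def)
        also have "(\<lambda>\<omega>. (X \<omega> + K \<omega>) - Z \<omega>) = (\<lambda>\<omega>. (X \<omega> - Z \<omega>) + K \<omega>)" by auto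
        finally show ?thesis unfolding L2_norm_add_sq[OF L2_rv_diff[OF X Z(1)] K] F_def using Z(3) by linarith
      qed
      let ?K = "\<lambda>\<omega>. (-1) *\<^sub>R H \<omega>"
      have K: "?K \<in> L2_rv M" using H by (rule L2_rv_scaleR)
      have Ks: "L2_norm M ?K = s" using L2_norm_scaleR[of M "-1" H] Hs by simp
      have 1: "F (\<lambda>\<omega>. X \<omega> + H \<omega>) \<le> F X + e / 3 * s + 2 * (\<integral>\<omega>. (X \<omega> - Y1 \<omega>) \<bullet> H \<omega> \<partial>M) + s\<^sup>2"
        using near_le[OF H Y(1) lawY(1) near(1)] Hs by simp
      have 2: "F (\<lambda>\<omega>. X \<omega> + ?K \<omega>) \<le> F X + e / 3 * s - 2 * (\<integral>\<omega>. (X \<omega> - Y2 \<omega>) \<bullet> H \<omega> \<partial>M) + s\<^sup>2"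
        using near_le[OF K Y(2) lawY(2) near(2)] Ks by simp
      have 3: "\<bar>F (\<lambda>\<omega>. X \<omega> + H \<omega>) - F X - D H\<bar> \<le> e / 3 * s" using \<delta>(2)[OF H] Hs s by simp
      have 4: "\<bar>F (\<lambda>\<omega>. X \<omega> + ?K \<omega>) - F X + D H\<bar> \<le> e / 3 * s"
        using \<delta>(2)[OF K] Ks s Dm[OF H, of "-1"] by simp
      have "(\<integral>\<omega>. (X \<omega> - Y2 \<omega>) \<bullet> H \<omega> \<partial>M) - (\<integral>\<omega>. (X \<omega> - Y1 \<omega>) \<bullet> H \<omega> \<partial>M) =
          (\<integral>\<omega>. (X \<omega> - Y2 \<omega>) \<bullet> H \<omega> - (X \<omega> - Y1 \<omega>) \<bullet> H \<omega> \<partial>M)"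
        using X Y H by (intro Bochner_Integration.integral_diff[symmetric] L2_inner_integrable L2_rv_diff)
      also have "\<dots> = (\<integral>\<omega>. (s / n) * (norm (Y1 \<omega> - Y2 \<omega>))\<^sup>2 \<partial>M)"
        by (rule Bochner_Integration.integral_cong)
          (auto simp: H_def inner_diff_left power2_norm_eq_inner algebra_simps diff_divide_distrib)
      also have "\<dots> = (s / n) * n\<^sup>2" unfolding n_def L2_norm_sq by simp
      also have "\<dots> = s * n" using \<open>0 < n\<close> by (simp add: power2_eq_square)
      finally have "s * n \<le> 2 * (e / 3 * s) + s\<^sup>2"
        using 1 2 3 4 by linarith
      also have "\<dots> \<le> 2 * (e / 3 * s) + e / 3 * s"
        unfolding power2_eq_square using mult_right_mono[OF s(3) less_imp_le[OF s(1)]] by (rule add_left_mono)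
      also have "\<dots> = s * e" by simp
      finally show ?thesis using s(1) by (simp add: n_def)
    qed
  qed
qed

text \<open>
  Under the gluing \<open>\<rho>\<close> of \<open>\<pi>1\<close> and \<open>\<pi>2\<close> the two second coordinates are conditionally independent
  given the cell of the first coordinate; \<open>t\<close> is the mean of the second coordinate of \<open>\<pi>2\<close> on that cell.
\<close>
lemma couplings_cell_mean:
  fixes \<mu> \<nu> :: "'a::euclidean_space measure" and c :: "'a \<Rightarrow> 'a"
  assumes \<mu>: "\<mu> \<in> P2" and \<nu>: "\<nu> \<in> P2" and c: "simple_function borel c" and \<pi>2: "\<pi>2 \<in> couplings \<mu> \<nu>"
  obtains t where "t \<in> L2_rv \<mu>"
    "\<And>\<pi>1. \<pi>1 \<in> couplings \<mu> \<nu> \<Longrightarrow> \<exists>\<rho>\<in>couplings \<pi>1 \<pi>2. (AE z in \<rho>. c (fst (fst z)) = c (fst (snd z))) \<and>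
       L2_norm \<pi>1 (\<lambda>z. snd z - t (fst z)) \<le> L2_norm \<rho> (\<lambda>z. snd (fst z) - snd (snd z))"
proof -
  interpret U: prob_space \<mu> by (rule P2_D[OF \<mu>])
  interpret B: prob_space \<pi>2 by (rule couplingsD[OF \<pi>2])
  have cm [measurable]: "c \<in> borel \<rightarrow>\<^sub>M count_space UNIV" by (rule measurable_simple_function[OF c])
  have cb [measurable]: "c \<in> borel_measurable borel" by (rule borel_measurable_simple_function[OF c])
  have fin: "finite (range c)" using c by (simp add: simple_function_def)
  have c\<mu>: "simple_function \<mu> c" using c by (simp add: simple_function_def P2_D[OF \<mu>])
  define m where "m i = measure \<mu> {x. c x = i}" for i
  have m0: "0 \<le> m i" for i by (simp add: m_def)
  define I where "I i = (\<integral>z. indicator {z. c (fst z) = i} z *\<^sub>R snd z \<partial>\<pi>2)" for i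
  \<comment> \<open>On a null cell \<open>1 / 0 = 0\<close> makes the mean \<open>0\<close>.\<close>
  define t0 where "t0 i = (1 / m i) *\<^sub>R I i" for i
  define t where "t x = t0 (c x)" for x
  note S2 [measurable_cong] = couplingsD(2)[OF \<pi>2]
  have idL2: "(\<lambda>x. x) \<in> L2_rv \<nu>" by (rule P2_D(4)[OF \<nu>])
  have set_c [measurable]: "{z :: 'a \<times> 'a. c (fst z) = i} \<in> sets borel" for i
  proof -
    have "(\<lambda>z :: 'a \<times> 'a. c (fst z)) \<in> borel \<rightarrow>\<^sub>M count_space UNIV"
      by (rule measurable_compose[OF borel_measurable_fst_borel cm])
    from measurable_sets[OF this, of "{i}"] show ?thesis by (simp add: vimage_def)
  qed
  have m_\<pi>: "measure \<pi> {z. c (fst z) = i} = m i" if "\<pi> \<in> couplings \<mu> \<nu>" for \<pi> i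
  proof -
    have "measure (distr \<pi> borel fst) {x. c x = i} = measure \<pi> (fst -` {x. c x = i} \<inter> space \<pi>)"
      using that by (intro measure_distr couplings_fst_measurable[OF that]) measurable
    then show ?thesis by (simp add: m_def couplingsD[OF that] vimage_def)
  qed
  have intI: "integrable \<pi>2 (\<lambda>z. indicator {z. c (fst z) = i} z *\<^sub>R snd z)" for i
  proof (rule integrable_mult_indicator)
    have "integrable \<pi>2 (\<lambda>z. norm (snd z))"
      using couplings_L2(2)[OF \<pi>2 idL2] by (rule B.integral_norm_le_L2_norm(1))
    then show "integrable \<pi>2 snd"
      using couplings_fst_measurable(2)[OF \<pi>2] by (simp add: integrable_norm_iff)
  qed simp
  have t_simple: "simple_function \<mu> t" unfolding t_def[abs_def] using c\<mu> by (rule simple_function_compose1)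
  have "simple_function borel t" unfolding t_def[abs_def] using c by (rule simple_function_compose1)
  then have tb [measurable]: "t \<in> borel_measurable borel" by (rule borel_measurable_simple_function)
  have t: "t \<in> L2_rv \<mu>" using U.prob_space_axioms t_simple by (rule simple_function_L2)
  let ?N = "L2_norm \<nu> (\<lambda>x. x)"
  have diff_sq: "(L2_norm \<pi> (\<lambda>z. snd z - t (fst z)))\<^sup>2 =
      ?N\<^sup>2 - 2 * (\<integral>z. snd z \<bullet> t (fst z) \<partial>\<pi>) + (L2_norm \<mu> t)\<^sup>2" if "\<pi> \<in> couplings \<mu> \<nu>" for \<pi>
    using L2_norm_diff_sq[OF couplings_L2(2)[OF that idL2] couplings_L2(1)[OF that t]]
      couplings_L2_norm(2)[OF that, of "\<lambda>x. x"] couplings_L2_norm(1)[OF that tb] by simp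
  \<comment> \<open>Under \<open>\<pi>2\<close> the cell mean is the orthogonal projection of the
    second coordinate onto functions of the cell: pairing the two gives the squared norm of
    \<open>t\<close>, and a projection does not increase the norm.\<close>
  have t_le: "(L2_norm \<mu> t)\<^sup>2 \<le> ?N\<^sup>2"
  proof -
    have "(\<integral>z. snd z \<bullet> t (fst z) \<partial>\<pi>2) = (\<integral>z. (\<Sum>i\<in>range c. t0 i \<bullet> (indicator {z. c (fst z) = i} z *\<^sub>R snd z)) \<partial>\<pi>2)"
    proof (rule Bochner_Integration.integral_cong[OF refl])
      fix z :: "'a \<times> 'a"
      have "(\<Sum>i\<in>range c. t0 i \<bullet> (indicator {z. c (fst z) = i} z *\<^sub>R snd z)) =
          (\<Sum>i\<in>range c. if i = c (fst z) then t0 i \<bullet> snd z else 0)"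
        by (intro sum.cong) (auto simp: indicator_def)
      then show "snd z \<bullet> t (fst z) = (\<Sum>i\<in>range c. t0 i \<bullet> (indicator {z. c (fst z) = i} z *\<^sub>R snd z))"
        using fin by (simp add: t_def inner_commute)
    qed
    also have "\<dots> = (\<Sum>i\<in>range c. \<integral>z. t0 i \<bullet> (indicator {z. c (fst z) = i} z *\<^sub>R snd z) \<partial>\<pi>2)"
      by (rule Bochner_Integration.integral_sum) (rule integrable_inner_right, rule intI)
    also have "\<dots> = (\<Sum>i\<in>range c. t0 i \<bullet> I i)"
      unfolding I_def by (intro sum.cong refl integral_inner_right intI)
    also have "\<dots> = (\<Sum>i\<in>range c. (norm (t0 i))\<^sup>2 * m i)"
    proof (rule sum.cong[OF refl])
      fix i
      show "t0 i \<bullet> I i = (norm (t0 i))\<^sup>2 * m i"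
        unfolding power2_norm_eq_inner by (cases "m i = 0") (auto simp: t0_def)
    qed
    also have "\<dots> = (L2_norm \<mu> t)\<^sup>2"
      unfolding L2_norm_sq t_def
      using U.integral_finite_range[where \<phi> = "\<lambda>i. (norm (t0 i))\<^sup>2", OF c\<mu> fin]
      by (simp add: m_def P2_D(3)[OF \<mu>])
    finally show ?thesis using diff_sq[OF \<pi>2] zero_le_power2[of "L2_norm \<pi>2 (\<lambda>z. snd z - t (fst z))"] by linarith
  qed
  show ?thesis
  proof
    show "t \<in> L2_rv \<mu>" by fact
    fix \<pi>1 assume \<pi>1: "\<pi>1 \<in> couplings \<mu> \<nu>"
    interpret A: prob_space \<pi>1 by (rule couplingsD[OF \<pi>1])
    interpret AB: pair_prob_space \<pi>1 \<pi>2 ..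
    note S1 [measurable_cong] = couplingsD(2)[OF \<pi>1]
    \<comment> \<open>Diagonal weights: the two couplings are glued only where their first
      coordinates lie in the same cell.\<close>
    define p where "p i j = (if i = j then m i else 0)" for i j
    define w where "w = (\<lambda>z :: ('a \<times> 'a) \<times> 'a \<times> 'a. p (c (fst (fst z))) (c (fst (snd z))) /
      (measure \<pi>1 {x. c (fst x) = c (fst (fst z))} * measure \<pi>2 {x. c (fst x) = c (fst (snd z))}))"
    define \<rho> where "\<rho> = density (\<pi>1 \<Otimes>\<^sub>M \<pi>2) (\<lambda>z. ennreal (w z))"
    have cf: "simple_function borel (\<lambda>z :: 'a \<times> 'a. c (fst z))"
      by (rule simple_function_measurable_comp[OF c borel_measurable_fst_borel])
    have rg: "range (\<lambda>z :: 'a \<times> 'a. c (fst z)) = range c" by (auto simp: image_iff)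
    have glue: "prob_space \<rho>" "sets \<rho> = sets borel" "distr \<rho> borel fst = \<pi>1" "distr \<rho> borel snd = \<pi>2"
      "w \<in> borel_measurable (\<pi>1 \<Otimes>\<^sub>M \<pi>2)"
      using glue_finite(1-5)[OF A.prob_space_axioms B.prob_space_axioms S1 S2 cf cf, of p w \<rho>]
        fin m0 m_\<pi>[OF \<pi>1] m_\<pi>[OF \<pi>2] w_def \<rho>_def unfolding rg by (auto simp: p_def)
    have \<rho>: "\<rho> \<in> couplings \<pi>1 \<pi>2" using glue by (simp add: couplings_def)
    have w_eq: "w z = (if c (fst (fst z)) = c (fst (snd z)) then 1 / m (c (fst (fst z))) else 0)" for z
      by (simp add: w_def p_def m_\<pi>[OF \<pi>1] m_\<pi>[OF \<pi>2])
    have w0: "0 \<le> w z" for z using m0 by (simp add: w_eq)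
    have "AE z in \<rho>. c (fst (fst z)) = c (fst (snd z))"
      unfolding \<rho>_def AE_density[OF measurable_compose[OF glue(5) measurable_ennreal]]
      by (rule AE_I2) (simp add: w_eq)
    moreover have "L2_norm \<pi>1 (\<lambda>z. snd z - t (fst z)) \<le> L2_norm \<rho> (\<lambda>z. snd (fst z) - snd (snd z))"
    proof (rule power2_le_imp_le)
      have y1: "(\<lambda>z. snd (fst z)) \<in> L2_rv \<rho>"
        using couplings_L2(1)[OF \<rho> couplings_L2(2)[OF \<pi>1 idL2]] .
      have y2: "(\<lambda>z. snd (snd z)) \<in> L2_rv \<rho>"
        using couplings_L2(2)[OF \<rho> couplings_L2(2)[OF \<pi>2 idL2]] .
      have n1: "L2_norm \<rho> (\<lambda>z. snd (fst z)) = ?N"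
        using couplings_L2_norm(1)[OF \<rho> borel_measurable_snd_borel] couplings_L2_norm(2)[OF \<pi>1, of "\<lambda>x. x"] by simp
      have n2: "L2_norm \<rho> (\<lambda>z. snd (snd z)) = ?N"
        using couplings_L2_norm(2)[OF \<rho> borel_measurable_snd_borel] couplings_L2_norm(2)[OF \<pi>2, of "\<lambda>x. x"] by simp
      have SP: "sets (\<pi>1 \<Otimes>\<^sub>M \<pi>2) = sets borel"
        using sets_pair_measure_cong[OF S1 S2] unfolding borel_prod .
      have f: "(\<lambda>z. snd (fst z) \<bullet> snd (snd z)) \<in> borel_measurable (\<pi>1 \<Otimes>\<^sub>M \<pi>2)"
        using y1 y2 by (simp add: L2_rv_def \<rho>_def)
      have "integrable \<rho> (\<lambda>z. snd (fst z) \<bullet> snd (snd z))" using y1 y2 by (rule L2_inner_integrable)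
      then have int: "integrable (\<pi>1 \<Otimes>\<^sub>M \<pi>2) (\<lambda>z. w z * (snd (fst z) \<bullet> snd (snd z)))"
        unfolding \<rho>_def using integrable_density[OF f glue(5)] w0 by simp
      have "(\<integral>z. snd (fst z) \<bullet> snd (snd z) \<partial>\<rho>) = (\<integral>z. w z * (snd (fst z) \<bullet> snd (snd z)) \<partial>(\<pi>1 \<Otimes>\<^sub>M \<pi>2))"
        unfolding \<rho>_def using integral_density[OF f glue(5)] w0 by simp
      also have "\<dots> = (\<integral>a. \<integral>b. w (a, b) * (snd a \<bullet> snd b) \<partial>\<pi>2 \<partial>\<pi>1)"
        using AB.integral_fst'[OF int] by simp
      also have "\<dots> = (\<integral>a. snd a \<bullet> t (fst a) \<partial>\<pi>1)"
      proof (rule Bochner_Integration.integral_cong[OF refl])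
        fix a :: "'a \<times> 'a"
        let ?i = "c (fst a)"
        have "(\<integral>b. w (a, b) * (snd a \<bullet> snd b) \<partial>\<pi>2) =
            (\<integral>b. ((1 / m ?i) *\<^sub>R snd a) \<bullet> (indicator {z. c (fst z) = ?i} b *\<^sub>R snd b) \<partial>\<pi>2)"
          by (rule Bochner_Integration.integral_cong[OF refl]) (auto simp: w_eq indicator_def)
        also have "\<dots> = ((1 / m ?i) *\<^sub>R snd a) \<bullet> I ?i"
          unfolding I_def by (rule integral_inner_right) (rule intI)
        finally show "(\<integral>b. w (a, b) * (snd a \<bullet> snd b) \<partial>\<pi>2) = snd a \<bullet> t (fst a)" by (simp add: t_def t0_def)
      qed
      \<comment> \<open>Independence within a cell allows \<open>snd (snd z)\<close> to be replaced
        by its cell mean. Once both squares are expanded, the claim reduces to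
        \<open>t_le\<close>.\<close>
      finally have J: "(\<integral>z. snd (fst z) \<bullet> snd (snd z) \<partial>\<rho>) = (\<integral>a. snd a \<bullet> t (fst a) \<partial>\<pi>1)" .
      show "(L2_norm \<pi>1 (\<lambda>z. snd z - t (fst z)))\<^sup>2 \<le> (L2_norm \<rho> (\<lambda>z. snd (fst z) - snd (snd z)))\<^sup>2"
        unfolding diff_sq[OF \<pi>1] L2_norm_diff_sq[OF y1 y2] n1 n2 J using t_le by linarith
    qed simp
    ultimately show "\<exists>\<rho>\<in>couplings \<pi>1 \<pi>2. (AE z in \<rho>. c (fst (fst z)) = c (fst (snd z))) \<and>
       L2_norm \<pi>1 (\<lambda>z. snd z - t (fst z)) \<le> L2_norm \<rho> (\<lambda>z. snd (fst z) - snd (snd z))"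
      using \<rho> by blast
  qed
qed

text \<open>One optimal \<open>\<pi>2\<close> is fixed as reference, so that \<open>t\<close> does
  not depend on the optimal coupling compared with it. Under the gluing the two first coordinates
  nearly coincide, so after realisation over \<open>X\<close> both second coordinates are
  near-optimal for \<open>X\<close>, hence close to each other; the cell mean is then close
  too.\<close>

lemma optimal_couplings_near_map:
  fixes X :: "'w \<Rightarrow> 'a::euclidean_space"
  assumes M: "prob_space M" "atomless M" and \<mu>: "\<mu> \<in> P2" and \<nu>: "\<nu> \<in> P2"
    and X: "X \<in> L2_rv M" "law M X = \<mu>"
    and diff: "frechet_differentiable_at M (L2_lift M (\<lambda>\<sigma>. W2sq \<sigma> \<nu>)) X" and "0 < e"
  shows "\<exists>t\<in>L2_rv \<mu>. \<forall>\<pi>\<in>optimal_couplings \<mu> \<nu>. L2_norm \<pi> (\<lambda>z. snd z - t (fst z)) \<le> e"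
proof -
  obtain \<eta> where \<eta>: "0 < \<eta>"
    "\<And>Y1 Y2. Y1 \<in> L2_rv M \<Longrightarrow> Y2 \<in> L2_rv M \<Longrightarrow> law M Y1 = \<nu> \<Longrightarrow> law M Y2 = \<nu> \<Longrightarrow>
      (L2_norm M (\<lambda>\<omega>. X \<omega> - Y1 \<omega>))\<^sup>2 \<le> W2sq (law M X) \<nu> + \<eta> \<Longrightarrow>
      (L2_norm M (\<lambda>\<omega>. X \<omega> - Y2 \<omega>))\<^sup>2 \<le> W2sq (law M X) \<nu> + \<eta> \<Longrightarrow>
      L2_norm M (\<lambda>\<omega>. Y1 \<omega> - Y2 \<omega>) \<le> e"
    by (rule differentiable_near_optimal_close[OF M(1) X(1) diff \<open>0 < e\<close>]) (rule that)
  define s where "s = sqrt (W2sq \<mu> \<nu>)"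
  have s: "0 \<le> s" "s\<^sup>2 = W2sq \<mu> \<nu>" using W2sq_nonneg[OF M \<mu> \<nu>] by (simp_all add: s_def)
  \<comment> \<open>In \<open>s + 3 * d\<close>, one \<open>d\<close> is the error of realising the
    gluing over \<open>X\<close> and two are for passing from one first coordinate to the other; the
    quotient keeps the square within \<open>\<eta>\<close> of the optimum.\<close>
  define d where "d = min 1 (\<eta> / (6 * s + 9))"
  have d: "0 < d" "d \<le> 1" "d * (6 * s + 9) \<le> \<eta>"
    using \<eta>(1) s(1) by (auto simp: d_def pos_le_divide_eq[symmetric])
  have d\<eta>: "(s + 3 * d)\<^sup>2 \<le> W2sq \<mu> \<nu> + \<eta>"
  proof -
    have "(s + 3 * d)\<^sup>2 = s\<^sup>2 + d * (6 * s + 9 * d)" by (simp add: power2_eq_square algebra_simps)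
    also have "\<dots> \<le> s\<^sup>2 + d * (6 * s + 9)" using d by (intro add_left_mono mult_left_mono) auto
    finally show ?thesis using d(3) s(2) by simp
  qed
  obtain c where c: "simple_function borel c" "(\<lambda>x. c x - x) \<in> L2_rv \<mu>" "L2_norm \<mu> (\<lambda>x. c x - x) \<le> d"
    by (rule P2_simple_approx[OF \<mu> d(1)]) (rule that)
  have cb [measurable]: "c \<in> borel_measurable borel" using c(1) by (rule borel_measurable_simple_function)
  obtain \<pi>2 where opt2: "\<pi>2 \<in> optimal_couplings \<mu> \<nu>" using optimal_coupling_exists[OF M \<mu> \<nu>] by blast
  then have \<pi>2: "\<pi>2 \<in> couplings \<mu> \<nu>" by (simp add: optimal_couplings_def)
  have cost: "L2_norm \<pi> (\<lambda>z. fst z - snd z) = s" if "\<pi> \<in> optimal_couplings \<mu> \<nu>" for \<pi>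
  proof -
    have "(L2_norm \<pi> (\<lambda>z. fst z - snd z))\<^sup>2 = s\<^sup>2"
      using that unfolding s(2) by (simp add: optimal_couplings_def transport_cost_eq)
    then show ?thesis using L2_norm_nonneg s(1) by (rule power2_eq_imp_eq)
  qed
  obtain t where t: "t \<in> L2_rv \<mu>"
    "\<And>\<pi>1. \<pi>1 \<in> couplings \<mu> \<nu> \<Longrightarrow> \<exists>\<rho>\<in>couplings \<pi>1 \<pi>2. (AE z in \<rho>. c (fst (fst z)) = c (fst (snd z))) \<and>
       L2_norm \<pi>1 (\<lambda>z. snd z - t (fst z)) \<le> L2_norm \<rho> (\<lambda>z. snd (fst z) - snd (snd z))"
    by (rule couplings_cell_mean[OF \<mu> \<nu> c(1) \<pi>2]) (rule that)
  have "L2_norm \<pi>1 (\<lambda>z. snd z - t (fst z)) \<le> e" if opt1: "\<pi>1 \<in> optimal_couplings \<mu> \<nu>" for \<pi>1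
  proof -
    have \<pi>1: "\<pi>1 \<in> couplings \<mu> \<nu>" using opt1 by (simp add: optimal_couplings_def)
    obtain \<rho> where \<rho>: "\<rho> \<in> couplings \<pi>1 \<pi>2" and AE: "AE z in \<rho>. c (fst (fst z)) = c (fst (snd z))"
      and le: "L2_norm \<pi>1 (\<lambda>z. snd z - t (fst z)) \<le> L2_norm \<rho> (\<lambda>z. snd (fst z) - snd (snd z))"
      using t(2)[OF \<pi>1] by blast
    note P1 = couplings_P2[OF \<pi>1 \<mu> \<nu>] and P2 = couplings_P2[OF \<pi>2 \<mu> \<nu>]
    note P\<rho> = couplings_P2[OF \<rho> P1 P2]
    have [measurable_cong]: "sets \<rho> = sets borel" by (rule couplingsD(2)[OF \<rho>])
    have fm: "(\<lambda>z :: ('a \<times> 'a) \<times> 'a \<times> 'a. fst (fst z)) \<in> borel_measurable borel" by measurable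
    have "distr \<rho> borel (\<lambda>z. fst (fst z)) = distr (distr \<rho> borel fst) borel fst"
      by (subst distr_distr) (auto simp: comp_def)
    also have "\<dots> = law M X" by (simp add: couplingsD[OF \<rho>] couplingsD[OF \<pi>1] X(2))
    finally obtain Z where Z: "Z \<in> L2_rv M" "law M Z = \<rho>" "L2_norm M (\<lambda>\<omega>. X \<omega> - fst (fst (Z \<omega>))) \<le> d"
      by (rule atomless_realize_over[OF M X(1) P\<rho> fm _ d(1)]) (rule that)
    have [measurable]: "Z \<in> borel_measurable M" using Z by (simp add: L2_rv_def)
    have norm_Z: "L2_norm M (\<lambda>\<omega>. f (Z \<omega>)) = L2_norm \<rho> f" if "f \<in> borel_measurable borel" for f :: "('a \<times> 'a) \<times> 'a \<times> 'a \<Rightarrow> 'a"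
      by (rule L2_norm_comp[OF Z(2)]) (use that in auto)
    have x1: "(\<lambda>\<omega>. fst (fst (Z \<omega>))) \<in> L2_rv M" and y1: "(\<lambda>\<omega>. snd (fst (Z \<omega>))) \<in> L2_rv M"
      and x2: "(\<lambda>\<omega>. fst (snd (Z \<omega>))) \<in> L2_rv M" and y2: "(\<lambda>\<omega>. snd (snd (Z \<omega>))) \<in> L2_rv M"
      using Z(1) by (auto intro!: L2_rv_fst L2_rv_snd)
    have law1: "law M (\<lambda>\<omega>. snd (fst (Z \<omega>))) = \<nu>" and law2: "law M (\<lambda>\<omega>. snd (snd (Z \<omega>))) = \<nu>"
    proof -
      have "law M (\<lambda>\<omega>. snd (fst (Z \<omega>))) = distr (distr (law M Z) borel fst) borel snd"
        "law M (\<lambda>\<omega>. snd (snd (Z \<omega>))) = distr (distr (law M Z) borel snd) borel snd"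
        by (simp_all add: distr_distr comp_def)
      then show "law M (\<lambda>\<omega>. snd (fst (Z \<omega>))) = \<nu>" "law M (\<lambda>\<omega>. snd (snd (Z \<omega>))) = \<nu>"
        unfolding Z(2) couplingsD[OF \<rho>] couplingsD[OF \<pi>1] couplingsD[OF \<pi>2] by simp_all
    qed
    have c1: "L2_norm M (\<lambda>\<omega>. fst (fst (Z \<omega>)) - snd (fst (Z \<omega>))) = s"
      using norm_Z[of "\<lambda>z. fst (fst z) - snd (fst z)"] couplings_L2_norm(1)[OF \<rho>, of "\<lambda>z. fst z - snd z"] cost[OF opt1]
      by simp
    have c2: "L2_norm M (\<lambda>\<omega>. fst (snd (Z \<omega>)) - snd (snd (Z \<omega>))) = s"
      using norm_Z[of "\<lambda>z. fst (snd z) - snd (snd z)"] couplings_L2_norm(2)[OF \<rho>, of "\<lambda>z. fst z - snd z"] cost[OF opt2]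
      by simp
    \<comment> \<open>Almost surely the two first coordinates have the same value under
      \<open>c\<close>, and each is within \<open>d\<close> of it in norm.\<close>
    have x12: "L2_norm M (\<lambda>\<omega>. fst (fst (Z \<omega>)) - fst (snd (Z \<omega>))) \<le> 2 * d"
    proof -
      have cc1: "(\<lambda>z. c (fst (fst z)) - fst (fst z)) \<in> L2_rv \<rho>"
        using couplings_L2(1)[OF \<rho> couplings_L2(1)[OF \<pi>1 c(2)]] .
      have cc2: "(\<lambda>z. c (fst (snd z)) - fst (snd z)) \<in> L2_rv \<rho>"
        using couplings_L2(2)[OF \<rho> couplings_L2(1)[OF \<pi>2 c(2)]] .
      have e1: "L2_norm \<rho> (\<lambda>z. c (fst (fst z)) - fst (fst z)) \<le> d"
        using couplings_L2_norm(1)[OF \<rho>, of "\<lambda>z. c (fst z) - fst z"] couplings_L2_norm(1)[OF \<pi>1, of "\<lambda>x. c x - x"] c(3)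
        by simp
      have e2: "L2_norm \<rho> (\<lambda>z. c (fst (snd z)) - fst (snd z)) \<le> d"
        using couplings_L2_norm(2)[OF \<rho>, of "\<lambda>z. c (fst z) - fst z"] couplings_L2_norm(1)[OF \<pi>2, of "\<lambda>x. c x - x"] c(3)
        by simp
      have "L2_norm M (\<lambda>\<omega>. fst (fst (Z \<omega>)) - fst (snd (Z \<omega>))) = L2_norm \<rho> (\<lambda>z. fst (fst z) - fst (snd z))"
        by (rule norm_Z) measurable
      also have "\<dots> = L2_norm \<rho> (\<lambda>z. (c (fst (snd z)) - fst (snd z)) + (-1) *\<^sub>R (c (fst (fst z)) - fst (fst z)))"
        using AE by (intro L2_norm_cong_AE) auto
      also have "\<dots> \<le> L2_norm \<rho> (\<lambda>z. c (fst (snd z)) - fst (snd z)) + L2_norm \<rho> (\<lambda>z. (-1) *\<^sub>R (c (fst (fst z)) - fst (fst z)))"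
        by (rule L2_triangle[OF cc2 L2_rv_scaleR[OF cc1]])
      also have "\<dots> \<le> 2 * d" using e1 e2 unfolding L2_norm_scaleR by simp
      finally show ?thesis .
    qed
    have "L2_norm M (\<lambda>\<omega>. X \<omega> - snd (fst (Z \<omega>))) \<le> s + 3 * d"
      using L2_triangle_diff[OF X(1) x1 y1] c1 Z(3) d(1) by linarith
    from power_mono[OF this L2_norm_nonneg, of 2]
    have near1: "(L2_norm M (\<lambda>\<omega>. X \<omega> - snd (fst (Z \<omega>))))\<^sup>2 \<le> W2sq (law M X) \<nu> + \<eta>" using d\<eta> X(2) by simp
    have "L2_norm M (\<lambda>\<omega>. X \<omega> - snd (snd (Z \<omega>))) \<le> s + 3 * d"
      using L2_triangle_diff[OF X(1) x1 y2] L2_triangle_diff[OF x1 x2 y2] c2 x12 Z(3) by linarith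
    from power_mono[OF this L2_norm_nonneg, of 2]
    have near2: "(L2_norm M (\<lambda>\<omega>. X \<omega> - snd (snd (Z \<omega>))))\<^sup>2 \<le> W2sq (law M X) \<nu> + \<eta>" using d\<eta> X(2) by simp
    have "L2_norm \<rho> (\<lambda>z. snd (fst z) - snd (snd z)) = L2_norm M (\<lambda>\<omega>. snd (fst (Z \<omega>)) - snd (snd (Z \<omega>)))"
      by (rule norm_Z[symmetric]) measurable
    also have "\<dots> \<le> e" by (rule \<eta>(2)[OF y1 y2 law1 law2 near1 near2])
    finally show ?thesis using le by simp
  qed
  with t(1) show ?thesis by blast
qed

text \<open>The maps \<open>t k\<close> are all close to the second coordinate of one optimal
  \<open>\<pi>0\<close>, hence Cauchy in L^2 of \<mu>. Their limit \<open>T\<close> was not chosen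
  from a particular coupling, so every optimal coupling is carried by its graph; this gives
  existence of the map and uniqueness of the coupling at once.\<close>

lemma differentiable_imp_optimal_map:
  fixes X :: "'w \<Rightarrow> 'a::euclidean_space"
  assumes M: "prob_space M" "atomless M" and \<mu>: "\<mu> \<in> P2" and \<nu>: "\<nu> \<in> P2"
    and X: "X \<in> L2_rv M" "law M X = \<mu>"
    and diff: "frechet_differentiable_at M (L2_lift M (\<lambda>\<sigma>. W2sq \<sigma> \<nu>)) X"
  shows "\<exists>T\<in>borel_measurable borel. optimal_couplings \<mu> \<nu> = {distr \<mu> borel (\<lambda>x. (x, T x))}"
proof -
  interpret U: prob_space \<mu> by (rule P2_D[OF \<mu>])
  have "\<exists>t. t \<in> L2_rv \<mu> \<and> (\<forall>\<pi>\<in>optimal_couplings \<mu> \<nu>. L2_norm \<pi> (\<lambda>z. snd z - t (fst z)) \<le> (1/2) ^ k)" for k :: nat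
    using optimal_couplings_near_map[OF M \<mu> \<nu> X diff, of "(1/2) ^ k"] by auto
  then have "\<exists>t. \<forall>k::nat. t k \<in> L2_rv \<mu> \<and> (\<forall>\<pi>\<in>optimal_couplings \<mu> \<nu>. L2_norm \<pi> (\<lambda>z. snd z - t k (fst z)) \<le> (1/2) ^ k)"
    by (intro choice allI)
  then obtain t where t: "\<And>k::nat. t k \<in> L2_rv \<mu>"
    "\<And>k \<pi>. \<pi> \<in> optimal_couplings \<mu> \<nu> \<Longrightarrow> L2_norm \<pi> (\<lambda>z. snd z - t k (fst z)) \<le> (1/2) ^ k" by blast
  have [measurable_cong]: "sets \<mu> = sets borel" by (rule P2_D(2)[OF \<mu>])
  have tb: "t k \<in> borel_measurable borel" for k using L2_rvD[OF t(1)[of k]] by measurable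
  obtain \<pi>0 where \<pi>0: "\<pi>0 \<in> optimal_couplings \<mu> \<nu>" using optimal_coupling_exists[OF M \<mu> \<nu>] by blast
  have oc: "\<pi> \<in> couplings \<mu> \<nu>" if "\<pi> \<in> optimal_couplings \<mu> \<nu>" for \<pi> using that by (simp add: optimal_couplings_def)
  have idL2: "(\<lambda>x. x) \<in> L2_rv \<nu>" by (rule P2_D(4)[OF \<nu>])
  have "L2_norm \<mu> (\<lambda>x. t (Suc k) x - t k x) \<le> 2 * (1/2) ^ k" for k
  proof -
    note c = oc[OF \<pi>0]
    have tf: "(\<lambda>z. t k (fst z)) \<in> L2_rv \<pi>0" for k by (rule couplings_L2(1)[OF c t(1)])
    have "L2_norm \<mu> (\<lambda>x. t (Suc k) x - t k x) = L2_norm \<pi>0 (\<lambda>z. t (Suc k) (fst z) - t k (fst z))"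
      using couplings_L2_norm(1)[OF c, of "\<lambda>x. t (Suc k) x - t k x"] tb by simp
    also have "\<dots> \<le> L2_norm \<pi>0 (\<lambda>z. t (Suc k) (fst z) - snd z) + L2_norm \<pi>0 (\<lambda>z. snd z - t k (fst z))"
      by (rule L2_triangle_diff[OF tf couplings_L2(2)[OF c idL2] tf])
    also have "\<dots> \<le> 2 * (1/2) ^ k"
      using t(2)[OF \<pi>0, of "Suc k"] t(2)[OF \<pi>0, of k] power_decreasing[of k "Suc k" "1/2::real"]
      unfolding L2_norm_minus_commute[of \<pi>0 "\<lambda>z. t (Suc k) (fst z)" snd] by linarith
    finally show ?thesis .
  qed
  then obtain T where T: "T \<in> L2_rv \<mu>" "\<And>k. L2_norm \<mu> (\<lambda>x. t k x - T x) \<le> 2 * 2 * (1/2) ^ k"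
    using U.L2_geometric_limit[of t 2, OF t(1)] by blast
  have Tb [measurable]: "T \<in> borel_measurable borel" using L2_rvD[OF T(1)] by measurable
  have "\<pi> = distr \<mu> borel (\<lambda>x. (x, T x))" if opt: "\<pi> \<in> optimal_couplings \<mu> \<nu>" for \<pi>
  proof -
    note c = oc[OF opt]
    interpret prob_space \<pi> by (rule couplingsD[OF c])
    have [measurable_cong]: "sets \<pi> = sets borel" by (rule couplingsD(2)[OF c])
    have Tf: "(\<lambda>z. T (fst z)) \<in> L2_rv \<pi>" by (rule couplings_L2(1)[OF c T(1)])
    have y: "(\<lambda>z. snd z) \<in> L2_rv \<pi>" by (rule couplings_L2(2)[OF c idL2])
    \<comment> \<open>\<open>5 = 1 + 4\<close>: the distance from the second coordinate to
      \<open>t k\<close>, then from \<open>t k\<close> to its limit \<open>T\<close>.\<close>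
    have le: "L2_norm \<pi> (\<lambda>z. snd z - T (fst z)) \<le> 5 * (1/2) ^ k" for k
    proof -
      have "L2_norm \<pi> (\<lambda>z. t k (fst z) - T (fst z)) \<le> 4 * (1/2) ^ k"
        using couplings_L2_norm(1)[OF c, of "\<lambda>x. t k x - T x"] tb T(2)[of k] by simp
      then show ?thesis
        using L2_triangle_diff[OF y couplings_L2(1)[OF c t(1)[of k]] Tf] t(2)[OF opt, of k] by simp
    qed
    have "L2_norm \<pi> (\<lambda>z. snd z - T (fst z)) \<le> 0"
    proof (rule LIMSEQ_le_const)
      show "(\<lambda>k. 5 * (1/2) ^ k) \<longlonglongrightarrow> (0::real)" by (intro tendsto_mult_right_zero LIMSEQ_realpow_zero) auto
    qed (use le in blast)
    then have "L2_norm \<pi> (\<lambda>z. snd z - T (fst z)) = 0" by (simp add: order_antisym)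
    then have "AE z in \<pi>. snd z - T (fst z) = 0" using L2_norm_eq_0_iff[OF L2_rv_diff[OF y Tf]] by simp
    then have "distr \<pi> borel (\<lambda>z. z) = distr \<pi> borel (\<lambda>z. (fst z, T (fst z)))"
      by (intro distr_cong_AE) (auto simp: prod_eq_iff)
    also have "\<dots> = distr (distr \<pi> borel fst) borel (\<lambda>x. (x, T x))"
      by (subst distr_distr) (auto simp: comp_def)
    finally show ?thesis using couplingsD[OF c] distr_id2[of borel \<pi>] by simp
  qed
  then have "optimal_couplings \<mu> \<nu> = {distr \<mu> borel (\<lambda>x. (x, T x))}" using \<pi>0 by blast
  with Tb show ?thesis by blast
qed

section \<open>Kantorovich duality\<close>

lemma compact_fun_box: "compact {p :: 'i \<Rightarrow> real. \<forall>z. 0 \<le> p z \<and> p z \<le> 1}"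
proof -
  have "{p :: 'i \<Rightarrow> real. \<forall>z. 0 \<le> p z \<and> p z \<le> 1} = PiE UNIV (\<lambda>_. {0..1})"
    by (auto simp: PiE_iff)
  then show ?thesis
    using compactin_PiE[of "\<lambda>_::'i. euclidean :: real topology" UNIV "\<lambda>_. {0..1}"]
    by (simp add: euclidean_product_topology)
qed

lemma sum_delta_mult:
  fixes f :: "'a \<Rightarrow> real"
  assumes "finite A" "a \<in> A"
  shows "(\<Sum>x\<in>A. (if x = a then 1 else 0) * f x) = f a"
proof -
  have "(\<Sum>x\<in>A. (if x = a then 1 else 0) * f x) = (\<Sum>x\<in>A. if x = a then f x else 0)"
    by (intro sum.cong) auto
  then show ?thesis using assms by simp
qed

lemma sqrt_concave:
  fixes x y t :: real
  assumes "0 \<le> x" "0 \<le> y" "0 \<le> t" "t \<le> 1"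
  shows "(1 - t) * sqrt x + t * sqrt y \<le> sqrt ((1 - t) * x + t * y)"
proof -
  obtain a b where ab: "x = a\<^sup>2" "y = b\<^sup>2" "0 \<le> a" "0 \<le> b"
    using assms(1,2) by (metis real_sqrt_ge_zero real_sqrt_pow2)
  have "((1 - t) * a + t * b)\<^sup>2 = (1 - t) * a\<^sup>2 + t * b\<^sup>2 - t * (1 - t) * (a - b)\<^sup>2"
    by (simp add: power2_eq_square algebra_simps)
  also have "\<dots> \<le> (1 - t) * a\<^sup>2 + t * b\<^sup>2" using assms by simp
  finally have "(1 - t) * a + t * b \<le> sqrt ((1 - t) * a\<^sup>2 + t * b\<^sup>2)" by (rule real_le_rsqrt)
  then show ?thesis using ab by simp
qed

text \<open>
  The cost is penalised by \<open>-2 \<epsilon> sqrt p\<close>, whose infinite slope at \<open>0\<close> keeps the minimiser \<open>p\<close> away from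
  the boundary. Stationarity then says that \<open>C i j - \<epsilon> / sqrt (p i j)\<close> splits as \<open>\<psi> i + \<phi> j\<close>.
\<close>
lemma finite_transport_duality_pos:
  fixes C :: "'i \<Rightarrow> 'j \<Rightarrow> real"
  assumes fin: "finite I" "finite J" and ne: "I \<noteq> {}" "J \<noteq> {}"
    and m: "\<And>i. i \<in> I \<Longrightarrow> 0 < m i" "sum m I = 1" and n: "\<And>j. j \<in> J \<Longrightarrow> 0 < n j" "sum n J = 1"
    and "0 < e"
  obtains p \<psi> \<phi> where "\<And>i j. 0 \<le> p i j" "\<And>i j. i \<notin> I \<or> j \<notin> J \<Longrightarrow> p i j = 0"
    "\<And>i. i \<in> I \<Longrightarrow> (\<Sum>j\<in>J. p i j) = m i" "\<And>j. j \<in> J \<Longrightarrow> (\<Sum>i\<in>I. p i j) = n j"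
    "\<And>i j. i \<in> I \<Longrightarrow> j \<in> J \<Longrightarrow> \<psi> i + \<phi> j \<le> C i j"
    "(\<Sum>i\<in>I. \<Sum>j\<in>J. p i j * C i j) \<le> (\<Sum>i\<in>I. \<psi> i * m i) + (\<Sum>j\<in>J. \<phi> j * n j) + e"
proof -
  let ?Z = "I \<times> J"
  have finZ: "finite ?Z" and neZ: "?Z \<noteq> {}" using fin ne by auto
  \<comment> \<open>Entries of a plan are at most \<open>1\<close>, so the sum of
    \<open>\<epsilon> * sqrt (p z)\<close> over all cells, which is the final duality gap, is at
    most \<open>e\<close>.\<close>
  define \<epsilon> where "\<epsilon> = e / real (card ?Z)"
  have cardZ: "0 < card ?Z" using finZ neZ card_gt_0_iff by blast
  have \<epsilon>: "0 < \<epsilon>" using \<open>0 < e\<close> cardZ by (simp add: \<epsilon>_def)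
  \<comment> \<open>Plans are functions on the whole index type that vanish off the finite grid, so
    that Tychonoff's theorem for the cube applies.\<close>
  define K where "K = {p :: 'i \<times> 'j \<Rightarrow> real. (\<forall>z. 0 \<le> p z \<and> p z \<le> 1) \<and> (\<forall>z. z \<notin> ?Z \<longrightarrow> p z = 0) \<and>
    (\<forall>i\<in>I. (\<Sum>j\<in>J. p (i, j)) = m i) \<and> (\<forall>j\<in>J. (\<Sum>i\<in>I. p (i, j)) = n j)}"
  have K_intro: "p \<in> K" if nonneg: "\<And>z. z \<in> ?Z \<Longrightarrow> 0 \<le> p z" and zero: "\<And>z. z \<notin> ?Z \<Longrightarrow> p z = 0"
      and rows: "\<And>i. i \<in> I \<Longrightarrow> (\<Sum>j\<in>J. p (i, j)) = m i"
      and cols: "\<And>j. j \<in> J \<Longrightarrow> (\<Sum>i\<in>I. p (i, j)) = n j" for p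
  proof -
    have le1: "p (i, j) \<le> 1" if ij: "i \<in> I" "j \<in> J" for i j
    proof -
      have "p (i, j) \<le> (\<Sum>j\<in>J. p (i, j))"
        using fin ij nonneg by (intro member_le_sum[of j J "\<lambda>j. p (i, j)"]) auto
      also have "\<dots> \<le> sum m I"
        unfolding rows[OF ij(1)] using fin ij m(1) by (intro member_le_sum) (auto intro: less_imp_le)
      finally show ?thesis using m(2) by simp
    qed
    have "0 \<le> p z \<and> p z \<le> 1" for z
    proof (cases "z \<in> ?Z")
      case True
      then show ?thesis using nonneg[OF True] le1[of "fst z" "snd z"] by auto
    qed (simp add: zero)
    then show ?thesis using zero rows cols by (simp add: K_def)
  qed
  have "compact K"
  proof -
    have KE: "K = {p. \<forall>z. 0 \<le> p z \<and> p z \<le> 1} \<inter> ({p. \<forall>z. z \<notin> ?Z \<longrightarrow> p z = 0} \<inter>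
      ((\<Inter>i\<in>I. {p. (\<Sum>j\<in>J. p (i, j)) = m i}) \<inter> (\<Inter>j\<in>J. {p. (\<Sum>i\<in>I. p (i, j)) = n j})))"
      by (auto simp: K_def)
    have cl: "closed ({p :: 'i \<times> 'j \<Rightarrow> real. \<forall>z. z \<notin> ?Z \<longrightarrow> p z = 0} \<inter>
      ((\<Inter>i\<in>I. {p. (\<Sum>j\<in>J. p (i, j)) = m i}) \<inter> (\<Inter>j\<in>J. {p. (\<Sum>i\<in>I. p (i, j)) = n j})))"
      by (intro closed_Int closed_INT ballI closed_Collect_all closed_Collect_imp open_Collect_const
          closed_Collect_eq continuous_intros continuous_on_product_coordinates)
    show ?thesis unfolding KE by (rule compact_Int_closed[OF compact_fun_box cl])
  qed
  define f where "f p = (\<Sum>z\<in>?Z. p z * C (fst z) (snd z) - 2 * \<epsilon> * sqrt (p z))" for p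
  have "continuous_on K f" unfolding f_def
    by (intro continuous_intros continuous_on_subset[OF continuous_on_product_coordinates subset_UNIV])
  \<comment> \<open>The independent plan: an admissible point with all entries positive, towards
    which a minimiser with a zero entry can be moved.\<close>
  define q where "q z = (if z \<in> ?Z then m (fst z) * n (snd z) else 0)" for z
  have qm: "(\<Sum>j\<in>J. q (i, j)) = m i" if "i \<in> I" for i
  proof -
    have "(\<Sum>j\<in>J. q (i, j)) = (\<Sum>j\<in>J. m i * n j)" using that by (intro sum.cong) (auto simp: q_def)
    then show ?thesis using n(2) by (simp flip: sum_distrib_left)
  qed
  have qn: "(\<Sum>i\<in>I. q (i, j)) = n j" if "j \<in> J" for j
  proof -
    have "(\<Sum>i\<in>I. q (i, j)) = (\<Sum>i\<in>I. m i * n j)" using that by (intro sum.cong) (auto simp: q_def)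
    then show ?thesis using m(2) by (simp flip: sum_distrib_right)
  qed
  have q0: "0 < q z" if "z \<in> ?Z" for z using that m n by (auto simp: q_def)
  have q: "q \<in> K" using q0 qm qn by (intro K_intro) (auto simp: q_def less_imp_le)
  obtain p where p: "p \<in> K" "\<And>p'. p' \<in> K \<Longrightarrow> f p \<le> f p'"
    using continuous_attains_inf[OF \<open>compact K\<close> _ \<open>continuous_on K f\<close>] q by blast
  have pnn: "0 \<le> p z" and pz: "z \<notin> ?Z \<Longrightarrow> p z = 0" for z
    using p(1) unfolding K_def by blast+
  have pm: "i \<in> I \<Longrightarrow> (\<Sum>j\<in>J. p (i, j)) = m i" and pn: "j \<in> J \<Longrightarrow> (\<Sum>i\<in>I. p (i, j)) = n j" for i j
    using p(1) by (auto simp: K_def)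
  have ppos: "0 < p z0" if z0: "z0 \<in> ?Z" for z0
  proof (rule ccontr)
    assume "\<not> 0 < p z0"
    then have p0: "p z0 = 0" using pnn[of z0] by simp
    define B where "B = 2 * \<epsilon> * sqrt (q z0)"
    have "0 < B" using \<epsilon> q0[OF z0] by (simp add: B_def)
    have le: "f p \<le> f q" using p(2) q .
    define D where "D = f q - f p"
    have "0 \<le> D" using le by (simp add: D_def)
    \<comment> \<open>Moving a fraction \<open>t = \<tau>\<^sup>2\<close> towards \<open>q\<close>
      costs at most \<open>t * (B + D)\<close>, while the square root at \<open>z0\<close> gains
      \<open>\<tau> * B\<close>. This \<open>\<tau>\<close> makes the cost half of the gain.\<close>
    define \<tau> where "\<tau> = B / (2 * (B + D))"
    have \<tau>: "0 < \<tau>" "\<tau> < 1" "\<tau> * (B + D) = B / 2"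
      using \<open>0 < B\<close> \<open>0 \<le> D\<close> by (simp_all add: \<tau>_def field_simps)
    define t where "t = \<tau>\<^sup>2"
    have t: "0 < t" "t < 1" "sqrt t = \<tau>"
      using \<tau> by (auto simp: t_def power_less_one_iff abs_square_less_1)
    define r where "r z = (1 - t) * p z + t * q z" for z
    have r: "r \<in> K"
    proof (rule K_intro)
      show "(\<Sum>j\<in>J. r (i, j)) = m i" if "i \<in> I" for i
      proof -
        have "(\<Sum>j\<in>J. r (i, j)) = (1 - t) * m i + t * m i"
          unfolding r_def sum.distrib sum_distrib_left[symmetric] using pm[OF that] qm[OF that] by simp
        then show ?thesis by (simp add: algebra_simps)
      qed
      show "(\<Sum>i\<in>I. r (i, j)) = n j" if "j \<in> J" for j
      proof -
        have "(\<Sum>i\<in>I. r (i, j)) = (1 - t) * n j + t * n j"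
          unfolding r_def sum.distrib sum_distrib_left[symmetric] using pn[OF that] qn[OF that] by simp
        then show ?thesis by (simp add: algebra_simps)
      qed
      show "0 \<le> r z" if "z \<in> ?Z" for z
        unfolding r_def using t pnn less_imp_le[OF q0[OF that]]
        by (intro add_nonneg_nonneg mult_nonneg_nonneg) auto
      show "r z = 0" if "z \<notin> ?Z" for z using that by (simp add: r_def pz q_def del: mem_Sigma_iff)
    qed
    have conc: "(1 - t) * sqrt (p z) + t * sqrt (q z) \<le> sqrt (r z)" if "z \<in> ?Z" for z
      unfolding r_def using pnn[of z] q0[OF that] t by (intro sqrt_concave) auto
    let ?g = "\<lambda>p z. p z * C (fst z) (snd z) - 2 * \<epsilon> * sqrt (p z)"
    have "f r \<le> (\<Sum>z\<in>?Z. (1 - t) * ?g p z + t * ?g q z + (if z = z0 then (t - \<tau>) * B else 0))"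
      unfolding f_def
    proof (rule sum_mono)
      fix z assume z: "z \<in> ?Z"
      have "2 * \<epsilon> * ((1 - t) * sqrt (p z) + t * sqrt (q z)) + (if z = z0 then (\<tau> - t) * B else 0) \<le> 2 * \<epsilon> * sqrt (r z)"
      proof (cases "z = z0")
        case True
        have "sqrt (r z) = \<tau> * sqrt (q z)" using p0 True by (simp add: r_def real_sqrt_mult t)
        then show ?thesis using p0 True by (simp add: B_def algebra_simps)
      next
        case False
        then show ?thesis using mult_left_mono[OF conc[OF z], of "2 * \<epsilon>"] \<epsilon> by simp
      qed
      then show "?g r z \<le> (1 - t) * ?g p z + t * ?g q z + (if z = z0 then (t - \<tau>) * B else 0)"
        by (cases "z = z0") (simp_all add: r_def algebra_simps)
    qed
    also have "\<dots> = (1 - t) * f p + t * f q + (t - \<tau>) * B"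
      using z0 finZ by (simp add: sum.distrib f_def flip: sum_distrib_left)
    finally have "f p \<le> (1 - t) * f p + t * f q + (t - \<tau>) * B" using p(2)[OF r] by simp
    then have "\<tau> * B \<le> t * (B + D)" by (simp add: D_def algebra_simps)
    also have "\<dots> = \<tau> * (B / 2)" unfolding t_def power2_eq_square mult.assoc \<tau>(3) ..
    finally show False using \<tau>(1) \<open>0 < B\<close> by simp
  qed
  define D where "D i j = C i j - \<epsilon> / sqrt (p (i, j))" for i j
  \<comment> \<open>First-order condition: \<open>r\<close> has zero row and column sums, so small
    multiples of either sign keep \<open>p\<close> admissible, and the bound \<open>1\<close> on
    \<open>r\<close> makes every step below the least entry \<open>d\<close> small enough.\<close>
  have stat: "(\<Sum>z\<in>?Z. r z * D (fst z) (snd z)) = 0"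
    if r: "\<And>z. \<bar>r z\<bar> \<le> 1" "\<And>z. z \<notin> ?Z \<Longrightarrow> r z = 0" "\<And>i. i \<in> I \<Longrightarrow> (\<Sum>j\<in>J. r (i, j)) = 0"
      "\<And>j. j \<in> J \<Longrightarrow> (\<Sum>i\<in>I. r (i, j)) = 0" for r
  proof -
    define g where "g t = f (\<lambda>z. p z + t * r z)" for t
    define d where "d = Min (p ` ?Z)"
    have d: "0 < d" "\<And>z. z \<in> ?Z \<Longrightarrow> d \<le> p z" using finZ neZ ppos by (auto simp: d_def)
    have "DERIV g 0 :> (\<Sum>z\<in>?Z. r z * C (fst z) (snd z) - 2 * \<epsilon> * (r z * (inverse (sqrt (p z)) / 2)))"
      unfolding g_def f_def
    proof (rule DERIV_sum)
      fix z assume "z \<in> ?Z"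
      then have "0 < p z" by (rule ppos)
      then show "((\<lambda>t. (p z + t * r z) * C (fst z) (snd z) - 2 * \<epsilon> * sqrt (p z + t * r z)) has_field_derivative
          r z * C (fst z) (snd z) - 2 * \<epsilon> * (r z * (inverse (sqrt (p z)) / 2))) (at 0)"
        by (auto intro!: derivative_eq_intros)
    qed
    moreover have "\<forall>t. \<bar>0 - t\<bar> < d \<longrightarrow> g 0 \<le> g t"
    proof (intro allI impI)
      fix t assume t: "\<bar>0 - t\<bar> < d"
      have "(\<lambda>z. p z + t * r z) \<in> K"
      proof (rule K_intro)
        fix z assume z: "z \<in> ?Z"
        have "\<bar>t * r z\<bar> \<le> \<bar>t\<bar> * 1" unfolding abs_mult using r(1) by (intro mult_left_mono) auto
        then show "0 \<le> p z + t * r z" using t d(2)[OF z] by linarith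
      next
        fix z assume "z \<notin> ?Z" then show "p z + t * r z = 0" using pz r(2) by simp
      next
        fix i assume "i \<in> I" then show "(\<Sum>j\<in>J. p (i, j) + t * r (i, j)) = m i"
          using pm r(3) by (simp add: sum.distrib flip: sum_distrib_left)
      next
        fix j assume "j \<in> J" then show "(\<Sum>i\<in>I. p (i, j) + t * r (i, j)) = n j"
          using pn r(4) by (simp add: sum.distrib flip: sum_distrib_left)
      qed
      from p(2)[OF this] show "g 0 \<le> g t" by (simp add: g_def)
    qed
    ultimately have "(\<Sum>z\<in>?Z. r z * C (fst z) (snd z) - 2 * \<epsilon> * (r z * (inverse (sqrt (p z)) / 2))) = 0"
      using d(1) by (rule_tac DERIV_local_min)
    moreover have "r z * D (fst z) (snd z) = r z * C (fst z) (snd z) - 2 * \<epsilon> * (r z * (inverse (sqrt (p z)) / 2))" for z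
      by (simp add: D_def right_diff_distrib inverse_eq_divide)
    ultimately show ?thesis by simp
  qed
  obtain i0 j0 where i0: "i0 \<in> I" and j0: "j0 \<in> J" using ne by blast
  \<comment> \<open>Potentials are read off a reference row and column; subtracting the corner
    \<open>D i0 j0\<close> avoids counting it twice.\<close>
  define \<psi> where "\<psi> i = D i j0" for i
  define \<phi> where "\<phi> j = D i0 j - D i0 j0" for j
  have split: "D i j = \<psi> i + \<phi> j" if ij: "i \<in> I" "j \<in> J" for i j
  proof -
    \<comment> \<open>\<open>u a * v b\<close> moves mass around the rectangle with corners
      \<open>(i, j)\<close>, \<open>(i, j0)\<close>, \<open>(i0, j0)\<close>, \<open>(i0, j)\<close>
      with alternating signs; stationarity then says that the mixed difference of \<open>D\<close>
      vanishes.\<close>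
    define u where "u a = (if a = i then 1 else 0) - (if a = i0 then 1 else (0::real))" for a
    define v where "v b = (if b = j then 1 else 0) - (if b = j0 then 1 else (0::real))" for b
    have uI: "(\<Sum>a\<in>I. u a * h a) = h i - h i0" for h :: "'i \<Rightarrow> real"
      using sum_delta_mult[OF fin(1) ij(1), of h] sum_delta_mult[OF fin(1) i0, of h]
      by (simp add: u_def left_diff_distrib sum_subtractf)
    have vJ: "(\<Sum>b\<in>J. v b * h b) = h j - h j0" for h :: "'j \<Rightarrow> real"
      using sum_delta_mult[OF fin(2) ij(2), of h] sum_delta_mult[OF fin(2) j0, of h]
      by (simp add: v_def left_diff_distrib sum_subtractf)
    have "(\<Sum>z\<in>?Z. (u (fst z) * v (snd z)) * D (fst z) (snd z)) = 0"
    proof (rule stat)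
      show "\<bar>u (fst z) * v (snd z)\<bar> \<le> 1" for z by (auto simp: u_def v_def)
      show "u (fst z) * v (snd z) = 0" if "z \<notin> ?Z" for z
        using that ij i0 j0 by (auto simp: u_def v_def mem_Times_iff)
      show "(\<Sum>j\<in>J. u (fst (a, j)) * v (snd (a, j))) = 0" for a
        using vJ[of "\<lambda>_. u a"] by (simp add: mult.commute)
      show "(\<Sum>i\<in>I. u (fst (i, b)) * v (snd (i, b))) = 0" for b
        using uI[of "\<lambda>_. v b"] by simp
    qed
    moreover have "(\<Sum>z\<in>?Z. (u (fst z) * v (snd z)) * D (fst z) (snd z)) = (\<Sum>a\<in>I. u a * (\<Sum>b\<in>J. v b * D a b))"
      by (simp add: sum.cartesian_product case_prod_unfold sum_distrib_left mult.assoc)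
    ultimately have "(D i j - D i j0) - (D i0 j - D i0 j0) = 0" unfolding uI vJ by simp
    then show ?thesis by (simp add: \<psi>_def \<phi>_def)
  qed
  show ?thesis
  proof
    show "0 \<le> p (i, j)" for i j by (rule pnn)
    show "p (i, j) = 0" if "i \<notin> I \<or> j \<notin> J" for i j using that by (intro pz) auto
    show "(\<Sum>j\<in>J. p (i, j)) = m i" if "i \<in> I" for i using that by (rule pm)
    show "(\<Sum>i\<in>I. p (i, j)) = n j" if "j \<in> J" for j using that by (rule pn)
    show "\<psi> i + \<phi> j \<le> C i j" if "i \<in> I" "j \<in> J" for i j
    proof -
      have "0 \<le> \<epsilon> / sqrt (p (i, j))" using \<epsilon> pnn[of "(i, j)"] by simp
      then show ?thesis using split[OF that] unfolding D_def by linarith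
    qed
    have "(\<Sum>i\<in>I. \<psi> i * m i) + (\<Sum>j\<in>J. \<phi> j * n j) =
        (\<Sum>i\<in>I. \<Sum>j\<in>J. \<psi> i * p (i, j)) + (\<Sum>j\<in>J. \<Sum>i\<in>I. \<phi> j * p (i, j))"
      using pm pn by (simp flip: sum_distrib_left)
    also have "(\<Sum>j\<in>J. \<Sum>i\<in>I. \<phi> j * p (i, j)) = (\<Sum>i\<in>I. \<Sum>j\<in>J. \<phi> j * p (i, j))" by (rule sum.swap)
    also have "(\<Sum>i\<in>I. \<Sum>j\<in>J. \<psi> i * p (i, j)) + (\<Sum>i\<in>I. \<Sum>j\<in>J. \<phi> j * p (i, j)) =
        (\<Sum>i\<in>I. \<Sum>j\<in>J. p (i, j) * C i j - \<epsilon> * sqrt (p (i, j)))"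
      unfolding sum.distrib[symmetric]
    proof (intro sum.cong refl)
      fix i j assume ij: "i \<in> I" "j \<in> J"
      have "0 < p (i, j)" using ij by (intro ppos) auto
      then have *: "p (i, j) / sqrt (p (i, j)) = sqrt (p (i, j))" by (simp add: real_div_sqrt)
      have "\<psi> i * p (i, j) + \<phi> j * p (i, j) = p (i, j) * D i j"
        unfolding split[OF ij] by (simp add: algebra_simps)
      also have "\<dots> = p (i, j) * C i j - \<epsilon> * (p (i, j) / sqrt (p (i, j)))"
        unfolding D_def by (simp add: right_diff_distrib)
      finally show "\<psi> i * p (i, j) + \<phi> j * p (i, j) = p (i, j) * C i j - \<epsilon> * sqrt (p (i, j))"
        unfolding * .
    qed
    also have "\<dots> = (\<Sum>i\<in>I. \<Sum>j\<in>J. p (i, j) * C i j) - (\<Sum>i\<in>I. \<Sum>j\<in>J. \<epsilon> * sqrt (p (i, j)))"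
      by (simp add: sum_subtractf)
    finally have *: "(\<Sum>i\<in>I. \<psi> i * m i) + (\<Sum>j\<in>J. \<phi> j * n j) =
      (\<Sum>i\<in>I. \<Sum>j\<in>J. p (i, j) * C i j) - (\<Sum>i\<in>I. \<Sum>j\<in>J. \<epsilon> * sqrt (p (i, j)))" .
    have "(\<Sum>i\<in>I. \<Sum>j\<in>J. \<epsilon> * sqrt (p (i, j))) \<le> (\<Sum>i\<in>I. \<Sum>j\<in>J. \<epsilon> * 1)"
      using \<epsilon> p(1) by (intro sum_mono mult_left_mono) (auto simp: K_def)
    also have "\<dots> = e" using cardZ by (simp add: \<epsilon>_def card_cartesian_product)
    finally show "(\<Sum>i\<in>I. \<Sum>j\<in>J. p (i, j) * C i j) \<le> (\<Sum>i\<in>I. \<psi> i * m i) + (\<Sum>j\<in>J. \<phi> j * n j) + e"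
      using * by linarith
  qed
qed

text \<open>Rows and columns of mass \<open>0\<close> are removed before solving. On them the
  potentials are set to \<open>-B\<close>, with \<open>B\<close> above all the others: admissible
  because \<open>C\<close> is nonnegative, and without effect on the dual value.\<close>

lemma finite_transport_duality:
  fixes C :: "'i \<Rightarrow> 'j \<Rightarrow> real"
  assumes fin: "finite I" "finite J"
    and m: "\<And>i. i \<in> I \<Longrightarrow> 0 \<le> m i" "sum m I = 1" and n: "\<And>j. j \<in> J \<Longrightarrow> 0 \<le> n j" "sum n J = 1"
    and C: "\<And>i j. 0 \<le> C i j" and "0 < e"
  obtains p \<psi> \<phi> where "\<And>i j. 0 \<le> p i j"
    "\<And>i. i \<in> I \<Longrightarrow> (\<Sum>j\<in>J. p i j) = m i" "\<And>j. j \<in> J \<Longrightarrow> (\<Sum>i\<in>I. p i j) = n j"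
    "\<And>i j. i \<in> I \<Longrightarrow> j \<in> J \<Longrightarrow> \<psi> i + \<phi> j \<le> C i j"
    "(\<Sum>i\<in>I. \<Sum>j\<in>J. p i j * C i j) \<le> (\<Sum>i\<in>I. \<psi> i * m i) + (\<Sum>j\<in>J. \<phi> j * n j) + e"
proof -
  define I' where "I' = {i \<in> I. m i \<noteq> 0}"
  define J' where "J' = {j \<in> J. n j \<noteq> 0}"
  have sub: "I' \<subseteq> I" "J' \<subseteq> J" by (auto simp: I'_def J'_def)
  have fin': "finite I'" "finite J'" using fin sub finite_subset by blast+
  have restrict: "(\<Sum>i\<in>I'. h i) = (\<Sum>i\<in>I. h i)" if "\<And>i. i \<in> I \<Longrightarrow> m i = 0 \<Longrightarrow> h i = 0" for h :: "'i \<Rightarrow> real"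
    using that fin(1) by (intro sum.mono_neutral_left) (auto simp: I'_def)
  have restrict2: "(\<Sum>j\<in>J'. h j) = (\<Sum>j\<in>J. h j)" if "\<And>j. j \<in> J \<Longrightarrow> n j = 0 \<Longrightarrow> h j = 0" for h :: "'j \<Rightarrow> real"
    using that fin(2) by (intro sum.mono_neutral_left) (auto simp: J'_def)
  have s1: "sum m I' = 1" "sum n J' = 1" using restrict[of m] restrict2[of n] m n by auto
  then have ne: "I' \<noteq> {}" "J' \<noteq> {}" by auto
  have pos: "\<And>i. i \<in> I' \<Longrightarrow> 0 < m i" "\<And>j. j \<in> J' \<Longrightarrow> 0 < n j"
    using m(1) n(1) by (force simp: I'_def J'_def)+
  obtain p \<psi> \<phi> where p: "\<And>i j. 0 \<le> p i j" "\<And>i j. i \<notin> I' \<or> j \<notin> J' \<Longrightarrow> p i j = 0"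
    "\<And>i. i \<in> I' \<Longrightarrow> (\<Sum>j\<in>J'. p i j) = m i" "\<And>j. j \<in> J' \<Longrightarrow> (\<Sum>i\<in>I'. p i j) = n j"
    and dual: "\<And>i j. i \<in> I' \<Longrightarrow> j \<in> J' \<Longrightarrow> \<psi> i + \<phi> j \<le> C i j"
    and gap: "(\<Sum>i\<in>I'. \<Sum>j\<in>J'. p i j * C i j) \<le> (\<Sum>i\<in>I'. \<psi> i * m i) + (\<Sum>j\<in>J'. \<phi> j * n j) + e"
    by (rule finite_transport_duality_pos[of I' J' m n e C, OF fin' ne pos(1) s1(1) pos(2) s1(2) \<open>0 < e\<close>])
       (assumption, assumption, rule that)
  have pI: "p i j = 0" if "i \<in> I" "m i = 0" for i j using that by (intro p(2)) (auto simp: I'_def)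
  have pJ: "p i j = 0" if "j \<in> J" "n j = 0" for i j using that by (intro p(2)) (auto simp: J'_def)
  define B where "B = (\<Sum>i\<in>I'. \<bar>\<psi> i\<bar>) + (\<Sum>j\<in>J'. \<bar>\<phi> j\<bar>)"
  have "0 \<le> B" by (simp add: B_def sum_nonneg)
  have B\<psi>: "\<psi> i \<le> B" if "i \<in> I'" for i
  proof -
    have "\<bar>\<psi> i\<bar> \<le> (\<Sum>i\<in>I'. \<bar>\<psi> i\<bar>)" using fin' that by (intro member_le_sum) auto
    moreover have "0 \<le> (\<Sum>j\<in>J'. \<bar>\<phi> j\<bar>)" by (simp add: sum_nonneg)
    ultimately show ?thesis unfolding B_def by linarith
  qed
  have B\<phi>: "\<phi> j \<le> B" if "j \<in> J'" for j
  proof -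
    have "\<bar>\<phi> j\<bar> \<le> (\<Sum>j\<in>J'. \<bar>\<phi> j\<bar>)" using fin' that by (intro member_le_sum[of j J' "\<lambda>j. \<bar>\<phi> j\<bar>"]) auto
    moreover have "0 \<le> (\<Sum>i\<in>I'. \<bar>\<psi> i\<bar>)" by (simp add: sum_nonneg)
    ultimately show ?thesis unfolding B_def by linarith
  qed
  define \<psi>' where "\<psi>' i = (if i \<in> I' then \<psi> i else - B)" for i
  define \<phi>' where "\<phi>' j = (if j \<in> J' then \<phi> j else - B)" for j
  show ?thesis
  proof
    show "0 \<le> p i j" for i j by (rule p(1))
    show "(\<Sum>j\<in>J. p i j) = m i" if "i \<in> I" for i
    proof (cases "i \<in> I'")
      case True
      then show ?thesis using p(3)[OF True] restrict2[of "p i"] pJ by simp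
    next
      case False
      then have "m i = 0" using that by (simp add: I'_def)
      then show ?thesis using pI[OF that] by simp
    qed
    show "(\<Sum>i\<in>I. p i j) = n j" if "j \<in> J" for j
    proof (cases "j \<in> J'")
      case True
      then show ?thesis using p(4)[OF True] restrict[of "\<lambda>i. p i j"] pI by simp
    next
      case False
      then have "n j = 0" using that by (simp add: J'_def)
      then show ?thesis using pJ[OF that] by simp
    qed
    show "\<psi>' i + \<phi>' j \<le> C i j" for i j
      using dual[of i j] B\<psi>[of i] B\<phi>[of j] C[of i j] \<open>0 \<le> B\<close>
      by (cases "i \<in> I'"; cases "j \<in> J'") (auto simp: \<psi>'_def \<phi>'_def)
    have "(\<Sum>i\<in>I. \<Sum>j\<in>J. p i j * C i j) = (\<Sum>i\<in>I'. \<Sum>j\<in>J'. p i j * C i j)"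
      using pI pJ by (subst restrict, simp, intro sum.cong refl restrict2[symmetric]) simp
    moreover have "(\<Sum>i\<in>I. \<psi>' i * m i) = (\<Sum>i\<in>I'. \<psi> i * m i)"
      by (subst restrict[symmetric]) (auto simp: \<psi>'_def)
    moreover have "(\<Sum>j\<in>J. \<phi>' j * n j) = (\<Sum>j\<in>J'. \<phi> j * n j)"
      by (subst restrict2[symmetric]) (auto simp: \<phi>'_def)
    ultimately show "(\<Sum>i\<in>I. \<Sum>j\<in>J. p i j * C i j) \<le> (\<Sum>i\<in>I. \<psi>' i * m i) + (\<Sum>j\<in>J. \<phi>' j * n j) + e"
      using gap by simp
  qed
qed

section \<open>From finite to general transport problems\<close>

lemma couplings_integral_sum:
  fixes \<psi> \<phi> :: "'a::euclidean_space \<Rightarrow> real"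
  assumes \<pi>: "\<pi> \<in> couplings \<mu> \<nu>" and "integrable \<mu> \<psi>" "integrable \<nu> \<phi>"
  shows "integrable \<pi> (\<lambda>z. \<psi> (fst z) + \<phi> (snd z))"
    "(\<integral>z. \<psi> (fst z) + \<phi> (snd z) \<partial>\<pi>) = (\<integral>x. \<psi> x \<partial>\<mu>) + (\<integral>y. \<phi> y \<partial>\<nu>)"
proof -
  note d = couplingsD(4,5)[OF \<pi>] and m = couplings_fst_measurable[OF \<pi>]
  have \<psi>: "\<psi> \<in> borel_measurable borel" and \<phi>: "\<phi> \<in> borel_measurable borel"
    using borel_measurable_integrable[OF assms(2)] borel_measurable_integrable[OF assms(3)]
    unfolding d[symmetric] by simp_all
  have i1: "integrable \<pi> (\<lambda>z. \<psi> (fst z))" and e1: "(\<integral>z. \<psi> (fst z) \<partial>\<pi>) = (\<integral>x. \<psi> x \<partial>\<mu>)"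
    using assms(2) integrable_distr_eq[OF m(1) \<psi>] integral_distr[OF m(1) \<psi>] unfolding d by simp_all
  have i2: "integrable \<pi> (\<lambda>z. \<phi> (snd z))" and e2: "(\<integral>z. \<phi> (snd z) \<partial>\<pi>) = (\<integral>x. \<phi> x \<partial>\<nu>)"
    using assms(3) integrable_distr_eq[OF m(2) \<phi>] integral_distr[OF m(2) \<phi>] unfolding d by simp_all
  show "integrable \<pi> (\<lambda>z. \<psi> (fst z) + \<phi> (snd z))" using i1 i2 by simp
  show "(\<integral>z. \<psi> (fst z) + \<phi> (snd z) \<partial>\<pi>) = (\<integral>x. \<psi> x \<partial>\<mu>) + (\<integral>y. \<phi> y \<partial>\<nu>)" using i1 i2 e1 e2 by simp
qed

text \<open>
  The error splits into a function of \<open>x\<close> and one of \<open>y\<close>: subtracting them from dual potentials that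
  are constant on cells gives potentials admissible for the original cost.
\<close>
lemma norm_sq_approx_le:
  fixes x y a b :: "'a::real_inner"
  assumes "0 < \<epsilon>"
  shows "(norm (a - b))\<^sup>2 \<le> (norm (x - y))\<^sup>2 + (2 * \<epsilon> * (norm x)\<^sup>2 + (2 / \<epsilon> + 2) * (norm (a - x))\<^sup>2)
    + (2 * \<epsilon> * (norm y)\<^sup>2 + (2 / \<epsilon> + 2) * (norm (b - y))\<^sup>2)"
proof -
  define s where "s = norm (x - y)"
  define t where "t = norm ((a - x) - (b - y))"
  have "a - b = (x - y) + ((a - x) - (b - y))" by simp
  then have "norm (a - b) \<le> s + t" unfolding s_def t_def by (metis norm_triangle_ineq)
  then have "(norm (a - b))\<^sup>2 \<le> (s + t)\<^sup>2" by (rule power_mono) simp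
  also have "\<dots> \<le> s\<^sup>2 + \<epsilon> * s\<^sup>2 + (1 / \<epsilon> + 1) * t\<^sup>2"
  proof -
    \<comment> \<open>Young's inequality for the mixed term \<open>2 * (s * t)\<close>, with a small
      weight on \<open>s\<close> and a large one on the cell error \<open>t\<close>.\<close>
    have "0 \<le> (\<epsilon> * s - t)\<^sup>2 / \<epsilon>" using assms by simp
    also have "(\<epsilon> * s - t)\<^sup>2 / \<epsilon> = \<epsilon> * s\<^sup>2 - 2 * (s * t) + t\<^sup>2 / \<epsilon>"
      using assms by (simp add: power2_eq_square field_simps)
    finally show ?thesis by (simp add: power2_sum algebra_simps)
  qed
  also have "\<dots> \<le> s\<^sup>2 + \<epsilon> * (2 * (norm x)\<^sup>2 + 2 * (norm y)\<^sup>2) +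
      (1 / \<epsilon> + 1) * (2 * (norm (a - x))\<^sup>2 + 2 * (norm (b - y))\<^sup>2)"
    unfolding s_def t_def using assms
    by (intro add_mono mult_left_mono norm_diff_sq_le order_refl) auto
  also have "\<dots> = s\<^sup>2 + (2 * \<epsilon> * (norm x)\<^sup>2 + (2 / \<epsilon> + 2) * (norm (a - x))\<^sup>2)
    + (2 * \<epsilon> * (norm y)\<^sup>2 + (2 / \<epsilon> + 2) * (norm (b - y))\<^sup>2)"
    by (simp add: algebra_simps)
  finally show ?thesis by (simp add: s_def)
qed

text \<open>The large weight \<open>2 / \<epsilon>\<close> meets a squared error of order
  \<open>\<epsilon>\<^sup>2\<close>, so the whole correction is of order
  \<open>\<epsilon>\<close>.\<close>

lemma cell_error_integral:
  fixes c :: "'a::euclidean_space \<Rightarrow> 'a"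
  assumes \<mu>: "\<mu> \<in> P2" and c: "(\<lambda>x. c x - x) \<in> L2_rv \<mu>" "L2_norm \<mu> (\<lambda>x. c x - x) \<le> \<epsilon>"
    and \<epsilon>: "0 < \<epsilon>" "\<epsilon> < 1"
    and k: "k = (\<lambda>x. 2 * \<epsilon> * (norm x)\<^sup>2 + (2 / \<epsilon> + 2) * (norm (c x - x))\<^sup>2)"
  shows "integrable \<mu> k" "(\<integral>x. k x \<partial>\<mu>) \<le> 2 * \<epsilon> * (L2_norm \<mu> (\<lambda>x. x))\<^sup>2 + 4 * \<epsilon>"
proof -
  note i = L2_rv_integrable[OF P2_D(4)[OF \<mu>]] L2_rv_integrable[OF c(1)]
  show "integrable \<mu> k" unfolding k using i by (intro Bochner_Integration.integrable_add integrable_mult_right)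
  have "(2 / \<epsilon> + 2) * (L2_norm \<mu> (\<lambda>x. c x - x))\<^sup>2 \<le> (2 / \<epsilon> + 2) * \<epsilon>\<^sup>2"
    using c(2) \<epsilon> by (intro mult_left_mono power_mono) auto
  also have "\<dots> = 2 * \<epsilon> + 2 * \<epsilon> * \<epsilon>" using \<epsilon> by (simp add: power2_eq_square field_simps)
  also have "\<dots> \<le> 4 * \<epsilon>" using \<epsilon> mult_left_mono[of \<epsilon> 1 \<epsilon>] by simp
  finally have "(2 / \<epsilon> + 2) * (L2_norm \<mu> (\<lambda>x. c x - x))\<^sup>2 \<le> 4 * \<epsilon>" .
  moreover have "(\<integral>x. k x \<partial>\<mu>) = 2 * \<epsilon> * (L2_norm \<mu> (\<lambda>x. x))\<^sup>2 + (2 / \<epsilon> + 2) * (L2_norm \<mu> (\<lambda>x. c x - x))\<^sup>2"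
    unfolding k L2_norm_sq using i by (subst Bochner_Integration.integral_add) auto
  ultimately show "(\<integral>x. k x \<partial>\<mu>) \<le> 2 * \<epsilon> * (L2_norm \<mu> (\<lambda>x. x))\<^sup>2 + 4 * \<epsilon>" by simp
qed

lemma simple_cell_weights:
  assumes "prob_space \<mu>" "sets \<mu> = sets borel" "simple_function borel c"
  shows "(\<Sum>i\<in>range c. measure \<mu> {x. c x = i}) = 1"
    and "\<And>\<psi> :: 'v \<Rightarrow> real. (\<integral>x. \<psi> (c x) \<partial>\<mu>) = (\<Sum>i\<in>range c. \<psi> i * measure \<mu> {x. c x = i})"
    and "\<And>\<psi> :: 'v \<Rightarrow> real. integrable \<mu> (\<lambda>x. \<psi> (c x))"
proof -
  interpret prob_space \<mu> by fact
  have sp: "space \<mu> = UNIV" using sets_eq_imp_space_eq[OF assms(2)] by simp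
  have c: "simple_function \<mu> c" and fin: "finite (range c)"
    using assms by (auto simp: simple_function_def sp)
  show eq: "(\<integral>x. \<psi> (c x) \<partial>\<mu>) = (\<Sum>i\<in>range c. \<psi> i * measure \<mu> {x. c x = i})" for \<psi> :: "'v \<Rightarrow> real"
    using integral_finite_range[OF c fin, of \<psi>] by (simp add: sp)
  show "(\<Sum>i\<in>range c. measure \<mu> {x. c x = i}) = 1"
    using eq[of "\<lambda>_. 1"] prob_space by (simp add: sp)
  show "integrable \<mu> (\<lambda>x. \<psi> (c x))" for \<psi> :: "'v \<Rightarrow> real"
  proof -
    have "(\<lambda>x. \<psi> (c x)) \<in> L2_rv \<mu>"
      using prob_space_axioms simple_function_compose1[OF c] by (rule simple_function_L2)
    from L2_inner_integrable[OF this, of "\<lambda>_. 1"] show ?thesis by (simp add: L2_rv_def)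
  qed
qed

text \<open>Weak duality integrates the constraint against any coupling. For the converse the
  problem is solved on cells: the finite plan becomes a coupling whose cost is nearly optimal, and
  the finite potentials minus the cell errors become admissible for the original cost.\<close>

lemma WWsq_eq_W2sq:
  fixes X Y :: "'w \<Rightarrow> 'a::euclidean_space"
  assumes M: "prob_space M" and X: "X \<in> L2_rv M" and Y: "Y \<in> L2_rv M"
  shows "WWsq M X Y = W2sq (law M X) (law M Y)"
proof (rule order_antisym)
  let ?\<mu> = "law M X" and ?\<nu> = "law M Y"
  define S where "S = {(\<integral>\<omega>. \<psi> (X \<omega>) + \<phi> (Y \<omega>) \<partial>M) | \<psi> \<phi>. integrable ?\<mu> \<psi> \<and> integrable ?\<nu> \<phi> \<and>
            (\<forall>x y. \<psi> x + \<phi> y \<le> (norm (x - y))\<^sup>2)}"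
  have WW: "WWsq M X Y = Sup S" by (simp add: WWsq_def S_def)
  have \<mu>: "?\<mu> \<in> P2" and \<nu>: "?\<nu> \<in> P2" using law_in_P2[OF M] X Y by auto
  have mX [measurable]: "X \<in> borel_measurable M" and mY [measurable]: "Y \<in> borel_measurable M"
    using X Y by (auto simp: L2_rv_def)
  note XY = law_Pair_coupling(1)[OF M mX mY]
  have dual_value: "(\<integral>\<omega>. \<psi> (X \<omega>) + \<phi> (Y \<omega>) \<partial>M) = (\<integral>x. \<psi> x \<partial>?\<mu>) + (\<integral>y. \<phi> y \<partial>?\<nu>)"
    if "integrable ?\<mu> \<psi>" "integrable ?\<nu> \<phi>" for \<psi> \<phi> :: "'a \<Rightarrow> real"
  proof -
    have [measurable]: "\<psi> \<in> borel_measurable borel" "\<phi> \<in> borel_measurable borel"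
      using borel_measurable_integrable[OF that(1)] borel_measurable_integrable[OF that(2)] by simp_all
    have "(\<integral>\<omega>. \<psi> (X \<omega>) + \<phi> (Y \<omega>) \<partial>M) = (\<integral>z. \<psi> (fst z) + \<phi> (snd z) \<partial>law M (\<lambda>\<omega>. (X \<omega>, Y \<omega>)))"
      by (subst integral_distr) auto
    then show ?thesis using couplings_integral_sum(2)[OF XY that] by simp
  qed
  have upper: "s \<le> W2sq ?\<mu> ?\<nu>" if s: "s \<in> S" for s
  proof -
    obtain \<psi> \<phi> where int: "integrable ?\<mu> \<psi>" "integrable ?\<nu> \<phi>" and le: "\<And>x y. \<psi> x + \<phi> y \<le> (norm (x - y))\<^sup>2"
      and s_eq: "s = (\<integral>\<omega>. \<psi> (X \<omega>) + \<phi> (Y \<omega>) \<partial>M)"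
      using s by (auto simp: S_def)
    have "s \<le> transport_cost \<pi>" if \<pi>: "\<pi> \<in> couplings ?\<mu> ?\<nu>" for \<pi>
    proof -
      have "s = (\<integral>z. \<psi> (fst z) + \<phi> (snd z) \<partial>\<pi>)"
        unfolding s_eq dual_value[OF int] couplings_integral_sum(2)[OF \<pi> int] ..
      also have "\<dots> \<le> (\<integral>z. (norm (fst z - snd z))\<^sup>2 \<partial>\<pi>)"
        using couplings_integral_sum(1)[OF \<pi> int] le
          L2_rv_integrable[OF L2_rv_diff[OF couplings_L2(1)[OF \<pi> P2_D(4)[OF \<mu>]] couplings_L2(2)[OF \<pi> P2_D(4)[OF \<nu>]]]]
        by (intro integral_mono) auto
      finally show ?thesis by (simp add: transport_cost_eq L2_norm_sq)
    qed
    then show ?thesis unfolding W2sq_def using XY by (intro cINF_greatest) auto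
  qed
  have "0 \<in> S" unfolding S_def by (intro CollectI exI[of _ "\<lambda>_. 0"]) auto
  then have "S \<noteq> {}" by blast
  have bdd: "bdd_above S" using upper by (rule bdd_aboveI)
  have WW0: "0 \<le> Sup S" using \<open>0 \<in> S\<close> bdd by (rule cSup_upper)
  show "WWsq M X Y \<le> W2sq ?\<mu> ?\<nu>" unfolding WW using \<open>S \<noteq> {}\<close> upper by (rule cSup_least)
  define \<kappa> where "\<kappa> = (L2_norm ?\<mu> (\<lambda>x. x))\<^sup>2 + (L2_norm ?\<nu> (\<lambda>x. x))\<^sup>2"
  \<comment> \<open>\<open>2 * \<epsilon>\<close> is the distance of the two coordinates from their
    cell values. \<open>(2 * \<kappa> + 9) * \<epsilon>\<close> collects the finite duality gap
    \<open>\<epsilon>\<close>, twice \<open>4 * \<epsilon>\<close> from the cell errors, and their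
    second-moment terms.\<close>
  have lower: "W2sq ?\<mu> ?\<nu> \<le> (2 * \<epsilon> + sqrt (Sup S + (2 * \<kappa> + 9) * \<epsilon>))\<^sup>2" if \<epsilon>: "0 < \<epsilon>" "\<epsilon> < 1" for \<epsilon>
  proof -
    obtain c1 where c1: "simple_function borel c1" "(\<lambda>x. c1 x - x) \<in> L2_rv ?\<mu>" "L2_norm ?\<mu> (\<lambda>x. c1 x - x) \<le> \<epsilon>"
      by (rule P2_simple_approx[OF \<mu> \<epsilon>(1)]) (rule that)
    obtain c2 where c2: "simple_function borel c2" "(\<lambda>x. c2 x - x) \<in> L2_rv ?\<nu>" "L2_norm ?\<nu> (\<lambda>x. c2 x - x) \<le> \<epsilon>"
      by (rule P2_simple_approx[OF \<nu> \<epsilon>(1)]) (rule that)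
    have c1b [measurable]: "c1 \<in> borel_measurable borel" and c2b [measurable]: "c2 \<in> borel_measurable borel"
      using c1(1) c2(1) by (auto intro: borel_measurable_simple_function)
    define m where "m i = measure ?\<mu> {x. c1 x = i}" for i
    define n where "n j = measure ?\<nu> {x. c2 x = j}" for j
    define C where "C a b = (norm (a - b))\<^sup>2" for a b :: 'a
    note cw1 = simple_cell_weights[OF P2_D(1,2)[OF \<mu>] c1(1)] and cw2 = simple_cell_weights[OF P2_D(1,2)[OF \<nu>] c2(1)]
    have fin: "finite (range c1)" "finite (range c2)" using c1(1) c2(1) by (auto simp: simple_function_def)
    have mn: "\<And>i. 0 \<le> m i" "\<And>j. 0 \<le> n j" "sum m (range c1) = 1" "sum n (range c2) = 1"
      using cw1(1) cw2(1) by (auto simp: m_def n_def)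
    obtain p \<psi> \<phi> where p: "\<And>i j. 0 \<le> p i j"
      "\<And>i. i \<in> range c1 \<Longrightarrow> (\<Sum>j\<in>range c2. p i j) = m i" "\<And>j. j \<in> range c2 \<Longrightarrow> (\<Sum>i\<in>range c1. p i j) = n j"
      and dual: "\<And>i j. i \<in> range c1 \<Longrightarrow> j \<in> range c2 \<Longrightarrow> \<psi> i + \<phi> j \<le> C i j"
      and gap: "(\<Sum>i\<in>range c1. \<Sum>j\<in>range c2. p i j * C i j) \<le>
        (\<Sum>i\<in>range c1. \<psi> i * m i) + (\<Sum>j\<in>range c2. \<phi> j * n j) + \<epsilon>"
      by (rule finite_transport_duality[of "range c1" "range c2" m n C \<epsilon>, OF fin mn(1,3,2,4) _ \<epsilon>(1)])
         (simp add: C_def, rule that)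
    \<comment> \<open>Spreading the finite plan as a density restores the exact marginals while
      keeping the mass \<open>p i j\<close> of every product cell.\<close>
    define w where "w = (\<lambda>z. p (c1 (fst z)) (c2 (snd z)) /
      (measure ?\<mu> {x. c1 x = c1 (fst z)} * measure ?\<nu> {x. c2 x = c2 (snd z)}))"
    define \<rho> where "\<rho> = density (?\<mu> \<Otimes>\<^sub>M ?\<nu>) (\<lambda>z. ennreal (w z))"
    note glue = glue_finite[of ?\<mu> ?\<nu> c1 c2 p, OF P2_D(1)[OF \<mu>] P2_D(1)[OF \<nu>] P2_D(2)[OF \<mu>] P2_D(2)[OF \<nu>]
        c1(1) c2(1) p(1) p(2)[unfolded m_def] p(3)[unfolded n_def] w_def \<rho>_def]
    have \<rho>: "\<rho> \<in> couplings ?\<mu> ?\<nu>" using glue(1-4) by (simp add: couplings_def)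
    interpret R: prob_space \<rho> by (rule glue(1))
    have [measurable_cong]: "sets \<rho> = sets borel" by (rule glue(2))
    have sp\<rho>: "space \<rho> = UNIV" by (rule couplingsD(3)[OF \<rho>])
    let ?W = "\<lambda>z. (c1 (fst z), c2 (snd z))"
    have W: "simple_function \<rho> ?W"
      by (intro simple_function_Pair simple_function_measurable_comp[OF c1(1)] simple_function_measurable_comp[OF c2(1)]
          couplings_fst_measurable[OF \<rho>])
    have cc: "(\<lambda>z. c1 (fst z) - c2 (snd z)) \<in> L2_rv \<rho>"
      using R.prob_space_axioms simple_function_compose1[OF W, of "\<lambda>v. fst v - snd v"] by (intro simple_function_L2) auto
    have "(L2_norm \<rho> (\<lambda>z. c1 (fst z) - c2 (snd z)))\<^sup>2 = (\<Sum>v\<in>range c1 \<times> range c2. C (fst v) (snd v) * measure \<rho> {z. ?W z = v})"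
      unfolding L2_norm_sq
      using R.integral_finite_range[where \<phi> = "\<lambda>v. C (fst v) (snd v)" and W = ?W and R = "range c1 \<times> range c2", OF W] fin
      by (simp add: sp\<rho> C_def)
    also have "\<dots> = (\<Sum>v\<in>range c1 \<times> range c2. p (fst v) (snd v) * C (fst v) (snd v))"
    proof (rule sum.cong[OF refl])
      fix v assume "v \<in> range c1 \<times> range c2"
      then have "measure \<rho> {z. ?W z = v} = p (fst v) (snd v)"
        using glue(6)[of "fst v" "snd v"] by (auto simp: prod_eq_iff)
      then show "C (fst v) (snd v) * measure \<rho> {z. ?W z = v} = p (fst v) (snd v) * C (fst v) (snd v)" by simp
    qed
    also have "\<dots> = (\<Sum>i\<in>range c1. \<Sum>j\<in>range c2. p i j * C i j)"
      by (simp add: sum.cartesian_product case_prod_unfold)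
    also have "\<dots> \<le> (\<integral>x. \<psi> (c1 x) \<partial>?\<mu>) + (\<integral>y. \<phi> (c2 y) \<partial>?\<nu>) + \<epsilon>"
      using gap unfolding cw1(2) cw2(2) m_def n_def .
    finally have primal: "(L2_norm \<rho> (\<lambda>z. c1 (fst z) - c2 (snd z)))\<^sup>2 \<le> (\<integral>x. \<psi> (c1 x) \<partial>?\<mu>) + (\<integral>y. \<phi> (c2 y) \<partial>?\<nu>) + \<epsilon>" .
    define k1 where "k1 = (\<lambda>x. 2 * \<epsilon> * (norm x)\<^sup>2 + (2 / \<epsilon> + 2) * (norm (c1 x - x))\<^sup>2)"
    define k2 where "k2 = (\<lambda>y. 2 * \<epsilon> * (norm y)\<^sup>2 + (2 / \<epsilon> + 2) * (norm (c2 y - y))\<^sup>2)"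
    note k1 = cell_error_integral[OF \<mu> c1(2,3) \<epsilon> k1_def] and k2 = cell_error_integral[OF \<nu> c2(2,3) \<epsilon> k2_def]
    have int1: "integrable ?\<mu> (\<lambda>x. \<psi> (c1 x) - k1 x)" and int2: "integrable ?\<nu> (\<lambda>y. \<phi> (c2 y) - k2 y)"
      using cw1(3)[of \<psi>] cw2(3)[of \<phi>] k1(1) k2(1) by (auto intro: Bochner_Integration.integrable_diff)
    have feas: "(\<psi> (c1 x) - k1 x) + (\<phi> (c2 y) - k2 y) \<le> (norm (x - y))\<^sup>2" for x y
      using dual[of "c1 x" "c2 y"] norm_sq_approx_le[OF \<epsilon>(1), of "c1 x" "c2 y" x y] by (simp add: C_def k1_def k2_def)
    have "(\<integral>\<omega>. (\<psi> (c1 (X \<omega>)) - k1 (X \<omega>)) + (\<phi> (c2 (Y \<omega>)) - k2 (Y \<omega>)) \<partial>M) \<in> S"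
      unfolding S_def using int1 int2 feas
      by (intro CollectI exI[of _ "\<lambda>x. \<psi> (c1 x) - k1 x"] exI[of _ "\<lambda>y. \<phi> (c2 y) - k2 y"]) auto
    then have "(\<integral>\<omega>. (\<psi> (c1 (X \<omega>)) - k1 (X \<omega>)) + (\<phi> (c2 (Y \<omega>)) - k2 (Y \<omega>)) \<partial>M) \<le> Sup S"
      using bdd by (rule cSup_upper)
    then have "(\<integral>x. \<psi> (c1 x) - k1 x \<partial>?\<mu>) + (\<integral>y. \<phi> (c2 y) - k2 y \<partial>?\<nu>) \<le> Sup S"
      using dual_value[OF int1 int2] by simp
    then have "(\<integral>x. \<psi> (c1 x) \<partial>?\<mu>) + (\<integral>y. \<phi> (c2 y) \<partial>?\<nu>) \<le> Sup S + (\<integral>x. k1 x \<partial>?\<mu>) + (\<integral>y. k2 y \<partial>?\<nu>)"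
      using Bochner_Integration.integral_diff[OF cw1(3)[of \<psi>] k1(1)]
        Bochner_Integration.integral_diff[OF cw2(3)[of \<phi>] k2(1)] by linarith
    then have "(L2_norm \<rho> (\<lambda>z. c1 (fst z) - c2 (snd z)))\<^sup>2 \<le> Sup S + (2 * \<kappa> + 9) * \<epsilon>"
      using primal k1(2) k2(2) unfolding \<kappa>_def by (simp add: algebra_simps)
    then have mid: "L2_norm \<rho> (\<lambda>z. c1 (fst z) - c2 (snd z)) \<le> sqrt (Sup S + (2 * \<kappa> + 9) * \<epsilon>)"
      by (rule real_le_rsqrt)
    have x: "(\<lambda>z. fst z) \<in> L2_rv \<rho>" and y: "(\<lambda>z. snd z) \<in> L2_rv \<rho>"
      using couplings_L2(1)[OF \<rho> P2_D(4)[OF \<mu>]] couplings_L2(2)[OF \<rho> P2_D(4)[OF \<nu>]] by simp_all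
    have dx: "(\<lambda>z. c1 (fst z) - fst z) \<in> L2_rv \<rho>" "L2_norm \<rho> (\<lambda>z. c1 (fst z) - fst z) \<le> \<epsilon>"
      using couplings_L2(1)[OF \<rho> c1(2)] couplings_L2_norm(1)[OF \<rho>, of "\<lambda>x. c1 x - x"] c1(3) by simp_all
    have dy: "(\<lambda>z. c2 (snd z) - snd z) \<in> L2_rv \<rho>" "L2_norm \<rho> (\<lambda>z. c2 (snd z) - snd z) \<le> \<epsilon>"
      using couplings_L2(2)[OF \<rho> c2(2)] couplings_L2_norm(2)[OF \<rho>, of "\<lambda>x. c2 x - x"] c2(3) by simp_all
    have cx: "(\<lambda>z. c1 (fst z)) \<in> L2_rv \<rho>" and cy: "(\<lambda>z. c2 (snd z)) \<in> L2_rv \<rho>"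
      using L2_rv_add[OF dx(1) x] L2_rv_add[OF dy(1) y] by simp_all
    have "L2_norm \<rho> (\<lambda>z. fst z - snd z) \<le> 2 * \<epsilon> + sqrt (Sup S + (2 * \<kappa> + 9) * \<epsilon>)"
      using L2_triangle_diff[OF x cx y] L2_triangle_diff[OF cx cy y] dx(2) dy(2) mid
      unfolding L2_norm_minus_commute[of \<rho> fst "\<lambda>z. c1 (fst z)"] by linarith
    then have "(L2_norm \<rho> (\<lambda>z. fst z - snd z))\<^sup>2 \<le> (2 * \<epsilon> + sqrt (Sup S + (2 * \<kappa> + 9) * \<epsilon>))\<^sup>2"
      by (rule power_mono) simp
    then show ?thesis using W2sq_le[OF \<rho>] by (simp add: transport_cost_eq)
  qed
  \<comment> \<open>The exponent \<open>Suc k\<close> keeps the parameter strictly below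
    \<open>1\<close>, as \<open>lower\<close> requires.\<close>
  have "(\<lambda>k. (2 * (1/2) ^ Suc k + sqrt (Sup S + (2 * \<kappa> + 9) * (1/2) ^ Suc k))\<^sup>2) \<longlonglongrightarrow>
      (2 * 0 + sqrt (Sup S + (2 * \<kappa> + 9) * 0))\<^sup>2"
  proof -
    have "(\<lambda>k. (1/2::real) ^ Suc k) \<longlonglongrightarrow> 0"
      by (rule LIMSEQ_Suc) (intro LIMSEQ_realpow_zero, auto)
    then show ?thesis by (intro tendsto_intros)
  qed
  then have "W2sq ?\<mu> ?\<nu> \<le> (2 * 0 + sqrt (Sup S + (2 * \<kappa> + 9) * 0))\<^sup>2"
  proof (rule LIMSEQ_le_const)
    have "W2sq ?\<mu> ?\<nu> \<le> (2 * (1/2) ^ Suc k + sqrt (Sup S + (2 * \<kappa> + 9) * (1/2) ^ Suc k))\<^sup>2" for k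
      by (rule lower) (simp, rule power_Suc_less_one, simp_all)
    then show "\<exists>N. \<forall>k\<ge>N. W2sq ?\<mu> ?\<nu> \<le> (2 * (1/2) ^ Suc k + sqrt (Sup S + (2 * \<kappa> + 9) * (1/2) ^ Suc k))\<^sup>2" by blast
  qed
  \<comment> \<open>Nonnegativity of \<open>Sup S\<close>, from the zero potentials, lets the square
    undo the square root.\<close>
  then show "W2sq ?\<mu> ?\<nu> \<le> WWsq M X Y" using WW0 by (simp add: WW)
qed

theorem theorem2p2:
  fixes M :: "'w measure" and \<mu> \<nu> :: "(real ^ 'd) measure"
  assumes "prob_space M" and "atomless M"
    and "\<mu> \<in> P2" and "\<nu> \<in> P2"
  shows "(L_differentiable_at M (\<lambda>\<sigma>. W2sq \<sigma> \<nu>) \<mu> \<longleftrightarrow>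
           (\<exists>T \<in> borel_measurable borel.
              optimal_couplings \<mu> \<nu> = {distr \<mu> borel (\<lambda>x. (x, T x))})) \<and>
         (\<forall>T \<in> borel_measurable borel.
            optimal_couplings \<mu> \<nu> = {distr \<mu> borel (\<lambda>x. (x, T x))} \<longrightarrow>
            (\<forall>X \<in> L2_rv M. \<forall>Y \<in> L2_rv M. law M X = \<mu> \<longrightarrow> law M Y = \<nu> \<longrightarrow>
               has_frechet_derivative M (\<lambda>Z. WWsq M Z Y) X (\<lambda>\<omega>. 2 *\<^sub>R (X \<omega> - T (X \<omega>)))))"
proof (intro conjI iffI ballI impI)
  assume "L_differentiable_at M (\<lambda>\<sigma>. W2sq \<sigma> \<nu>) \<mu>"
  then obtain X where "X \<in> L2_rv M" "law M X = \<mu>" "frechet_differentiable_at M (L2_lift M (\<lambda>\<sigma>. W2sq \<sigma> \<nu>)) X"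
    by (auto simp: L_differentiable_at_def)
  then show "\<exists>T \<in> borel_measurable borel. optimal_couplings \<mu> \<nu> = {distr \<mu> borel (\<lambda>x. (x, T x))}"
    by (rule differentiable_imp_optimal_map[OF assms])
next
  assume "\<exists>T \<in> borel_measurable borel. optimal_couplings \<mu> \<nu> = {distr \<mu> borel (\<lambda>x. (x, T x))}"
  then obtain T where T: "T \<in> borel_measurable borel" "optimal_couplings \<mu> \<nu> = {distr \<mu> borel (\<lambda>x. (x, T x))}" by blast
  \<comment> \<open>L-differentiability asks for one variable of law \<open>\<mu>\<close> only, and
    atomlessness supplies it.\<close>
  obtain X where X: "X \<in> L2_rv M" "law M X = \<mu>" using atomless_rv_exists[OF assms(1-3)] .
  have "has_frechet_derivative M (L2_lift M (\<lambda>\<sigma>. W2sq \<sigma> \<nu>)) X (\<lambda>\<omega>. 2 *\<^sub>R (X \<omega> - T (X \<omega>)))"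
    unfolding L2_lift_def[abs_def] by (rule optimal_map_frechet_derivative[OF assms T X])
  then show "L_differentiable_at M (\<lambda>\<sigma>. W2sq \<sigma> \<nu>) \<mu>"
    using X unfolding L_differentiable_at_def frechet_differentiable_at_def has_frechet_derivative_def by blast
next
  fix T X Y assume T: "T \<in> borel_measurable borel" "optimal_couplings \<mu> \<nu> = {distr \<mu> borel (\<lambda>x. (x, T x))}"
    and X: "X \<in> L2_rv M" and Y: "Y \<in> L2_rv M" and law: "law M X = \<mu>" "law M Y = \<nu>"
  \<comment> \<open>The two functionals are identified on \<open>L2_rv M\<close> only; that is
    enough, since the differential looks at \<open>X\<close> and \<open>X + H\<close> with
    \<open>H\<close> in \<open>L2_rv M\<close>.\<close>
  have "WWsq M Z Y = W2sq (law M Z) \<nu>" if "Z \<in> L2_rv M" for Z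
    using WWsq_eq_W2sq[OF assms(1) that Y] law(2) by simp
  then show "has_frechet_derivative M (\<lambda>Z. WWsq M Z Y) X (\<lambda>\<omega>. 2 *\<^sub>R (X \<omega> - T (X \<omega>)))"
    using optimal_map_frechet_derivative[OF assms T X law(1)] X
    by (simp add: has_frechet_derivative_def has_L2_differential_def L2_rv_add)
qed

end
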